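(* Let $F_d\in\mathcal{A}$ for every $d\in\mathbb{N}$ and let $\widetilde{\mathrm{APP}}$ be the corresponding multivariate approximation problem. If $\widetilde{\mathrm{APP}}$ is exponentially weakly tractable for the class $\Lambda^{\mathrm{all}}$, then it is exponentially weakly tractable for the class $\Lambda^{\mathrm{std}}$. Likewise, if $\widetilde{\mathrm{APP}}$ is exponentially uniformly weakly tractable for the class $\Lambda^{\mathrm{all}}$, then it is exponentially uniformly weakly tractable for the class $\Lambda^{\mathrm{std}}$.
   Context: $\mathbb{N}=\{1,2,\dots\}$. The class $\mathcal{A}$ consists of all separable Banach spaces $F$ of real- or complex-valued functions defined on some nonempty set $\mathcal{D}$ such that function evaluation $f\mapsto f(x)$ is continuous on $F$ for each $x\in\mathcal{D}$ and $F$ is continuously embedded in $L_2=L_2(\mathcal{D},\mu)$ for some measure $\mu$ on $\mathcal{D}$ (the set $\mathcal{D}$ and the measure $\mu$ are part of the data associated with $F$). $B_F$ denotes the closed unit ball of $F$ and $F^*$ the space of continuous linear functionals on $F$. For $n\in\mathbb{N}$ define - $g_n(F,L_2):=\inf_{x_1,\dots,x_n\in\mathcal{D},\ \phi\colon\mathbb{R}^n\to L_2}\ \sup_{f\in B_F}\bigl\|f-\phi(f(x_1),\dots,f(x_n))\bigr\|_{L_2}$, where $\phi$ is an arbitrary map; - $c_n(F,L_2):=\inf_{\phi\colon\mathbb{R}^n\to L_2,\ N\in(F^* )^n}\ \sup_{f\in B_F}\|f-\phi(N(f))\|_{L_2}$, where $\phi$ is an arbitrary map and $N(f)=(N_1(f),\dots,N_n(f))$.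 (For complex-valued functions, $\mathbb{R}^n$ is replaced by $\mathbb{C}^n$.) Define $n^{\mathrm{std}}(\varepsilon,F):=\min\{n: g_n(F,L_2)\le\varepsilon\}$ and $n^{\mathrm{all}}(\varepsilon,F):=\min\{n: c_n(F,L_2)\le\varepsilon\}$, with $n\in\mathbb{N}$ and $\min\emptyset=\infty$. A multivariate approximation problem is a sequence of embeddings $\widetilde{\mathrm{APP}}=(\mathrm{APP}_d\colon F_d\to L_2(\mathcal{D}_d,\mu_d))_{d\in\mathbb{N}}$, $\mathrm{APP}_d(f)=f$, with $F_d\in\mathcal{A}$ and associated $\mathcal{D}_d,\mu_d$. For $\mathrm{x}\in\{\mathrm{std},\mathrm{all}\}$, $\widetilde{\mathrm{APP}}$ is called - exponentially uniformly weakly tractable for the class $\Lambda^{\mathrm{x}}$ if for all $\alpha,\beta>0$ we have $\lim_{d+\varepsilon^{-1}\to\infty}\frac{\ln n^{\mathrm{x}}(\varepsilon,F_d)}{d^{\alpha}+(1+\ln\varepsilon^{-1})^{\beta}}=0$; - exponentially weakly tractable for the class $\Lambda^{\mathrm{x}}$ if $\lim_{d+\varepsilon^{-1}\to\infty}\frac{\ln n^{\mathrm{x}}(\varepsilon,F_d)}{d+(1+\ln\varepsilon^{-1})}=0$. The limits are taken over $d\in\mathbb{N}$ and $\varepsilon\in(0,1)$. *)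

theory Defs
  imports "HOL-Analysis.Analysis"
begin

section \<open>Banach spaces of functions\<close>

text \<open>
  A space of functions on a set together with its data. The scalar field is a subset of the
  complex numbers, either \<open>\<real>\<close> or \<open>UNIV\<close>, so that real- and complex-valued spaces (also mixed
  within one sequence of spaces) are covered. The set on which the functions live is the space of
  the measure. Functions on it are represented by total functions that vanish outside of it.
\<close>

record 'a fun_space =
  scalars :: "complex set"
  funs :: "('a \<Rightarrow> complex) set"
  fnorm :: "('a \<Rightarrow> complex) \<Rightarrow> real"
  meas :: "'a measure"

abbreviation domain_of :: "'a fun_space \<Rightarrow> 'a set" where
  "domain_of F \<equiv> space (meas F)"

definition normed_fun_space :: "'a fun_space \<Rightarrow> bool" where
  "normed_fun_space F \<longleftrightarrow>
     (scalars F = \<real> \<or> scalars F = UNIV) \<and>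
     domain_of F \<noteq> {} \<and>
     (\<forall>f\<in>funs F. (\<forall>x\<in>domain_of F. f x \<in> scalars F) \<and> (\<forall>x. x \<notin> domain_of F \<longrightarrow> f x = 0)) \<and>
     (\<lambda>x. 0) \<in> funs F \<and>
     (\<forall>f\<in>funs F. \<forall>g\<in>funs F. (\<lambda>x. f x + g x) \<in> funs F) \<and>
     (\<forall>c\<in>scalars F. \<forall>f\<in>funs F. (\<lambda>x. c * f x) \<in> funs F) \<and>
     (\<forall>f\<in>funs F. 0 \<le> fnorm F f) \<and>
     (\<forall>f\<in>funs F. fnorm F f = 0 \<longleftrightarrow> f = (\<lambda>x. 0)) \<and>
     (\<forall>c\<in>scalars F. \<forall>f\<in>funs F. fnorm F (\<lambda>x. c * f x) = cmod c * fnorm F f) \<and>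
     (\<forall>f\<in>funs F. \<forall>g\<in>funs F. fnorm F (\<lambda>x. f x + g x) \<le> fnorm F f + fnorm F g)"

text \<open>
  The locale \<open>Metric_space\<close> requires symmetry and nonnegativity also off the carrier, hence the
  default value.
\<close>

definition fdist :: "'a fun_space \<Rightarrow> ('a \<Rightarrow> complex) \<Rightarrow> ('a \<Rightarrow> complex) \<Rightarrow> real" where
  "fdist F f g = (if f \<in> funs F \<and> g \<in> funs F then fnorm F (\<lambda>x. f x - g x) else 0)"

abbreviation ftopology :: "'a fun_space \<Rightarrow> ('a \<Rightarrow> complex) topology" where
  "ftopology F \<equiv> Metric_space.mtopology (funs F) (fdist F)"

lemma
  assumes "normed_fun_space F"
  shows minus_one_in_scalars: "-1 \<in> scalars F"
    and fun_space_add: "\<And>f g. f \<in> funs F \<Longrightarrow> g \<in> funs F \<Longrightarrow> (\<lambda>x. f x + g x) \<in> funs F"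
    and fun_space_scale: "\<And>c f. c \<in> scalars F \<Longrightarrow> f \<in> funs F \<Longrightarrow> (\<lambda>x. c * f x) \<in> funs F"
    and fnorm_nonneg: "\<And>f. f \<in> funs F \<Longrightarrow> 0 \<le> fnorm F f"
    and fnorm_eq_0_iff: "\<And>f. f \<in> funs F \<Longrightarrow> fnorm F f = 0 \<longleftrightarrow> f = (\<lambda>x. 0)"
    and fnorm_scale: "\<And>c f. c \<in> scalars F \<Longrightarrow> f \<in> funs F \<Longrightarrow>
           fnorm F (\<lambda>x. c * f x) = cmod c * fnorm F f"
    and fnorm_triangle: "\<And>f g. f \<in> funs F \<Longrightarrow> g \<in> funs F \<Longrightarrow>
           fnorm F (\<lambda>x. f x + g x) \<le> fnorm F f + fnorm F g"
  using assms by (auto simp: normed_fun_space_def)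

lemma fun_space_diff:
  assumes F: "normed_fun_space F" and fg: "f \<in> funs F" "g \<in> funs F"
  shows "(\<lambda>x. f x - g x) \<in> funs F"
  using fun_space_add[OF F fg(1) fun_space_scale[OF F minus_one_in_scalars[OF F] fg(2)]]
  by simp

lemma Metric_space_fun_space:
  assumes F: "normed_fun_space F"
  shows "Metric_space (funs F) (fdist F)"
proof
  note diff = fun_space_diff[OF F]
  have neg: "fnorm F (\<lambda>x. g x - f x) = fnorm F (\<lambda>x. f x - g x)"
    if "f \<in> funs F" "g \<in> funs F" for f g
    using fnorm_scale[OF F minus_one_in_scalars[OF F] diff[OF that]] by simp
  show "0 \<le> fdist F f g" for f g
    by (simp add: fdist_def fnorm_nonneg[OF F] diff)
  show "fdist F f g = fdist F g f" for f g
    using neg[of f g] by (auto simp: fdist_def)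
  show "fdist F f g = 0 \<longleftrightarrow> f = g" if "f \<in> funs F" "g \<in> funs F" for f g
    using that by (simp add: fdist_def fnorm_eq_0_iff[OF F] diff fun_eq_iff)
  show "fdist F f h \<le> fdist F f g + fdist F g h"
    if "f \<in> funs F" "g \<in> funs F" "h \<in> funs F" for f g h
    using fnorm_triangle[OF F diff[OF that(1,2)] diff[OF that(2,3)]] that
    by (simp add: fdist_def)
qed

section \<open>The target space and the class of admissible spaces\<close>

text \<open>
  The elements of \<open>Ltwo\<close> are functions instead of equivalence classes; errors below only depend on
  the equivalence class.
\<close>

definition Ltwo :: "'a fun_space \<Rightarrow> ('a \<Rightarrow> complex) set" where
  "Ltwo F = {h \<in> borel_measurable (meas F).
     (\<forall>x\<in>domain_of F. h x \<in> scalars F) \<and> integrable (meas F) (\<lambda>x. (cmod (h x))\<^sup>2)}"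

definition Ltwo_norm :: "'a measure \<Rightarrow> ('a \<Rightarrow> complex) \<Rightarrow> real" where
  "Ltwo_norm M h = sqrt (\<integral>x. (cmod (h x))\<^sup>2 \<partial>M)"

definition class_A :: "'a fun_space set" where
  "class_A = {F. normed_fun_space F \<and>
     Metric_space.mcomplete (funs F) (fdist F) \<and>
     separable_space (ftopology F) \<and>
     (\<forall>x\<in>domain_of F. continuous_map (ftopology F) euclidean (\<lambda>f. f x)) \<and>
     funs F \<subseteq> Ltwo F \<and>
     (\<exists>C. \<forall>f\<in>funs F. Ltwo_norm (meas F) f \<le> C * fnorm F f)}"

definition unit_ball :: "'a fun_space \<Rightarrow> ('a \<Rightarrow> complex) set" where
  "unit_ball F = {f \<in> funs F. fnorm F f \<le> 1}"

definition dual :: "'a fun_space \<Rightarrow> (('a \<Rightarrow> complex) \<Rightarrow> complex) set" where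
  "dual F = {N. (\<forall>f\<in>funs F. N f \<in> scalars F) \<and>
     (\<forall>f\<in>funs F. \<forall>g\<in>funs F. N (\<lambda>x. f x + g x) = N f + N g) \<and>
     (\<forall>c\<in>scalars F. \<forall>f\<in>funs F. N (\<lambda>x. c * f x) = c * N f) \<and>
     continuous_map (ftopology F) euclidean N}"

section \<open>Minimal errors and information complexity\<close>

abbreviation vectors :: "'a fun_space \<Rightarrow> nat \<Rightarrow> (nat \<Rightarrow> complex) set" where
  "vectors F n \<equiv> {1..n} \<rightarrow>\<^sub>E scalars F"

text \<open>
  The errors are extended nonnegative reals, since the worst-case error of an arbitrary map may be
  infinite.
\<close>

definition g_err :: "nat \<Rightarrow> 'a fun_space \<Rightarrow> ennreal" where
  "g_err n F = (INF (x, \<phi>) \<in> ({1..n} \<rightarrow> domain_of F) \<times> (vectors F n \<rightarrow> Ltwo F).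
     SUP f \<in> unit_ball F. ennreal (Ltwo_norm (meas F) (\<lambda>t. f t - \<phi> (\<lambda>i\<in>{1..n}. f (x i)) t)))"

definition c_err :: "nat \<Rightarrow> 'a fun_space \<Rightarrow> ennreal" where
  "c_err n F = (INF (\<phi>, N) \<in> (vectors F n \<rightarrow> Ltwo F) \<times> ({1..n} \<rightarrow> dual F).
     SUP f \<in> unit_ball F. ennreal (Ltwo_norm (meas F) (\<lambda>t. f t - \<phi> (\<lambda>i\<in>{1..n}. N i f) t)))"

datatype info_class = Lambda_std | Lambda_all

fun min_err :: "info_class \<Rightarrow> nat \<Rightarrow> 'a fun_space \<Rightarrow> ennreal" where
  "min_err Lambda_std n F = g_err n F"
| "min_err Lambda_all n F = c_err n F"

text \<open>The infimum in \<open>enat\<close> is a minimum for nonempty sets and \<open>\<infinity>\<close> for the empty set.\<close>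

definition info_complexity :: "info_class \<Rightarrow> real \<Rightarrow> 'a fun_space \<Rightarrow> enat" where
  "info_complexity \<Lambda> \<epsilon> F = Inf (enat ` {n. 1 \<le> n \<and> min_err \<Lambda> n F \<le> ennreal \<epsilon>})"

section \<open>Tractability\<close>

definition ln_enat :: "enat \<Rightarrow> ereal" where
  "ln_enat n = (case n of enat k \<Rightarrow> ereal (ln (real k)) | \<infinity> \<Rightarrow> \<infinity>)"

definition tract_filter :: "(nat \<times> real) filter" where
  "tract_filter =
     inf (filtercomap (\<lambda>(d, \<epsilon>). real d + inverse \<epsilon>) at_top) (principal ({1..} \<times> {0<..<1}))"

definition exp_weakly_tractable :: "info_class \<Rightarrow> (nat \<Rightarrow> 'a fun_space) \<Rightarrow> bool" where
  "exp_weakly_tractable \<Lambda> F \<longleftrightarrow>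
     ((\<lambda>(d, \<epsilon>). ln_enat (info_complexity \<Lambda> \<epsilon> (F d)) / ereal (real d + (1 + ln (inverse \<epsilon>))))
        \<longlongrightarrow> 0) tract_filter"

definition exp_unif_weakly_tractable :: "info_class \<Rightarrow> (nat \<Rightarrow> 'a fun_space) \<Rightarrow> bool" where
  "exp_unif_weakly_tractable \<Lambda> F \<longleftrightarrow>
     (\<forall>\<alpha> > 0. \<forall>\<beta> > 0.
       ((\<lambda>(d, \<epsilon>). ln_enat (info_complexity \<Lambda> \<epsilon> (F d)) /
            ereal (real d powr \<alpha> + (1 + ln (inverse \<epsilon>)) powr \<beta>))
          \<longlongrightarrow> 0) tract_filter)"

end

theory Submission
  imports Defs "Jordan_Normal_Form.Determinant"
begin

text \<open>
  If a set of functionals has a kernel on which the \<open>L2\<close> norm is at most \<open>\<rho>\<close> times the norm of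
  \<open>F\<close>, an approximate Auerbach basis gives a space of dimension \<open>n\<close> approximating the unit ball up
  to \<open>(2 n + 1) \<rho>\<close>. Taking accuracies that decrease geometrically and orthonormalising all these
  spaces successively yields functions \<open>e j\<close> with \<open>f x = (\<Sum>j. \<langle>f, e j\<rangle> * e j x)\<close> for all \<open>f\<close> and almost
  all \<open>x\<close>. The first \<open>n\<close> of them are recovered from \<open>n\<close> well-chosen function values, where the
  remaining ones act as noise whose energy is amplified by the factor \<open>n + 1\<close> at most. Hence
  sampling costs only polynomial factors in \<open>n\<close> and powers of \<open>\<epsilon>\<close>, and these disappear in the
  logarithm of the complexity. For \<open>\<beta> > 1\<close> the number of functionals need not be polynomial in
  \<open>1 / \<epsilon>\<close>, but the assumption with \<open>min \<beta> 1\<close> in place of \<open>\<beta>\<close> is at our disposal.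
\<close>

section \<open>Square-integrable functions\<close>

text \<open>Since \<open>\<phi>\<close> is arbitrary, only kernels matter: a function annihilated by
  all functionals has the same data as its negative, and conversely it is optimal up to a factor 2
  to answer with any element of the unit ball that has the observed data. So everything reduces to
  bounding the \<open>L2\<close> norm of functions in the unit ball that vanish at the sample
  points. Two obstacles shape the proof: \<open>F\<close> carries no inner product, and
  \<open>L2\<close> norms say nothing about point values. Weights overcome both. The coefficients of
  \<open>f\<close> that belong to the accuracy with index \<open>k + 1\<close> have energy at most
  \<open>\<eta> k\<close>, the squared error of the preceding spaces. Divided by the weight
  \<open>\<eta> k * 2 ^ Suc k\<close>, they have total energy at most 1, while the weights stay
  summable. Hence the unit ball lies in a finite-dimensional space plus an ellipsoid with summable
  squared semiaxes, where Cauchy-Schwarz controls point values. The price is a factor of order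
  \<open>n (k + 1) * (n k)^2\<close> in front of the squared accuracies, for which their decay has
  to pay.\<close>

definition square_integrable :: "'a measure \<Rightarrow> ('a \<Rightarrow> complex) set" where
  "square_integrable M = {f \<in> borel_measurable M. integrable M (\<lambda>x. (cmod (f x))\<^sup>2)}"

text \<open>Scalars are complex here even for real spaces. Orthonormal functions only serve to
  estimate norms, and the reconstruction map returns elements of \<open>F\<close>, so nothing built
  from this form has to be real-valued.\<close>

definition L2_inner :: "'a measure \<Rightarrow> ('a \<Rightarrow> complex) \<Rightarrow> ('a \<Rightarrow> complex) \<Rightarrow> complex" where
  "L2_inner M f g = (\<integral>x. f x * cnj (g x) \<partial>M)"

definition L2_norm_sq :: "'a measure \<Rightarrow> ('a \<Rightarrow> complex) \<Rightarrow> real" where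
  "L2_norm_sq M f = (\<integral>x. (cmod (f x))\<^sup>2 \<partial>M)"

lemma square_integrable_measurable [measurable_dest]:
  "f \<in> square_integrable M \<Longrightarrow> f \<in> borel_measurable M"
  by (simp add: square_integrable_def)

lemma square_integrable_integrable:
  "f \<in> square_integrable M \<Longrightarrow> integrable M (\<lambda>x. (cmod (f x))\<^sup>2)"
  by (simp add: square_integrable_def)

lemma L2_norm_sq_nonneg [simp]: "0 \<le> L2_norm_sq M f"
  by (simp add: L2_norm_sq_def)

lemma cmod_add_squared_le: "(cmod (a + b))\<^sup>2 \<le> 2 * (cmod a)\<^sup>2 + 2 * (cmod b)\<^sup>2"
proof -
  have "(cmod (a + b))\<^sup>2 \<le> (cmod a + cmod b)\<^sup>2"
    by (intro power_mono norm_triangle_ineq) auto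
  also have "\<dots> \<le> 2 * (cmod a)\<^sup>2 + 2 * (cmod b)\<^sup>2"
    using zero_le_power2[of "cmod a - cmod b"] by (simp add: power2_eq_square algebra_simps)
  finally show ?thesis .
qed

lemma mult_le_sum_squares:
  fixes a b :: real
  assumes "0 \<le> a" "0 \<le> b"
  shows "a * b \<le> a\<^sup>2 + b\<^sup>2"
  using zero_le_power2[of "a - b"] mult_nonneg_nonneg[OF assms]
  unfolding power2_diff by linarith

lemma square_integrable_zero [simp]: "(\<lambda>x. 0) \<in> square_integrable M"
  by (simp add: square_integrable_def)

lemma square_integrable_add:
  assumes "f \<in> square_integrable M" "g \<in> square_integrable M"
  shows "(\<lambda>x. f x + g x) \<in> square_integrable M"
proof -
  note [measurable] = assms[THEN square_integrable_measurable]
  have "integrable M (\<lambda>x. 2 * (cmod (f x))\<^sup>2 + 2 * (cmod (g x))\<^sup>2)"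
    using assms[THEN square_integrable_integrable] by auto
  then have "integrable M (\<lambda>x. (cmod (f x + g x))\<^sup>2)"
    by (rule Bochner_Integration.integrable_bound) (auto simp: cmod_add_squared_le)
  then show ?thesis by (simp add: square_integrable_def)
qed

lemma square_integrable_scale:
  assumes "f \<in> square_integrable M"
  shows "(\<lambda>x. c * f x) \<in> square_integrable M"
  using assms by (auto simp: square_integrable_def norm_mult power_mult_distrib)

lemma square_integrable_diff:
  assumes "f \<in> square_integrable M" "g \<in> square_integrable M"
  shows "(\<lambda>x. f x - g x) \<in> square_integrable M"
  using square_integrable_add[OF assms(1) square_integrable_scale[OF assms(2), of "-1"]] by simp

lemma square_integrable_sum:
  assumes "\<And>i. i \<in> I \<Longrightarrow> f i \<in> square_integrable M"
  shows "(\<lambda>x. \<Sum>i\<in>I. f i x) \<in> square_integrable M"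
  using assms by (induction I rule: infinite_finite_induct) (auto intro: square_integrable_add)

lemma integrable_mult_cnj:
  assumes "f \<in> square_integrable M" "g \<in> square_integrable M"
  shows "integrable M (\<lambda>x. f x * cnj (g x))"
proof -
  note [measurable] = assms[THEN square_integrable_measurable]
  have "cmod (f x * cnj (g x)) \<le> (cmod (f x))\<^sup>2 + (cmod (g x))\<^sup>2" for x
    by (simp add: norm_mult mult_le_sum_squares)
  moreover have "integrable M (\<lambda>x. (cmod (f x))\<^sup>2 + (cmod (g x))\<^sup>2)"
    using assms[THEN square_integrable_integrable] by auto
  moreover have "(\<lambda>x. cnj (g x)) \<in> borel_measurable M"
    by (rule measurable_compose[OF _ borel_measurable_continuous_onI])
       (auto intro: continuous_on_cnj)
  ultimately show ?thesis
    by (elim Bochner_Integration.integrable_bound) auto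
qed

lemma L2_inner_cnj: "L2_inner M g f = cnj (L2_inner M f g)"
  unfolding L2_inner_def by (subst Bochner_Integration.integral_cnj[symmetric]) (simp add: mult.commute)

lemma L2_inner_self: "L2_inner M f f = complex_of_real (L2_norm_sq M f)"
  unfolding L2_inner_def L2_norm_sq_def
  by (subst integral_complex_of_real[symmetric]) (simp only: complex_norm_square)

lemma L2_inner_add_left:
  assumes "f \<in> square_integrable M" "g \<in> square_integrable M" "h \<in> square_integrable M"
  shows "L2_inner M (\<lambda>x. f x + g x) h = L2_inner M f h + L2_inner M g h"
  unfolding L2_inner_def using assms by (simp add: distrib_right integrable_mult_cnj)

lemma L2_inner_diff_left:
  assumes "f \<in> square_integrable M" "g \<in> square_integrable M" "h \<in> square_integrable M"
  shows "L2_inner M (\<lambda>x. f x - g x) h = L2_inner M f h - L2_inner M g h"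
  unfolding L2_inner_def using assms by (simp add: left_diff_distrib integrable_mult_cnj)

lemma L2_inner_scale_left: "L2_inner M (\<lambda>x. c * f x) g = c * L2_inner M f g"
  unfolding L2_inner_def by (simp add: mult.assoc)

lemma L2_inner_sum_left:
  assumes "\<And>i. i \<in> I \<Longrightarrow> f i \<in> square_integrable M" "g \<in> square_integrable M"
  shows "L2_inner M (\<lambda>x. \<Sum>i\<in>I. f i x) g = (\<Sum>i\<in>I. L2_inner M (f i) g)"
  unfolding L2_inner_def using assms by (simp add: sum_distrib_right integrable_mult_cnj)

lemma L2_inner_diff_right:
  assumes "f \<in> square_integrable M" "g \<in> square_integrable M" "h \<in> square_integrable M"
  shows "L2_inner M h (\<lambda>x. f x - g x) = L2_inner M h f - L2_inner M h g"
  using L2_inner_diff_left[OF assms] by (metis complex_cnj_diff L2_inner_cnj)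

lemma L2_inner_scale_right: "L2_inner M g (\<lambda>x. c * f x) = cnj c * L2_inner M g f"
  using L2_inner_scale_left[of M c f g] by (metis complex_cnj_mult L2_inner_cnj)

lemma L2_inner_sum_right:
  assumes "\<And>i. i \<in> I \<Longrightarrow> f i \<in> square_integrable M" "g \<in> square_integrable M"
  shows "L2_inner M g (\<lambda>x. \<Sum>i\<in>I. f i x) = (\<Sum>i\<in>I. L2_inner M g (f i))"
  by (subst L2_inner_cnj) (simp add: L2_inner_sum_left assms L2_inner_cnj[of M g])

lemma L2_norm_sq_scale: "L2_norm_sq M (\<lambda>x. c * f x) = (cmod c)\<^sup>2 * L2_norm_sq M f"
  by (simp add: L2_norm_sq_def norm_mult power_mult_distrib)

lemma L2_norm_sq_add_le:
  assumes "f \<in> square_integrable M" "g \<in> square_integrable M"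
  shows "L2_norm_sq M (\<lambda>x. f x + g x) \<le> 2 * L2_norm_sq M f + 2 * L2_norm_sq M g"
proof -
  have "L2_norm_sq M (\<lambda>x. f x + g x) \<le> (\<integral>x. 2 * (cmod (f x))\<^sup>2 + 2 * (cmod (g x))\<^sup>2 \<partial>M)"
    unfolding L2_norm_sq_def
    using assms square_integrable_add[OF assms]
    by (intro integral_mono) (auto simp: square_integrable_integrable cmod_add_squared_le)
  then show ?thesis
    using assms by (simp add: L2_norm_sq_def square_integrable_integrable)
qed

lemma L2_norm_sq_diff_le:
  assumes "f \<in> square_integrable M" "g \<in> square_integrable M"
  shows "L2_norm_sq M (\<lambda>x. f x - g x) \<le> 2 * L2_norm_sq M f + 2 * L2_norm_sq M g"
  using L2_norm_sq_add_le[OF assms(1) square_integrable_scale[OF assms(2), of "-1"]]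
    L2_norm_sq_scale[of M "-1" g] by simp

lemma nn_integral_L2_norm_sq:
  assumes "f \<in> square_integrable M"
  shows "(\<integral>\<^sup>+x. ennreal ((cmod (f x))\<^sup>2) \<partial>M) = ennreal (L2_norm_sq M f)"
  unfolding L2_norm_sq_def
  by (rule nn_integral_eq_integral[OF square_integrable_integrable[OF assms]]) auto

lemma L2_norm_sq_eq_0_AE:
  assumes "f \<in> square_integrable M" "L2_norm_sq M f = 0"
  shows "AE x in M. f x = 0"
proof -
  have "AE x in M. (cmod (f x))\<^sup>2 = 0"
    using assms square_integrable_integrable[OF assms(1)]
    by (subst integral_nonneg_eq_0_iff_AE[symmetric]) (auto simp: L2_norm_sq_def)
  then show ?thesis by simp
qed

lemma L2_inner_cong_AE:
  assumes "AE x in M. f x = f' x" "f \<in> square_integrable M" "f' \<in> square_integrable M"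
    "g \<in> square_integrable M"
  shows "L2_inner M f g = L2_inner M f' g"
proof -
  show ?thesis
    unfolding L2_inner_def using assms(1)
    by (intro integral_cong_AE borel_measurable_integrable[OF integrable_mult_cnj] assms) auto
qed

lemma L2_norm_sq_cong_AE:
  assumes "AE x in M. f x = f' x" "f \<in> square_integrable M" "f' \<in> square_integrable M"
  shows "L2_norm_sq M f = L2_norm_sq M f'"
proof -
  note [measurable] = assms(2-)[THEN square_integrable_measurable]
  show ?thesis
    unfolding L2_norm_sq_def using assms(1) by (intro integral_cong_AE) auto
qed

text \<open>Elimination steps and Fourier residuals both subtract multiples of one fixed function,
  so their inner products are all expanded here once.\<close>

lemma L2_inner_diff_scale:
  assumes "f \<in> square_integrable M" "f' \<in> square_integrable M" "g \<in> square_integrable M"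
  shows "L2_inner M (\<lambda>x. f x - c * g x) (\<lambda>x. f' x - d * g x) =
    L2_inner M f f' - cnj d * L2_inner M f g - c * L2_inner M g f' + c * cnj d * L2_inner M g g"
  using assms square_integrable_scale[OF assms(3), of c] square_integrable_scale[OF assms(3), of d]
  by (simp add: L2_inner_diff_left L2_inner_diff_right square_integrable_diff
      L2_inner_scale_left L2_inner_scale_right algebra_simps)

lemma L2_norm_sq_diff_scale:
  assumes "f \<in> square_integrable M" "g \<in> square_integrable M"
  shows "complex_of_real (L2_norm_sq M (\<lambda>x. f x - c * g x)) =
    complex_of_real (L2_norm_sq M f) - cnj c * L2_inner M f g - c * L2_inner M g f + c * cnj c * complex_of_real (L2_norm_sq M g)"
  unfolding L2_inner_self[symmetric] using assms by (intro L2_inner_diff_scale)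

section \<open>Square-summable sequences\<close>

lemma summable_mult_of_square_summable:
  fixes a b :: "nat \<Rightarrow> complex"
  assumes "summable (\<lambda>j. (cmod (a j))\<^sup>2)" "summable (\<lambda>j. (cmod (b j))\<^sup>2)"
  shows "summable (\<lambda>j. cmod (a j * b j))"
proof (rule summable_comparison_test)
  have "cmod (a j * b j) \<le> (cmod (a j))\<^sup>2 + (cmod (b j))\<^sup>2" for j
    by (simp add: norm_mult mult_le_sum_squares)
  then show "\<exists>N. \<forall>n\<ge>N. norm (cmod (a n * b n)) \<le> (cmod (a n))\<^sup>2 + (cmod (b n))\<^sup>2"
    by auto
  show "summable (\<lambda>n. (cmod (a n))\<^sup>2 + (cmod (b n))\<^sup>2)"
    using assms by (rule summable_add)
qed

lemma Cauchy_Schwarz_suminf: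
  fixes a b :: "nat \<Rightarrow> complex"
  assumes a: "summable (\<lambda>j. (cmod (a j))\<^sup>2)" and b: "summable (\<lambda>j. (cmod (b j))\<^sup>2)"
  shows "(cmod (\<Sum>j. a j * b j))\<^sup>2 \<le> (\<Sum>j. (cmod (a j))\<^sup>2) * (\<Sum>j. (cmod (b j))\<^sup>2)"
proof (rule LIMSEQ_le_const2)
  have "summable (\<lambda>j. a j * b j)"
    using summable_mult_of_square_summable[OF a b] by (rule summable_norm_cancel)
  then show "(\<lambda>m. (cmod (\<Sum>j<m. a j * b j))\<^sup>2) \<longlonglongrightarrow> (cmod (\<Sum>j. a j * b j))\<^sup>2"
    by (intro tendsto_power tendsto_norm summable_LIMSEQ)
  have "(cmod (\<Sum>j<m. a j * b j))\<^sup>2 \<le> (\<Sum>j. (cmod (a j))\<^sup>2) * (\<Sum>j. (cmod (b j))\<^sup>2)" for m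
  proof -
    have "(cmod (\<Sum>j<m. a j * b j))\<^sup>2 \<le> (\<Sum>j<m. cmod (a j) * cmod (b j))\<^sup>2"
      using norm_sum[of "\<lambda>j. a j * b j" "{..<m}"] by (intro power_mono) (auto simp: norm_mult)
    also have "\<dots> \<le> (\<Sum>j<m. (cmod (a j))\<^sup>2) * (\<Sum>j<m. (cmod (b j))\<^sup>2)"
      by (rule Cauchy_Schwarz_ineq_sum)
    also have "\<dots> \<le> (\<Sum>j. (cmod (a j))\<^sup>2) * (\<Sum>j. (cmod (b j))\<^sup>2)"
      using a b by (intro mult_mono sum_le_suminf) (auto intro: sum_nonneg suminf_nonneg)
    finally show ?thesis .
  qed
  then show "\<exists>N. \<forall>m\<ge>N. (cmod (\<Sum>j<m. a j * b j))\<^sup>2 \<le>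
      (\<Sum>j. (cmod (a j))\<^sup>2) * (\<Sum>j. (cmod (b j))\<^sup>2)" by blast
qed

section \<open>Sampling points\<close>

text \<open>The reproducing kernel, with one argument fixed at \<open>p\<close>, of the span of the
  \<open>v k\<close> when these form a Parseval frame of it.\<close>

definition pivot_kernel :: "nat \<Rightarrow> (nat \<Rightarrow> 'a \<Rightarrow> complex) \<Rightarrow> 'a \<Rightarrow> 'a \<Rightarrow> complex" where
  "pivot_kernel n v p = (\<lambda>x. \<Sum>k<n. cnj (v k p) * v k x)"

text \<open>A rank-one Schur complement step; the result vanishes at \<open>p\<close> if the kernel
  does not. It uses the value \<open>g p\<close> instead of an inner product. On the span the two
  agree, and off the span the map is still defined but no longer an orthogonal projection.\<close>

definition eliminate :: "nat \<Rightarrow> (nat \<Rightarrow> 'a \<Rightarrow> complex) \<Rightarrow> 'a \<Rightarrow> ('a \<Rightarrow> complex) \<Rightarrow> 'a \<Rightarrow> complex" where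
  "eliminate n v p g = (\<lambda>x. g x - g p / pivot_kernel n v p p * pivot_kernel n v p x)"

lemma pivot_kernel_self:
  "pivot_kernel n v p p = complex_of_real (\<Sum>k<n. (cmod (v k p))\<^sup>2)"
  unfolding pivot_kernel_def of_real_sum complex_norm_square by (simp add: mult.commute)

lemma pivot_kernel_square_integrable:
  assumes "\<And>i. i < n \<Longrightarrow> v i \<in> square_integrable M"
  shows "pivot_kernel n v p \<in> square_integrable M"
  unfolding pivot_kernel_def
  using assms by (intro square_integrable_sum square_integrable_scale) auto

lemma eliminate_square_integrable:
  assumes "\<And>i. i < n \<Longrightarrow> v i \<in> square_integrable M" "g \<in> square_integrable M"
  shows "eliminate n v p g \<in> square_integrable M"
  unfolding eliminate_def
  using assms by (intro square_integrable_diff square_integrable_scale pivot_kernel_square_integrable)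

text \<open>A Parseval frame replaces an orthonormal basis: elimination lowers the dimension by one
  but keeps \<open>n\<close> functions, which the Parseval identity survives and orthonormality does
  not. The identity is pointwise on \<open>X\<close>, since it is applied at the chosen point
  \<open>p\<close>.\<close>

locale pivot =
  fixes M :: "'a measure" and n :: nat and v :: "nat \<Rightarrow> 'a \<Rightarrow> complex" and X :: "'a set" and p :: 'a
  assumes v: "\<And>i. i < n \<Longrightarrow> v i \<in> square_integrable M"
    and parseval: "\<And>i x. i < n \<Longrightarrow> x \<in> X \<Longrightarrow> v i x = (\<Sum>k<n. L2_inner M (v i) (v k) * v k x)"
    and p: "p \<in> X"
    and K_pos: "0 < (\<Sum>k<n. (cmod (v k p))\<^sup>2)"
begin

definition K :: real where "K = (\<Sum>k<n. (cmod (v k p))\<^sup>2)"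

lemma K_gt_0: "K > 0" using K_pos by (simp add: K_def)

abbreviation \<kappa> where "\<kappa> \<equiv> pivot_kernel n v p"

lemma kappa: "\<kappa> \<in> square_integrable M"
  by (rule pivot_kernel_square_integrable) (rule v)

lemma kappa_self: "\<kappa> p = of_real K"
  by (simp add: pivot_kernel_self K_def)

text \<open>The reproducing property: pairing with \<open>\<kappa>\<close> sums the Parseval
  expansion of \<open>v i\<close> at \<open>p\<close>.\<close>

lemma L2_inner_kappa: "i < n \<Longrightarrow> L2_inner M (v i) \<kappa> = v i p"
  unfolding pivot_kernel_def using v
  by (subst L2_inner_sum_right)
     (auto simp: L2_inner_scale_right square_integrable_scale parseval[of i p] p intro: sum.cong)

lemma L2_inner_kappa': "i < n \<Longrightarrow> L2_inner M \<kappa> (v i) = cnj (v i p)"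
  by (subst L2_inner_cnj) (simp add: L2_inner_kappa)

lemma L2_inner_kappa_kappa: "L2_inner M \<kappa> \<kappa> = of_real K"
proof -
  have "L2_inner M \<kappa> \<kappa> = (\<Sum>k<n. cnj (v k p) * L2_inner M (v k) \<kappa>)"
    by (subst (1) pivot_kernel_def, subst L2_inner_sum_left)
       (simp_all add: L2_inner_scale_left square_integrable_scale v kappa)
  also have "\<dots> = (\<Sum>k<n. cnj (v k p) * v k p)"
    by (simp add: L2_inner_kappa)
  also have "\<dots> = \<kappa> p"
    by (simp add: pivot_kernel_def)
  finally show ?thesis by (simp add: kappa_self)
qed

lemma L2_norm_sq_kappa: "L2_norm_sq M \<kappa> = K"
  using L2_inner_kappa_kappa unfolding L2_inner_self by (simp only: of_real_eq_iff)

lemma L2_inner_orth_kappa: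
  assumes "g \<in> square_integrable M" "\<And>i. i < n \<Longrightarrow> L2_inner M g (v i) = 0"
  shows "L2_inner M g \<kappa> = 0" "L2_inner M \<kappa> g = 0"
proof -
  show "L2_inner M g \<kappa> = 0"
    unfolding pivot_kernel_def using assms v
    by (subst L2_inner_sum_right) (auto simp: L2_inner_scale_right square_integrable_scale)
  then show "L2_inner M \<kappa> g = 0"
    by (subst L2_inner_cnj) simp
qed

abbreviation T where "T \<equiv> eliminate n v p"

lemma T_eq: "T g = (\<lambda>x. g x - g p / of_real K * \<kappa> x)"
  by (simp add: eliminate_def kappa_self)

text \<open>On the span, \<open>T\<close> is the orthogonal projection onto the complement of
  \<open>\<kappa>\<close>, because \<open>v i p\<close> is the inner product with
  \<open>\<kappa>\<close> and \<open>K\<close> the squared norm of \<open>\<kappa>\<close>. Summed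
  over \<open>i\<close>, the loss is exactly 1: one dimension.\<close>

lemma L2_norm_sq_T_v: "i < n \<Longrightarrow> L2_norm_sq M (T (v i)) = L2_norm_sq M (v i) - (cmod (v i p))\<^sup>2 / K"
proof -
  assume i: "i < n"
  have "complex_of_real (L2_norm_sq M (T (v i))) =
      complex_of_real (L2_norm_sq M (v i) - (cmod (v i p))\<^sup>2 / K)"
    unfolding T_eq L2_norm_sq_diff_scale[OF v[OF i] kappa] L2_inner_kappa[OF i] L2_inner_kappa'[OF i] L2_norm_sq_kappa
      of_real_diff of_real_divide complex_norm_square
    using K_gt_0 by (simp add: field_simps)
  then show ?thesis by (simp only: of_real_eq_iff)
qed

text \<open>Here \<open>g\<close> is orthogonal to \<open>\<kappa>\<close>, so by Pythagoras the
  subtracted multiple of \<open>\<kappa>\<close> adds its full energy.\<close>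

lemma L2_norm_sq_T_orth:
  assumes "g \<in> square_integrable M" "\<And>i. i < n \<Longrightarrow> L2_inner M g (v i) = 0"
  shows "L2_norm_sq M (T g) = L2_norm_sq M g + (cmod (g p))\<^sup>2 / K"
proof -
  have "complex_of_real (L2_norm_sq M (T g)) = complex_of_real (L2_norm_sq M g + (cmod (g p))\<^sup>2 / K)"
    unfolding T_eq L2_norm_sq_diff_scale[OF assms(1) kappa] L2_norm_sq_kappa
      of_real_add of_real_divide complex_norm_square
    using K_gt_0 by (simp add: L2_inner_orth_kappa[OF assms] del: complex_cnj_mult)
  then show ?thesis by (simp only: of_real_eq_iff)
qed

lemma L2_inner_T_T_v:
  assumes i: "i < n" and j: "j < n"
  shows "L2_inner M (T (v i)) (T (v j)) = L2_inner M (v i) (v j) - v i p * cnj (v j p) / K"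
  unfolding T_eq L2_inner_diff_scale[OF v[OF i] v[OF j] kappa] using K_gt_0
  by (simp add: L2_inner_kappa L2_inner_kappa' L2_inner_kappa_kappa i j)

text \<open>\<open>T (v i)\<close> is orthogonal to \<open>\<kappa>\<close>, so changing
  \<open>g\<close> by a multiple of \<open>\<kappa>\<close> does no harm. This keeps the noise
  orthogonal to the remaining space.\<close>

lemma L2_inner_T_orth:
  assumes "g \<in> square_integrable M" "\<And>i. i < n \<Longrightarrow> L2_inner M g (v i) = 0" and i: "i < n"
  shows "L2_inner M (T g) (T (v i)) = 0"
  unfolding T_eq L2_inner_diff_scale[OF assms(1) v[OF i] kappa] using K_gt_0
  by (simp add: L2_inner_kappa' L2_inner_kappa_kappa L2_inner_orth_kappa(1)[OF assms(1,2)] i assms(2))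

text \<open>The new Gram matrix is the old one minus a rank-one matrix. The old one reproduces
  \<open>T (v i)\<close> by linearity of \<open>T\<close>, and the rank-one part contributes a
  multiple of \<open>T \<kappa>\<close>, which is 0.\<close>

lemma parseval_T:
  assumes i: "i < n" and x: "x \<in> X"
  shows "T (v i) x = (\<Sum>k<n. L2_inner M (T (v i)) (T (v k)) * T (v k) x)"
proof -
  have 1: "(\<Sum>k<n. L2_inner M (v i) (v k) * T (v k) x) = T (v i) x"
  proof -
    have "(\<Sum>k<n. L2_inner M (v i) (v k) * T (v k) x) =
        (\<Sum>k<n. L2_inner M (v i) (v k) * v k x) - (\<Sum>k<n. L2_inner M (v i) (v k) * v k p) / K * \<kappa> x"
      by (simp add: T_eq right_diff_distrib sum_subtractf sum_divide_distrib sum_distrib_right mult.assoc)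
    then show ?thesis
      using parseval[OF i x] parseval[OF i p] by (simp add: T_eq)
  qed
  have 2: "(\<Sum>k<n. cnj (v k p) * T (v k) x) = 0"
  proof -
    have "(\<Sum>k<n. cnj (v k p) * T (v k) x) =
        (\<Sum>k<n. cnj (v k p) * v k x) - (\<Sum>k<n. cnj (v k p) * v k p) / K * \<kappa> x"
      by (simp add: T_eq right_diff_distrib sum_subtractf sum_divide_distrib sum_distrib_right mult.assoc)
    also have "\<dots> = \<kappa> x - \<kappa> p / K * \<kappa> x"
      by (simp add: pivot_kernel_def)
    finally show ?thesis using K_gt_0 by (simp add: kappa_self)
  qed
  have "(\<Sum>k<n. L2_inner M (T (v i)) (T (v k)) * T (v k) x) =
      (\<Sum>k<n. L2_inner M (v i) (v k) * T (v k) x) - v i p / K * (\<Sum>k<n. cnj (v k p) * T (v k) x)"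
    by (simp add: L2_inner_T_T_v i left_diff_distrib sum_subtractf sum_distrib_left field_simps)
  with 1 2 show ?thesis by simp
qed

end

text \<open>Averaging: the opposite inequality on all of \<open>X\<close> would contradict
  \<open>lt\<close> after integration.\<close>

lemma exists_good_point:
  fixes h k :: "'a \<Rightarrow> ennreal"
  assumes [measurable]: "h \<in> borel_measurable M" "k \<in> borel_measurable M"
    and X: "AE x in M. x \<in> X"
    and lt: "\<alpha> * (\<integral>\<^sup>+x. h x \<partial>M) < \<beta> * (\<integral>\<^sup>+x. k x \<partial>M)"
  shows "\<exists>x\<in>X. \<alpha> * h x < \<beta> * k x"
proof (rule ccontr)
  assume "\<not> ?thesis"
  then have "\<forall>x\<in>X. \<beta> * k x \<le> \<alpha> * h x" by (auto simp: not_less)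
  then have "(\<integral>\<^sup>+x. \<beta> * k x \<partial>M) \<le> (\<integral>\<^sup>+x. \<alpha> * h x \<partial>M)"
    using X by (intro nn_integral_mono_AE) auto
  then show False using lt by (simp add: nn_integral_cmult)
qed

text \<open>
  A derandomised form of volume sampling. Each step evaluates at a point where the kernel of the
  remaining space is large compared with the noise and removes the kernel function \<open>\<kappa>\<close> of that
  point by the oblique projection \<open>g \<mapsto> g - (g q / \<kappa> q) * \<kappa>\<close>; with \<open>t\<close> remaining dimensions the
  energy of the noise grows by the factor \<open>1 + 1 / t\<close> only. The projection fixes all functions
  vanishing at the point.
\<close>

lemma sampling_points:
  fixes v b :: "nat \<Rightarrow> 'a \<Rightarrow> complex"
  assumes X: "AE x in M. x \<in> X"
    and v: "\<And>i. i < n \<Longrightarrow> v i \<in> square_integrable M"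
    and b: "\<And>j. b j \<in> square_integrable M"
    and orth: "\<And>i j. i < n \<Longrightarrow> L2_inner M (b j) (v i) = 0"
    and parseval: "\<And>i x. i < n \<Longrightarrow> x \<in> X \<Longrightarrow> v i x = (\<Sum>k<n. L2_inner M (v i) (v k) * v k x)"
    and dim: "(\<Sum>i<n. L2_norm_sq M (v i)) = real t"
    and noise: "(\<Sum>j. ennreal (L2_norm_sq M (b j))) < ennreal \<tau>"
    and summ: "\<And>x. x \<in> X \<Longrightarrow> summable (\<lambda>j. (cmod (b j x))\<^sup>2)"
  shows "\<exists>p. (\<forall>i<t. p i \<in> X) \<and>
    (\<forall>f u a. f \<in> square_integrable M \<longrightarrow>
      (\<forall>x\<in>X. f x = (\<Sum>i<n. u i * v i x) + (\<Sum>j. a j * b j x)) \<longrightarrow>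
      summable (\<lambda>j. (cmod (a j))\<^sup>2) \<longrightarrow> (\<Sum>j. (cmod (a j))\<^sup>2) \<le> 1 \<longrightarrow>
      (\<forall>i<t. f (p i) = 0) \<longrightarrow> L2_norm_sq M f \<le> real (t + 1) * \<tau>)"
  using v b orth parseval dim noise summ
proof (induction t arbitrary: v b \<tau>)
  case 0
  \<comment> \<open>The sum in \<open>dim\<close> is the trace of a projection, hence the dimension.
    When it is 0, \<open>f\<close> is almost everywhere pure noise.\<close>
  have null: "L2_norm_sq M (v i) = 0" if "i < n" for i
    using 0(5) that by (simp add: sum_nonneg_eq_0_iff)
  have ae: "AE x in M. \<forall>i\<in>{..<n}. v i x = 0"
    by (intro AE_finite_allI) (auto intro: L2_norm_sq_eq_0_AE 0(1) null)
  have "L2_norm_sq M f \<le> \<tau>"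
    if f: "f \<in> square_integrable M"
      and rep: "\<forall>x\<in>X. f x = (\<Sum>i<n. u i * v i x) + (\<Sum>j. a j * b j x)"
      and a: "summable (\<lambda>j. (cmod (a j))\<^sup>2)" "(\<Sum>j. (cmod (a j))\<^sup>2) \<le> 1"
    for f u a
  proof -
    have le: "AE x in M. ennreal ((cmod (f x))\<^sup>2) \<le> (\<Sum>j. ennreal ((cmod (b j x))\<^sup>2))"
      using ae X
    proof eventually_elim
      case (elim x)
      have "(cmod (f x))\<^sup>2 = (cmod (\<Sum>j. a j * b j x))\<^sup>2"
        using rep elim by simp
      also have "\<dots> \<le> (\<Sum>j. (cmod (a j))\<^sup>2) * (\<Sum>j. (cmod (b j x))\<^sup>2)"
        using a(1) 0(7) elim by (intro Cauchy_Schwarz_suminf) auto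
      also have "\<dots> \<le> 1 * (\<Sum>j. (cmod (b j x))\<^sup>2)"
        using a(2) 0(7) elim by (intro mult_right_mono suminf_nonneg) auto
      finally have "(cmod (f x))\<^sup>2 \<le> (\<Sum>j. (cmod (b j x))\<^sup>2)" by simp
      then have "ennreal ((cmod (f x))\<^sup>2) \<le> ennreal (\<Sum>j. (cmod (b j x))\<^sup>2)"
        by (rule ennreal_leI)
      also have "\<dots> = (\<Sum>j. ennreal ((cmod (b j x))\<^sup>2))"
        using 0(7) elim by (intro suminf_ennreal2[symmetric]) auto
      finally show ?case .
    qed
    have [measurable]: "b j \<in> borel_measurable M" for j
      using 0(2) by (rule square_integrable_measurable)
    have "ennreal (L2_norm_sq M f) \<le> (\<integral>\<^sup>+x. (\<Sum>j. ennreal ((cmod (b j x))\<^sup>2)) \<partial>M)"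
      unfolding nn_integral_L2_norm_sq[OF f, symmetric] using le by (rule nn_integral_mono_AE)
    also have "\<dots> = (\<Sum>j. ennreal (L2_norm_sq M (b j)))"
      by (subst nn_integral_suminf) (auto simp: nn_integral_L2_norm_sq 0(2))
    also have "\<dots> \<le> ennreal \<tau>" using 0(6) by simp
    finally have "ennreal (L2_norm_sq M f) \<le> ennreal \<tau>" .
    moreover have "0 < \<tau>" using 0(6) by (metis ennreal_neg not_le not_less_zero)
    ultimately show ?thesis by (simp add: ennreal_le_iff)
  qed
  then show ?case by auto
next
  case (Suc t)
  note v = Suc.prems(1) and b = Suc.prems(2) and orth = Suc.prems(3) and parseval = Suc.prems(4)
    and dim = Suc.prems(5) and noise = Suc.prems(6) and summ = Suc.prems(7)
  have [measurable]: "b j \<in> borel_measurable M" for j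
    using b by (rule square_integrable_measurable)
  have vm [measurable]: "v j \<in> borel_measurable M" if "j < n" for j
    using v[OF that] by (rule square_integrable_measurable)
  have tau: "0 < \<tau>" using noise by (metis ennreal_neg not_le not_less_zero)
  define h where "h x = (\<Sum>j. ennreal ((cmod (b j x))\<^sup>2))" for x
  define k where "k x = (\<Sum>i<n. (cmod (v i x))\<^sup>2)" for x
  have int_h: "(\<integral>\<^sup>+x. h x \<partial>M) = (\<Sum>j. ennreal (L2_norm_sq M (b j)))"
    unfolding h_def by (subst nn_integral_suminf) (auto simp: nn_integral_L2_norm_sq b)
  have int_k: "(\<integral>\<^sup>+x. ennreal (k x) \<partial>M) = ennreal (real (Suc t))"
  proof -
    have "(\<integral>\<^sup>+x. ennreal (k x) \<partial>M) = (\<integral>\<^sup>+x. (\<Sum>i<n. ennreal ((cmod (v i x))\<^sup>2)) \<partial>M)"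
      unfolding k_def by (intro nn_integral_cong) (simp add: sum_ennreal)
    also have "\<dots> = (\<Sum>i<n. ennreal (L2_norm_sq M (v i)))"
      by (subst nn_integral_sum) (auto simp: nn_integral_L2_norm_sq v)
    also have "\<dots> = ennreal (\<Sum>i<n. L2_norm_sq M (v i))"
      by (rule sum_ennreal) simp
    finally show ?thesis using dim by simp
  qed
  \<comment> \<open>The integral of \<open>h\<close> is below \<open>\<tau>\<close> and that of
    \<open>k\<close> equals \<open>t + 1\<close>, so somewhere the noise-to-kernel ratio is below
    \<open>\<tau> / (t + 1)\<close>.\<close>
  have "\<exists>p\<in>X. ennreal (real (Suc t)) * h p < ennreal \<tau> * ennreal (k p)"
  proof (rule exists_good_point[OF _ _ X])
    show "h \<in> borel_measurable M" unfolding h_def by measurable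
    show "(\<lambda>x. ennreal (k x)) \<in> borel_measurable M"
      unfolding k_def
      by (intro measurable_compose[OF _ measurable_ennreal] borel_measurable_sum
          borel_measurable_power borel_measurable_norm vm) auto
    have "ennreal (real (Suc t)) * (\<Sum>j. ennreal (L2_norm_sq M (b j))) < ennreal (real (Suc t)) * ennreal \<tau>"
      by (rule ennreal_mult_strict_left_mono[OF noise]) (simp_all add: ennreal_zero_less_mult_iff del: of_nat_Suc)
    then show "ennreal (real (Suc t)) * (\<integral>\<^sup>+x. h x \<partial>M) < ennreal \<tau> * (\<integral>\<^sup>+x. ennreal (k x) \<partial>M)"
      by (simp add: int_h int_k mult.commute)
  qed
  then obtain q where q: "q \<in> X" and hk: "ennreal (real (Suc t)) * h q < ennreal \<tau> * ennreal (k q)"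
    by blast
  have hq: "h q = ennreal (\<Sum>j. (cmod (b j q))\<^sup>2)"
    unfolding h_def using summ[OF q] by (intro suminf_ennreal2) auto
  have Hq0: "0 \<le> (\<Sum>j. (cmod (b j q))\<^sup>2)"
    using summ[OF q] by (intro suminf_nonneg) auto
  have kq: "real (Suc t) * (\<Sum>j. (cmod (b j q))\<^sup>2) < \<tau> * k q"
    using hk tau Hq0 unfolding hq
    by (simp add: ennreal_mult[symmetric] k_def sum_nonneg ennreal_less_iff del: of_nat_Suc)
  have kpos: "0 < k q"
  proof -
    have "0 \<le> real (Suc t) * (\<Sum>j. (cmod (b j q))\<^sup>2)"
      using Hq0 by (intro mult_nonneg_nonneg) auto
    with kq have "0 < \<tau> * k q" by linarith
    then show ?thesis using tau by (simp add: zero_less_mult_iff)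
  qed
  interpret pivot M n v X q
    using v parseval q kpos by unfold_locales (auto simp: k_def)
  have Kk: "K = k q" by (simp add: K_def k_def)
  \<comment> \<open>Elimination adds \<open>(cmod (b j q))^2 / K\<close> to the energy of each
    \<open>b j\<close>. The added total is finite, so the strict bound on the noise
    persists.\<close>
  define \<tau>' where "\<tau>' = \<tau> + (\<Sum>j. (cmod (b j q))\<^sup>2) / K"
  have "\<exists>p. (\<forall>i<t. p i \<in> X) \<and>
    (\<forall>f u a. f \<in> square_integrable M \<longrightarrow>
      (\<forall>x\<in>X. f x = (\<Sum>i<n. u i * T (v i) x) + (\<Sum>j. a j * T (b j) x)) \<longrightarrow>
      summable (\<lambda>j. (cmod (a j))\<^sup>2) \<longrightarrow> (\<Sum>j. (cmod (a j))\<^sup>2) \<le> 1 \<longrightarrow>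
      (\<forall>i<t. f (p i) = 0) \<longrightarrow> L2_norm_sq M f \<le> real (t + 1) * \<tau>')"
  proof (rule Suc.IH)
    show "T (v i) \<in> square_integrable M" if "i < n" for i
      using that v by (intro eliminate_square_integrable)
    show "T (b j) \<in> square_integrable M" for j
      using v b by (intro eliminate_square_integrable)
    show "L2_inner M (T (b j)) (T (v i)) = 0" if "i < n" for i j
      using that by (intro L2_inner_T_orth b orth)
    show "T (v i) x = (\<Sum>k<n. L2_inner M (T (v i)) (T (v k)) * T (v k) x)" if "i < n" "x \<in> X" for i x
      using that by (rule parseval_T)
    show "(\<Sum>i<n. L2_norm_sq M (T (v i))) = real t"
      using dim K_gt_0
      by (simp add: L2_norm_sq_T_v sum_subtractf sum_divide_distrib[symmetric] K_def[symmetric])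
    have "(\<Sum>j. ennreal (L2_norm_sq M (T (b j)))) =
        (\<Sum>j. ennreal (L2_norm_sq M (b j)) + ennreal ((cmod (b j q))\<^sup>2 / K))"
      using K_gt_0 by (simp add: L2_norm_sq_T_orth b orth)
    also have "\<dots> = (\<Sum>j. ennreal (L2_norm_sq M (b j))) + (\<Sum>j. ennreal ((cmod (b j q))\<^sup>2 / K))"
      by (rule suminf_add[symmetric]) auto
    also have "(\<Sum>j. ennreal ((cmod (b j q))\<^sup>2 / K)) = ennreal ((\<Sum>j. (cmod (b j q))\<^sup>2) / K)"
      using summ[OF q] K_gt_0
      by (subst suminf_ennreal2) (auto intro: summable_divide simp: suminf_divide)
    also have "(\<Sum>j. ennreal (L2_norm_sq M (b j))) + ennreal ((\<Sum>j. (cmod (b j q))\<^sup>2) / K) <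
        ennreal \<tau> + ennreal ((\<Sum>j. (cmod (b j q))\<^sup>2) / K)"
      using noise by (simp add: ennreal_add_left_cancel_less add.commute)
    also have "\<dots> = ennreal \<tau>'"
      unfolding \<tau>'_def using tau Hq0 K_gt_0 by (intro ennreal_plus[symmetric]) auto
    finally show "(\<Sum>j. ennreal (L2_norm_sq M (T (b j)))) < ennreal \<tau>'" .
    show "summable (\<lambda>j. (cmod (T (b j) x))\<^sup>2)" if x: "x \<in> X" for x
    proof (rule summable_comparison_test)
      show "summable (\<lambda>j. 2 * (cmod (b j x))\<^sup>2 + 2 * ((cmod (\<kappa> x))\<^sup>2 / K\<^sup>2 * (cmod (b j q))\<^sup>2))"
        using summ[OF x] summ[OF q] by (intro summable_add summable_mult)
      have "(cmod (T (b j) x))\<^sup>2 \<le> 2 * (cmod (b j x))\<^sup>2 + 2 * ((cmod (\<kappa> x))\<^sup>2 / K\<^sup>2 * (cmod (b j q))\<^sup>2)" for j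
      proof -
        have "(cmod (b j q / of_real K * \<kappa> x))\<^sup>2 = (cmod (\<kappa> x))\<^sup>2 / K\<^sup>2 * (cmod (b j q))\<^sup>2"
          by (simp add: norm_mult norm_divide power_mult_distrib power_divide)
        then show ?thesis
          using cmod_add_squared_le[of "b j x" "- (b j q / of_real K * \<kappa> x)"]
          by (simp only: T_eq norm_minus_cancel add_uminus_conv_diff)
      qed
      then show "\<exists>N. \<forall>j\<ge>N. norm ((cmod (T (b j) x))\<^sup>2) \<le>
          2 * (cmod (b j x))\<^sup>2 + 2 * ((cmod (\<kappa> x))\<^sup>2 / K\<^sup>2 * (cmod (b j q))\<^sup>2)" by simp
    qed
  qed
  then obtain p where p: "\<forall>i<t. p i \<in> X"
    and IH: "\<forall>f u a. f \<in> square_integrable M \<longrightarrow>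
      (\<forall>x\<in>X. f x = (\<Sum>i<n. u i * T (v i) x) + (\<Sum>j. a j * T (b j) x)) \<longrightarrow>
      summable (\<lambda>j. (cmod (a j))\<^sup>2) \<longrightarrow> (\<Sum>j. (cmod (a j))\<^sup>2) \<le> 1 \<longrightarrow>
      (\<forall>i<t. f (p i) = 0) \<longrightarrow> L2_norm_sq M f \<le> real (t + 1) * \<tau>'"
    by (elim exE conjE) (rule that)
  \<comment> \<open>By the choice of \<open>q\<close> the noise grows at most by the factor
    \<open>1 + 1 / (t + 1)\<close>; multiplied by the \<open>t + 1\<close> of the induction
    hypothesis this telescopes to \<open>t + 2\<close>.\<close>
  have bound: "real (t + 1) * \<tau>' \<le> real (Suc t + 1) * \<tau>"
  proof -
    have "real (t + 1) * ((\<Sum>j. (cmod (b j q))\<^sup>2) / K) \<le> \<tau>"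
      using kq K_gt_0 unfolding Kk[symmetric] by (simp add: field_simps)
    then show ?thesis by (simp add: \<tau>'_def algebra_simps)
  qed
  show ?case
  proof (intro exI[of _ "\<lambda>i. if i = t then q else p i"] conjI allI impI)
    show "(if i = t then q else p i) \<in> X" if "i < Suc t" for i
      using that p q by auto
    fix f u a
    assume f: "f \<in> square_integrable M"
      and rep: "\<forall>x\<in>X. f x = (\<Sum>i<n. u i * v i x) + (\<Sum>j. a j * b j x)"
      and a: "summable (\<lambda>j. (cmod (a j))\<^sup>2)" "(\<Sum>j. (cmod (a j))\<^sup>2) \<le> 1"
      and zero: "\<forall>i<Suc t. f (if i = t then q else p i) = 0"
    have fq: "f q = 0" using zero by (auto dest: spec[of _ t])
    \<comment> \<open>Applying \<open>T\<close> to the expansion term by term gives \<open>f\<close>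
      minus a multiple of \<open>f q\<close>, and \<open>f q = 0\<close>. The coefficients
      \<open>u\<close> and \<open>a\<close> stay the same, so the energy bound on \<open>a\<close>
      carries over.\<close>
    have rep': "\<forall>x\<in>X. f x = (\<Sum>i<n. u i * T (v i) x) + (\<Sum>j. a j * T (b j) x)"
    proof
      fix x assume x: "x \<in> X"
      have sx: "summable (\<lambda>j. a j * b j x)" if "x \<in> X" for x
        using summable_mult_of_square_summable[OF a(1) summ[OF that]] by (rule summable_norm_cancel)
      have "(\<Sum>j. a j * T (b j) x) = (\<Sum>j. a j * b j x - a j * b j q * (\<kappa> x / K))"
        by (simp add: T_eq algebra_simps)
      also have "\<dots> = (\<Sum>j. a j * b j x) - (\<Sum>j. a j * b j q) * (\<kappa> x / K)"
        unfolding suminf_mult2[OF sx[OF q]]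
        by (rule suminf_diff[symmetric, OF sx[OF x] summable_mult2[OF sx[OF q]]])
      finally have 1: "(\<Sum>j. a j * T (b j) x) = \<dots>" .
      have 2: "(\<Sum>i<n. u i * T (v i) x) = (\<Sum>i<n. u i * v i x) - (\<Sum>i<n. u i * v i q) * (\<kappa> x / K)"
        by (simp add: T_eq right_diff_distrib sum_subtractf sum_distrib_right sum_divide_distrib
            mult.assoc)
      have "(\<Sum>i<n. u i * T (v i) x) + (\<Sum>j. a j * T (b j) x) = f x - f q * (\<kappa> x / K)"
        unfolding 1 2 using rep x q by (simp add: algebra_simps)
      then show "f x = (\<Sum>i<n. u i * T (v i) x) + (\<Sum>j. a j * T (b j) x)"
        using fq by simp
    qed
    have zero': "\<forall>i<t. f (p i) = 0"
    proof (intro allI impI)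
      fix i assume "i < t"
      then show "f (p i) = 0" using zero[rule_format, of i] by simp
    qed
    have "L2_norm_sq M f \<le> real (t + 1) * \<tau>'"
      by (rule IH[rule_format (no_asm), OF f rep' a zero'])
    with bound show "L2_norm_sq M f \<le> real (Suc t + 1) * \<tau>" by linarith
  qed
qed

section \<open>Gram--Schmidt orthogonalisation\<close>

definition orthonormal_or_zero :: "'a measure \<Rightarrow> (nat \<Rightarrow> 'a \<Rightarrow> complex) \<Rightarrow> bool" where
  "orthonormal_or_zero M e \<longleftrightarrow> (\<forall>i. e i \<in> square_integrable M) \<and>
     (\<forall>i j. i \<noteq> j \<longrightarrow> L2_inner M (e i) (e j) = 0) \<and> (\<forall>i. L2_norm_sq M (e i) = 1 \<or> e i = (\<lambda>x. 0))"

definition fourier_sum :: "'a measure \<Rightarrow> (nat \<Rightarrow> 'a \<Rightarrow> complex) \<Rightarrow> nat \<Rightarrow> ('a \<Rightarrow> complex) \<Rightarrow> 'a \<Rightarrow> complex" where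
  "fourier_sum M e m f = (\<lambda>x. \<Sum>j<m. L2_inner M f (e j) * e j x)"

lemma L2_inner_zero [simp]: "L2_inner M f (\<lambda>x. 0) = 0" "L2_inner M (\<lambda>x. 0) f = 0"
  by (simp_all add: L2_inner_def)

lemma L2_norm_sq_zero [simp]: "L2_norm_sq M (\<lambda>x. 0) = 0"
  by (simp add: L2_norm_sq_def)

lemma fourier_sum_cong:
  assumes "\<And>j. j < m \<Longrightarrow> e j = e' j"
  shows "fourier_sum M e m f = fourier_sum M e' m f"
  using assms by (simp add: fourier_sum_def)

context
  fixes M :: "'a measure" and e :: "nat \<Rightarrow> 'a \<Rightarrow> complex"
  assumes e: "orthonormal_or_zero M e"
begin

lemma orthonormal_square_integrable: "e i \<in> square_integrable M"
  using e by (simp add: orthonormal_or_zero_def)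

lemma orthonormal_orth: "i \<noteq> j \<Longrightarrow> L2_inner M (e i) (e j) = 0"
  using e by (simp add: orthonormal_or_zero_def)

lemma orthonormal_absorb: "L2_inner M f (e j) * L2_inner M (e j) (e j) = L2_inner M f (e j)"
  using e by (auto simp: orthonormal_or_zero_def L2_inner_self dest: spec[of _ j])

lemma orthonormal_parseval: "e i x = L2_inner M (e i) (e i) * e i x"
  using e by (auto simp: orthonormal_or_zero_def L2_inner_self dest!: spec[of _ i])

lemma L2_norm_sq_orthonormal: "L2_norm_sq M (e i) = 1 \<or> L2_norm_sq M (e i) = 0"
  using e by (auto simp: orthonormal_or_zero_def)

lemma fourier_sum_square_integrable: "fourier_sum M e m f \<in> square_integrable M"
  unfolding fourier_sum_def
  by (intro square_integrable_sum square_integrable_scale orthonormal_square_integrable)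

lemma L2_inner_fourier_sum:
  "L2_inner M (fourier_sum M e m f) (e i) = (if i < m then L2_inner M f (e i) else 0)"
proof -
  have "L2_inner M (fourier_sum M e m f) (e i) = (\<Sum>j<m. L2_inner M f (e j) * L2_inner M (e j) (e i))"
    unfolding fourier_sum_def
    by (subst L2_inner_sum_left)
       (auto intro: square_integrable_scale orthonormal_square_integrable simp: L2_inner_scale_left)
  also have "\<dots> = (\<Sum>j<m. if j = i then L2_inner M f (e i) else 0)"
    by (intro sum.cong) (auto simp: orthonormal_orth orthonormal_absorb)
  finally show ?thesis by simp
qed

lemma L2_norm_sq_diff_fourier_sum:
  assumes f: "f \<in> square_integrable M"
  shows "L2_norm_sq M (\<lambda>x. f x - fourier_sum M e m f x) = L2_norm_sq M f - (\<Sum>j<m. (cmod (L2_inner M f (e j)))\<^sup>2)"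
proof -
  note P = fourier_sum_square_integrable[of m f]
  have *: "L2_inner M g (fourier_sum M e m f) = (\<Sum>j<m. cnj (L2_inner M f (e j)) * L2_inner M g (e j))"
    if "g \<in> square_integrable M" for g
    unfolding fourier_sum_def using that
    by (subst L2_inner_sum_right)
       (auto intro: square_integrable_scale orthonormal_square_integrable simp: L2_inner_scale_right)
  have s: "(\<Sum>j<m. cnj (L2_inner M f (e j)) * L2_inner M f (e j)) =
      complex_of_real (\<Sum>j<m. (cmod (L2_inner M f (e j)))\<^sup>2)"
    unfolding of_real_sum complex_norm_square by (simp add: mult.commute)
  have 1: "L2_inner M f (fourier_sum M e m f) = complex_of_real (\<Sum>j<m. (cmod (L2_inner M f (e j)))\<^sup>2)"
    using *[OF f] s by simp
  have 2: "L2_inner M (fourier_sum M e m f) (fourier_sum M e m f) =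
      complex_of_real (\<Sum>j<m. (cmod (L2_inner M f (e j)))\<^sup>2)"
    unfolding *[OF P] s[symmetric] by (intro sum.cong) (auto simp: L2_inner_fourier_sum)
  have 3: "L2_inner M (fourier_sum M e m f) f = complex_of_real (\<Sum>j<m. (cmod (L2_inner M f (e j)))\<^sup>2)"
    by (subst L2_inner_cnj) (simp only: 1 complex_cnj_complex_of_real)
  have "complex_of_real (L2_norm_sq M (\<lambda>x. f x - fourier_sum M e m f x)) =
      complex_of_real (L2_norm_sq M f - (\<Sum>j<m. (cmod (L2_inner M f (e j)))\<^sup>2))"
    using L2_norm_sq_diff_scale[OF f P, of 1] by (simp only: 1 2 3 L2_inner_self[symmetric] mult_1_left
        complex_cnj_one of_real_diff) simp
  then show ?thesis by (simp only: of_real_eq_iff)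
qed

lemma Bessel:
  assumes f: "f \<in> square_integrable M"
  shows "(\<Sum>j<m. (cmod (L2_inner M f (e j)))\<^sup>2) \<le> L2_norm_sq M f"
  using L2_norm_sq_diff_fourier_sum[OF f, of m] L2_norm_sq_nonneg[of M "\<lambda>x. f x - fourier_sum M e m f x"]
  by linarith

text \<open>The residual after \<open>m\<close> terms is known exactly, so Bessel's inequality up to
  \<open>k\<close> leaves this bound once the first \<open>m\<close> terms are subtracted.\<close>

lemma Bessel_tail:
  assumes f: "f \<in> square_integrable M" and "m \<le> k"
  shows "(\<Sum>j=m..<k. (cmod (L2_inner M f (e j)))\<^sup>2) \<le> L2_norm_sq M (\<lambda>x. f x - fourier_sum M e m f x)"
proof -
  have "(\<Sum>j<k. (cmod (L2_inner M f (e j)))\<^sup>2) =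
      (\<Sum>j<m. (cmod (L2_inner M f (e j)))\<^sup>2) + (\<Sum>j=m..<k. (cmod (L2_inner M f (e j)))\<^sup>2)"
    using assms(2) by (simp add: lessThan_atLeast0 sum.atLeastLessThan_concat)
  then show ?thesis
    using Bessel[OF f, of k] L2_norm_sq_diff_fourier_sum[OF f, of m] by linarith
qed

text \<open>With \<open>h = f - g\<close>, the residual of \<open>f\<close> is almost everywhere
  that of \<open>h\<close>, and a residual of \<open>h\<close> is no larger than
  \<open>h\<close>.\<close>

lemma best_approximation:
  assumes f: "f \<in> square_integrable M" and g: "g \<in> square_integrable M"
    and span: "AE x in M. fourier_sum M e m g x = g x"
  shows "L2_norm_sq M (\<lambda>x. f x - fourier_sum M e m f x) \<le> L2_norm_sq M (\<lambda>x. f x - g x)"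
proof -
  let ?h = "\<lambda>x. f x - g x"
  have h: "?h \<in> square_integrable M" using f g by (rule square_integrable_diff)
  have "fourier_sum M e m ?h x = fourier_sum M e m f x - fourier_sum M e m g x" for x
    by (simp add: fourier_sum_def L2_inner_diff_left f g orthonormal_square_integrable
        left_diff_distrib sum_subtractf)
  then have ae: "AE x in M. f x - fourier_sum M e m f x = ?h x - fourier_sum M e m ?h x"
    using span by simp
  have "L2_norm_sq M (\<lambda>x. f x - fourier_sum M e m f x) = L2_norm_sq M (\<lambda>x. ?h x - fourier_sum M e m ?h x)"
    using ae by (intro L2_norm_sq_cong_AE square_integrable_diff f h fourier_sum_square_integrable)
  also have "\<dots> \<le> L2_norm_sq M ?h"
    unfolding L2_norm_sq_diff_fourier_sum[OF h] by (simp add: sum_nonneg)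
  finally show ?thesis .
qed

end

text \<open>If the residual has norm 0, division by 0 turns it into the zero function, even where it
  was nonzero on a null set.\<close>

function gram_schmidt :: "'a measure \<Rightarrow> (nat \<Rightarrow> 'a \<Rightarrow> complex) \<Rightarrow> nat \<Rightarrow> 'a \<Rightarrow> complex" where
  "gram_schmidt M q m =
    (let r = (\<lambda>x. q m x - (\<Sum>j<m. L2_inner M (q m) (gram_schmidt M q j) * gram_schmidt M q j x))
     in (\<lambda>x. r x / complex_of_real (sqrt (L2_norm_sq M r))))"
  by pat_completeness auto
termination
  by (relation "Wellfounded.measure (\<lambda>(M, q, m). m)") auto

declare gram_schmidt.simps [simp del]

context
  fixes M :: "'a measure" and q :: "nat \<Rightarrow> 'a \<Rightarrow> complex"
  assumes q: "\<And>i. q i \<in> square_integrable M"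
begin

abbreviation gs_residual :: "nat \<Rightarrow> 'a \<Rightarrow> complex" where
  "gs_residual m \<equiv> (\<lambda>x. q m x - fourier_sum M (gram_schmidt M q) m (q m) x)"

lemma gram_schmidt_eq:
  "gram_schmidt M q m = (\<lambda>x. inverse (complex_of_real (sqrt (L2_norm_sq M (gs_residual m)))) * gs_residual m x)"
  by (subst gram_schmidt.simps) (simp add: Let_def fourier_sum_def field_simps)

lemma gram_schmidt_square_integrable: "gram_schmidt M q m \<in> square_integrable M"
proof (induction m rule: less_induct)
  case (less m)
  show ?case
    unfolding gram_schmidt_eq[of m] unfolding fourier_sum_def
    by (intro square_integrable_scale square_integrable_diff square_integrable_sum q)
       (auto intro: less)
qed

lemma gs_residual_square_integrable: "gs_residual m \<in> square_integrable M"
  unfolding fourier_sum_def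
  by (intro square_integrable_scale square_integrable_diff square_integrable_sum q
      gram_schmidt_square_integrable)

lemma gram_schmidt_normalised: "L2_norm_sq M (gram_schmidt M q m) = 1 \<or> gram_schmidt M q m = (\<lambda>x. 0)"
proof (cases "L2_norm_sq M (gs_residual m) = 0")
  case True
  then show ?thesis by (subst (2) gram_schmidt_eq) simp
next
  case False
  then have "L2_norm_sq M (gs_residual m) > 0"
    using L2_norm_sq_nonneg[of M "gs_residual m"] by linarith
  then show ?thesis
    by (subst gram_schmidt_eq, subst L2_norm_sq_scale)
       (simp add: norm_inverse power_inverse)
qed

lemma gram_schmidt_orth: "i < m \<Longrightarrow> L2_inner M (gram_schmidt M q m) (gram_schmidt M q i) = 0"
proof (induction m arbitrary: i rule: less_induct)
  case (less m)
  \<comment> \<open>The projection lemmas speak of entire orthonormal sequences; cutting off by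
    zeros makes them available while orthogonality is known only below \<open>m\<close>.\<close>
  define e where "e j = (if j < m then gram_schmidt M q j else (\<lambda>x. 0))" for j
  have "L2_inner M (e j) (e k) = 0" if "j \<noteq> k" for j k
  proof (cases "j < m \<and> k < m")
    case True
    then show ?thesis
      using that less.IH[of j k] less.IH[of k j] L2_inner_cnj[of M "e j" "e k"]
      by (cases "j < k") (auto simp: e_def)
  qed (auto simp: e_def)
  then have e: "orthonormal_or_zero M e"
    using gram_schmidt_normalised gram_schmidt_square_integrable
    by (auto simp: orthonormal_or_zero_def e_def)
  have eq: "fourier_sum M (gram_schmidt M q) m (q m) = fourier_sum M e m (q m)"
    by (rule fourier_sum_cong) (simp add: e_def)
  have "L2_inner M (gs_residual m) (e i) = 0"
    unfolding eq using less.prems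
    by (simp add: L2_inner_diff_left q fourier_sum_square_integrable[OF e]
        orthonormal_square_integrable[OF e] L2_inner_fourier_sum[OF e])
  then have "L2_inner M (gs_residual m) (gram_schmidt M q i) = 0"
    using less.prems by (simp add: e_def)
  then show ?case
    by (subst gram_schmidt_eq) (simp add: L2_inner_scale_left)
qed

lemma gram_schmidt_orthonormal: "orthonormal_or_zero M (gram_schmidt M q)"
  unfolding orthonormal_or_zero_def
proof (intro conjI allI impI)
  fix i j :: nat assume "i \<noteq> j"
  then show "L2_inner M (gram_schmidt M q i) (gram_schmidt M q j) = 0"
    using gram_schmidt_orth[of i j] gram_schmidt_orth[of j i]
      L2_inner_cnj[of M "gram_schmidt M q i" "gram_schmidt M q j"]
    by (cases "i < j") auto
qed (use gram_schmidt_normalised gram_schmidt_square_integrable in auto)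

text \<open>\<open>q i\<close> is its projection onto the earlier functions plus a multiple of the
  \<open>i\<close>-th new one, and its later coefficients vanish. Equality may fail on the null set
  where a residual of norm 0 was replaced by 0.\<close>

lemma gram_schmidt_span:
  assumes "i < m"
  shows "AE x in M. fourier_sum M (gram_schmidt M q) m (q i) x = q i x"
proof -
  let ?e = "gram_schmidt M q"
  note e = gram_schmidt_orthonormal
  define c where "c = complex_of_real (sqrt (L2_norm_sq M (gs_residual i)))"
  have res: "AE x in M. gs_residual i x = c * ?e i x"
  proof (cases "L2_norm_sq M (gs_residual i) = 0")
    case True
    then show ?thesis
      using L2_norm_sq_eq_0_AE[OF gs_residual_square_integrable True] by (simp add: c_def)
  next
    case False
    then have "c \<noteq> 0" by (simp add: c_def)
    then have "gs_residual i x = c * ?e i x" for x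
      by (subst gram_schmidt_eq) (simp add: c_def)
    then show ?thesis by simp
  qed
  then have ae: "AE x in M. q i x = fourier_sum M ?e i (q i) x + c * ?e i x"
    by eventually_elim (simp add: algebra_simps)
  have sq: "(\<lambda>x. c * ?e i x) \<in> square_integrable M"
    "fourier_sum M ?e i (q i) \<in> square_integrable M"
    by (auto intro: square_integrable_scale gram_schmidt_square_integrable
        fourier_sum_square_integrable[OF e])
  have ipq: "L2_inner M (q i) (?e j) = (if j < i then L2_inner M (q i) (?e j) else 0) + c * L2_inner M (?e i) (?e j)" for j
  proof -
    have "L2_inner M (q i) (?e j) = L2_inner M (\<lambda>x. fourier_sum M ?e i (q i) x + c * ?e i x) (?e j)"
      using ae by (intro L2_inner_cong_AE q square_integrable_add sq gram_schmidt_square_integrable)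
    then show ?thesis
      by (simp add: L2_inner_add_left sq gram_schmidt_square_integrable L2_inner_fourier_sum[OF e] L2_inner_scale_left)
  qed
  have "L2_inner M (q i) (?e j) = 0" if "j > i" for j
    using ipq[of j] that orthonormal_orth[OF e, of i j] by simp
  then have "fourier_sum M ?e m (q i) x = (\<Sum>j<Suc i. L2_inner M (q i) (?e j) * ?e j x)" for x
    unfolding fourier_sum_def using assms by (intro sum.mono_neutral_right) auto
  moreover have "L2_inner M (q i) (?e i) * ?e i x = c * ?e i x" for x
  proof -
    have "L2_inner M (q i) (?e i) = c * L2_inner M (?e i) (?e i)" using ipq[of i] by simp
    then show ?thesis using orthonormal_parseval[OF e, of i x] by (simp add: mult.assoc)
  qed
  ultimately have eq: "fourier_sum M ?e m (q i) x = fourier_sum M ?e i (q i) x + c * ?e i x" for x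
    by (simp add: fourier_sum_def)
  show ?thesis unfolding eq using ae by eventually_elim (rule sym)
qed

lemma gram_schmidt_best_approximation:
  assumes f: "f \<in> square_integrable M"
  shows "L2_norm_sq M (\<lambda>x. f x - fourier_sum M (gram_schmidt M q) m f x) \<le>
    L2_norm_sq M (\<lambda>x. f x - (\<Sum>i<m. c i * q i x))"
proof (rule best_approximation[OF gram_schmidt_orthonormal f])
  let ?e = "gram_schmidt M q"
  show "(\<lambda>x. \<Sum>i<m. c i * q i x) \<in> square_integrable M"
    by (intro square_integrable_sum square_integrable_scale q)
  have "AE x in M. \<forall>i\<in>{..<m}. fourier_sum M ?e m (q i) x = q i x"
    by (intro AE_finite_allI) (auto intro: gram_schmidt_span)
  then show "AE x in M. fourier_sum M ?e m (\<lambda>x. \<Sum>i<m. c i * q i x) x = (\<Sum>i<m. c i * q i x)"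
  proof eventually_elim
    case (elim x)
    have "L2_inner M (\<lambda>x. \<Sum>i<m. c i * q i x) (?e j) = (\<Sum>i<m. c i * L2_inner M (q i) (?e j))" for j
      by (subst L2_inner_sum_left)
         (auto intro: square_integrable_scale q gram_schmidt_square_integrable simp: L2_inner_scale_left)
    then have "fourier_sum M ?e m (\<lambda>x. \<Sum>i<m. c i * q i x) x =
        (\<Sum>j<m. \<Sum>i<m. c i * (L2_inner M (q i) (?e j) * ?e j x))"
      by (simp add: fourier_sum_def sum_distrib_right mult.assoc)
    also have "\<dots> = (\<Sum>i<m. c i * fourier_sum M ?e m (q i) x)"
      by (subst sum.swap) (simp add: fourier_sum_def sum_distrib_left)
    finally show ?case using elim by simp
  qed
qed

end

section \<open>Pointwise expansions\<close>

locale fun_space_A =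
  fixes F :: "'a fun_space"
  assumes class_A: "F \<in> class_A"
begin

abbreviation "M \<equiv> meas F"

lemma normed: "normed_fun_space F"
  using class_A by (simp add: class_A_def)

sublocale Metric_space "funs F" "fdist F"
  by (rule Metric_space_fun_space[OF normed])

lemmas add_mem = fun_space_add[OF normed]
lemmas scale_mem = fun_space_scale[OF normed]
lemmas diff_mem = fun_space_diff[OF normed]
lemmas fnorm_ge_0 = fnorm_nonneg[OF normed]

lemma zero_mem: "(\<lambda>x. 0) \<in> funs F"
  using normed by (simp add: normed_fun_space_def)

lemma fnorm_zero: "fnorm F (\<lambda>x. 0) = 0"
  using fnorm_eq_0_iff[OF normed zero_mem] by simp

lemma scalars_cases: "scalars F = \<real> \<or> scalars F = UNIV"
  using normed by (simp add: normed_fun_space_def)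

lemma of_real_scalar: "complex_of_real r \<in> scalars F"
  using scalars_cases by (metis Reals_of_real UNIV_I)

lemma sum_mem:
  assumes "\<And>i. i \<in> I \<Longrightarrow> f i \<in> funs F"
  shows "(\<lambda>x. \<Sum>i\<in>I. f i x) \<in> funs F"
  using assms by (induction I rule: infinite_finite_induct) (auto intro: add_mem zero_mem)

lemma fnorm_sum_le:
  assumes "\<And>i. i \<in> I \<Longrightarrow> f i \<in> funs F"
  shows "fnorm F (\<lambda>x. \<Sum>i\<in>I. f i x) \<le> (\<Sum>i\<in>I. fnorm F (f i))"
  using assms
proof (induction I rule: infinite_finite_induct)
  case (insert i I)
  have "fnorm F (\<lambda>x. \<Sum>i\<in>insert i I. f i x) = fnorm F (\<lambda>x. f i x + (\<Sum>i\<in>I. f i x))"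
    using insert by simp
  also have "\<dots> \<le> fnorm F (f i) + fnorm F (\<lambda>x. \<Sum>i\<in>I. f i x)"
    using insert by (intro fnorm_triangle[OF normed] sum_mem) auto
  finally show ?case using insert by auto
qed (auto simp: fnorm_zero)

lemma fnorm_diff_le:
  assumes "f \<in> funs F" "g \<in> funs F"
  shows "fnorm F (\<lambda>x. f x - g x) \<le> fnorm F f + fnorm F g"
proof -
  have "fnorm F (\<lambda>x. f x + (-1) * g x) \<le> fnorm F f + fnorm F (\<lambda>x. (-1) * g x)"
    using assms minus_one_in_scalars[OF normed]
    by (intro fnorm_triangle[OF normed] scale_mem) auto
  then show ?thesis
    using fnorm_scale[OF normed minus_one_in_scalars[OF normed] assms(2)] by simp
qed

lemma mem_square_integrable: "f \<in> funs F \<Longrightarrow> f \<in> square_integrable M"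
  using class_A by (auto simp: class_A_def Ltwo_def square_integrable_def)

lemma mem_Ltwo: "f \<in> funs F \<Longrightarrow> f \<in> Ltwo F"
  using class_A by (auto simp: class_A_def)

lemma Ltwo_square_integrable: "f \<in> Ltwo F \<Longrightarrow> f \<in> square_integrable M"
  by (auto simp: Ltwo_def square_integrable_def)

lemma Ltwo_norm_L2_norm_sq: "Ltwo_norm M f = sqrt (L2_norm_sq M f)"
  by (simp add: Ltwo_norm_def L2_norm_sq_def)

lemma embedding_bound: "\<exists>C\<ge>0. \<forall>f\<in>funs F. L2_norm_sq M f \<le> C * (fnorm F f)\<^sup>2"
proof -
  obtain C where C: "\<And>f. f \<in> funs F \<Longrightarrow> Ltwo_norm M f \<le> C * fnorm F f"
    using class_A by (auto simp: class_A_def)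
  have "L2_norm_sq M f \<le> C\<^sup>2 * (fnorm F f)\<^sup>2" if f: "f \<in> funs F" for f
  proof -
    have "L2_norm_sq M f = (sqrt (L2_norm_sq M f))\<^sup>2" by simp
    also have "\<dots> \<le> (C * fnorm F f)\<^sup>2"
      using C[OF f] by (intro power_mono) (auto simp: Ltwo_norm_L2_norm_sq)
    finally show ?thesis by (simp add: power_mult_distrib)
  qed
  then show ?thesis by (intro exI[of _ "C\<^sup>2"]) auto
qed

text \<open>Continuity at 0 yields a ball of radius \<open>r\<close> on which \<open>\<phi>\<close>
  stays below 1; scaling \<open>f\<close> to norm \<open>r / 2\<close> gives the constant
  \<open>2 / r\<close>. Point evaluations and members of \<open>dual F\<close> are both
  instances.\<close>

lemma bounded_functional:
  assumes cont: "continuous_map mtopology euclidean \<phi>"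
    and hom: "\<And>c f. c \<in> scalars F \<Longrightarrow> f \<in> funs F \<Longrightarrow> \<phi> (\<lambda>x. c * f x) = c * (\<phi> f :: complex)"
  shows "\<exists>C\<ge>0. \<forall>f\<in>funs F. cmod (\<phi> f) \<le> C * fnorm F f"
proof -
  let ?z = "\<lambda>x::'a. 0::complex"
  have z: "\<phi> ?z = 0"
    using hom[of 0 ?z] of_real_scalar[of 0] zero_mem by simp
  have "openin mtopology {f \<in> topspace mtopology. \<phi> f \<in> ball 0 1}"
    using cont by (intro openin_continuous_map_preimage) auto
  then obtain r where r: "r > 0" and ball: "mball ?z r \<subseteq> {f \<in> funs F. \<phi> f \<in> ball 0 1}"
    using zero_mem z by (auto simp: openin_mtopology)
  have "cmod (\<phi> f) \<le> 2 / r * fnorm F f" if f: "f \<in> funs F" for f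
  proof (cases "fnorm F f = 0")
    case True
    then have "f = ?z" using fnorm_eq_0_iff[OF normed f] by simp
    then show ?thesis using z True by simp
  next
    case False
    then have pos: "fnorm F f > 0" using fnorm_ge_0[OF f] by simp
    define c where "c = complex_of_real (r / (2 * fnorm F f))"
    have c: "c \<in> scalars F" by (simp only: c_def of_real_scalar)
    have cc: "cmod c = r / (2 * fnorm F f)" using r pos by (simp add: c_def norm_divide)
    have "fnorm F (\<lambda>x. c * f x) = r / 2"
      using pos by (simp add: fnorm_scale[OF normed c f] cc)
    moreover have "fnorm F (\<lambda>x. - (c * f x)) = fnorm F (\<lambda>x. c * f x)"
      using fnorm_scale[OF normed minus_one_in_scalars[OF normed] scale_mem[OF c f]] by simp
    ultimately have "(\<lambda>x. c * f x) \<in> mball ?z r"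
      using r scale_mem[OF c f] zero_mem by (simp add: in_mball Defs.fdist_def)
    then have "cmod (\<phi> (\<lambda>x. c * f x)) < 1" using ball by auto
    then have "cmod c * cmod (\<phi> f) < 1" by (simp add: hom[OF c f] norm_mult)
    then show ?thesis using r pos by (simp add: cc field_simps)
  qed
  then show ?thesis using r by (intro exI[of _ "2 / r"]) auto
qed

lemma evaluation_bound:
  assumes "x \<in> domain_of F"
  shows "\<exists>C\<ge>0. \<forall>f\<in>funs F. cmod (f x) \<le> C * fnorm F f"
proof (rule bounded_functional)
  show "continuous_map mtopology euclidean (\<lambda>f. f x)"
    using class_A assms by (auto simp: class_A_def)
qed simp

lemma dual_bound:
  assumes "N \<in> dual F"
  shows "\<exists>C\<ge>0. \<forall>f\<in>funs F. cmod (N f) \<le> C * fnorm F f"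
  using assms by (intro bounded_functional) (auto simp: dual_def)

lemma countable_dense:
  "\<exists>D. countable D \<and> D \<subseteq> funs F \<and> (\<forall>f\<in>funs F. \<forall>r>0. \<exists>g\<in>D. fnorm F (\<lambda>x. f x - g x) < r)"
proof -
  have "separable_space mtopology" using class_A by (simp add: class_A_def)
  then obtain D where D: "countable D" "D \<subseteq> funs F" "mtopology closure_of D = funs F"
    by (auto simp: separable_space_def)
  have *: "\<exists>g\<in>D. fnorm F (\<lambda>x. f x - g x) < r" if "f \<in> funs F" "r > 0" for f r
  proof -
    have "f \<in> mtopology closure_of D" using D that by simp
    then have "\<exists>g\<in>D. g \<in> mball f r" using that(2) unfolding metric_closure_of by blast
    then obtain g where "g \<in> D" "g \<in> mball f r" by blast
    then show ?thesis by (intro bexI[of _ g]) (auto simp: in_mball Defs.fdist_def)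
  qed
  have "countable D \<and> D \<subseteq> funs F \<and>
      (\<forall>f\<in>funs F. \<forall>r>0. \<exists>g\<in>D. fnorm F (\<lambda>x. f x - g x) < r)"
    by (intro conjI ballI allI impI D(1,2) *)
  then show ?thesis by (rule exI)
qed

text \<open>
  An expansion that converges in the mean holds pointwise, for all functions simultaneously,
  outside of a single null set: off that set it holds for a countable dense subset, and both
  sides are continuous in \<open>f\<close>.
\<close>

lemma pointwise_expansion:
  assumes e: "orthonormal_or_zero M e"
    and w: "\<And>j. w j > 0" "summable w"
    and coeff: "\<And>f m. f \<in> funs F \<Longrightarrow> (\<Sum>j<m. (cmod (L2_inner M f (e j)))\<^sup>2 / w j) \<le> B * (fnorm F f)\<^sup>2"
    and m: "filterlim m at_top sequentially"
    and \<eta>: "summable \<eta>"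
    and conv: "\<And>f k. f \<in> funs F \<Longrightarrow>
      L2_norm_sq M (\<lambda>x. f x - fourier_sum M e (m k) f x) \<le> \<eta> k * (fnorm F f)\<^sup>2"
  shows "\<exists>X. (AE x in M. x \<in> X) \<and> X \<subseteq> domain_of F \<and>
    (\<forall>x\<in>X. summable (\<lambda>j. w j * (cmod (e j x))\<^sup>2)) \<and>
    (\<forall>f\<in>funs F. \<forall>x\<in>X. (\<lambda>j. L2_inner M f (e j) * e j x) sums f x)"
proof -
  note esq = orthonormal_square_integrable[OF e]
  have [measurable]: "e j \<in> borel_measurable M" for j
    using esq by (rule square_integrable_measurable)
  have B: "summable (\<lambda>j. (cmod (L2_inner M f (e j)))\<^sup>2 / w j)"
    "(\<Sum>j. (cmod (L2_inner M f (e j)))\<^sup>2 / w j) \<le> B * (fnorm F f)\<^sup>2" if "f \<in> funs F" for f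
  proof -
    show *: "summable (\<lambda>j. (cmod (L2_inner M f (e j)))\<^sup>2 / w j)"
    proof (rule bounded_imp_summable)
      show "0 \<le> (cmod (L2_inner M f (e j)))\<^sup>2 / w j" for j
        using w(1)[of j] by simp
      show "(\<Sum>j\<le>m. (cmod (L2_inner M f (e j)))\<^sup>2 / w j) \<le> B * (fnorm F f)\<^sup>2" for m
        using coeff[OF that, of "Suc m"] by (simp only: lessThan_Suc_atMost)
    qed
    show "(\<Sum>j. (cmod (L2_inner M f (e j)))\<^sup>2 / w j) \<le> B * (fnorm F f)\<^sup>2"
      using * coeff[OF that] by (intro suminf_le_const)
  qed
  \<comment> \<open>The weighted sum has a finite integral, since each \<open>e j\<close> has norm
    at most 1 and \<open>w\<close> is summable.\<close>
  have ae_w: "AE x in M. summable (\<lambda>j. w j * (cmod (e j x))\<^sup>2)"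
  proof -
    have "(\<integral>\<^sup>+x. (\<Sum>j. ennreal (w j * (cmod (e j x))\<^sup>2)) \<partial>M) =
        (\<Sum>j. \<integral>\<^sup>+x. ennreal (w j * (cmod (e j x))\<^sup>2) \<partial>M)"
      by (rule nn_integral_suminf) measurable
    also have "\<dots> = (\<Sum>j. ennreal (w j) * ennreal (L2_norm_sq M (e j)))"
      using w(1) by (simp add: ennreal_mult less_imp_le nn_integral_cmult nn_integral_L2_norm_sq[OF esq])
    also have "\<dots> \<le> (\<Sum>j. ennreal (w j))"
    proof (intro suminf_le summableI)
      show "ennreal (w j) * ennreal (L2_norm_sq M (e j)) \<le> ennreal (w j)" for j
        using L2_norm_sq_orthonormal[OF e, of j] by auto
    qed
    also have "\<dots> = ennreal (\<Sum>j. w j)"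
      using w by (intro suminf_ennreal2) (auto intro: less_imp_le)
    finally have "(\<integral>\<^sup>+x. (\<Sum>j. ennreal (w j * (cmod (e j x))\<^sup>2)) \<partial>M) \<noteq> \<infinity>"
      by (auto simp: top_unique)
    then have "AE x in M. (\<Sum>j. ennreal (w j * (cmod (e j x))\<^sup>2)) \<noteq> \<infinity>"
      by (intro nn_integral_PInf_AE) auto
    then show ?thesis
    proof eventually_elim
      case (elim x)
      then show ?case using w(1)[THEN less_imp_le]
        by (intro summable_suminf_not_top) auto
    qed
  qed
  have conv_x: "summable (\<lambda>j. cmod (L2_inner M f (e j) * e j x))"
    "(cmod (\<Sum>j. L2_inner M f (e j) * e j x))\<^sup>2 \<le> B * (fnorm F f)\<^sup>2 * (\<Sum>j. w j * (cmod (e j x))\<^sup>2)"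
    if f: "f \<in> funs F" and x: "summable (\<lambda>j. w j * (cmod (e j x))\<^sup>2)" for f x
  proof -
    \<comment> \<open>The weight is split between coefficient and value: \<open>a\<close> is
      square-summable by \<open>coeff\<close>, and \<open>b\<close> by the choice of
      \<open>x\<close>.\<close>
    define a where "a j = L2_inner M f (e j) / complex_of_real (sqrt (w j))" for j
    define b where "b j = complex_of_real (sqrt (w j)) * e j x" for j
    have ab: "a j * b j = L2_inner M f (e j) * e j x" for j
      using w(1)[of j] by (simp add: a_def b_def)
    have a: "(cmod (a j))\<^sup>2 = (cmod (L2_inner M f (e j)))\<^sup>2 / w j" for j
      using w(1)[of j] by (simp add: a_def norm_divide power_divide)
    have b: "(cmod (b j))\<^sup>2 = w j * (cmod (e j x))\<^sup>2" for j
      using w(1)[of j] by (simp add: b_def norm_mult power_mult_distrib)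
    show "summable (\<lambda>j. cmod (L2_inner M f (e j) * e j x))"
      using summable_mult_of_square_summable[of a b] B(1)[OF f] x by (simp add: a b ab)
    have "(cmod (\<Sum>j. L2_inner M f (e j) * e j x))\<^sup>2 \<le>
        (\<Sum>j. (cmod (L2_inner M f (e j)))\<^sup>2 / w j) * (\<Sum>j. w j * (cmod (e j x))\<^sup>2)"
      using Cauchy_Schwarz_suminf[of a b] B(1)[OF f] x by (simp add: a b ab)
    also have "\<dots> \<le> B * (fnorm F f)\<^sup>2 * (\<Sum>j. w j * (cmod (e j x))\<^sup>2)"
      using w(1)[THEN less_imp_le] by (intro mult_right_mono B(2) f suminf_nonneg x) auto
    finally show "(cmod (\<Sum>j. L2_inner M f (e j) * e j x))\<^sup>2 \<le>
      B * (fnorm F f)\<^sup>2 * (\<Sum>j. w j * (cmod (e j x))\<^sup>2)" .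
  qed
  obtain D where D': "countable D \<and> D \<subseteq> funs F \<and>
      (\<forall>f\<in>funs F. \<forall>r>0. \<exists>g\<in>D. fnorm F (\<lambda>x. f x - g x) < r)"
    using countable_dense by (rule exE)
  note D = D'[THEN conjunct1] D'[THEN conjunct2, THEN conjunct1]
  note dense = D'[THEN conjunct2, THEN conjunct2, rule_format]
  have ae_f: "AE x in M. f x = (\<Sum>j. L2_inner M f (e j) * e j x)" if f: "f \<in> funs F" for f
  proof -
    define d where "d k = (\<lambda>x. f x - fourier_sum M e (m k) f x)" for k
    have dsq: "d k \<in> square_integrable M" for k
      unfolding d_def by (intro square_integrable_diff mem_square_integrable f fourier_sum_square_integrable[OF e])
    have [measurable]: "d k \<in> borel_measurable M" for k
      using dsq by (rule square_integrable_measurable)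
    \<comment> \<open>Convergence in the mean alone would give almost everywhere convergence only
      along a further subsequence. Summable squared errors give it along \<open>m\<close>
      itself.\<close>
    have s: "summable (\<lambda>k. L2_norm_sq M (d k))"
    proof (rule summable_comparison_test)
      show "\<exists>N. \<forall>k\<ge>N. norm (L2_norm_sq M (d k)) \<le> \<eta> k * (fnorm F f)\<^sup>2" using conv[OF f] by (auto simp: d_def)
      show "summable (\<lambda>k. \<eta> k * (fnorm F f)\<^sup>2)" using \<eta> by (rule summable_mult2)
    qed
    have "(\<integral>\<^sup>+x. (\<Sum>k. ennreal ((cmod (d k x))\<^sup>2)) \<partial>M) = (\<Sum>k. ennreal (L2_norm_sq M (d k)))"
      by (subst nn_integral_suminf) (measurable, simp add: nn_integral_L2_norm_sq[OF dsq])
    also have "\<dots> = ennreal (\<Sum>k. L2_norm_sq M (d k))"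
      using s by (intro suminf_ennreal2) auto
    finally have "(\<integral>\<^sup>+x. (\<Sum>k. ennreal ((cmod (d k x))\<^sup>2)) \<partial>M) \<noteq> \<infinity>" by simp
    then have "AE x in M. (\<Sum>k. ennreal ((cmod (d k x))\<^sup>2)) \<noteq> \<infinity>"
      by (intro nn_integral_PInf_AE) measurable
    then show ?thesis using ae_w
    proof eventually_elim
      case (elim x)
      have "summable (\<lambda>k. (cmod (d k x))\<^sup>2)"
        using elim by (intro summable_suminf_not_top) auto
      then have "(\<lambda>k. (cmod (d k x))\<^sup>2) \<longlonglongrightarrow> 0" by (rule summable_LIMSEQ_zero)
      then have "(\<lambda>k. sqrt ((cmod (d k x))\<^sup>2)) \<longlonglongrightarrow> sqrt 0" by (rule tendsto_real_sqrt)
      then have "(\<lambda>k. cmod (d k x)) \<longlonglongrightarrow> 0"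
        by (simp only: real_sqrt_zero real_sqrt_abs abs_norm_cancel)
      then have "(\<lambda>k. d k x) \<longlonglongrightarrow> 0"
        by (rule tendsto_norm_zero_cancel)
      from tendsto_diff[OF tendsto_const[of "f x"] this]
      have 1: "(\<lambda>k. fourier_sum M e (m k) f x) \<longlonglongrightarrow> f x"
        by (simp only: d_def diff_diff_eq2 add_diff_cancel_left' diff_zero)
      have "summable (\<lambda>j. L2_inner M f (e j) * e j x)"
        using conv_x(1)[OF f elim(2)] by (rule summable_norm_cancel)
      from filterlim_compose[OF summable_LIMSEQ[OF this] m]
      have "(\<lambda>k. fourier_sum M e (m k) f x) \<longlonglongrightarrow> (\<Sum>j. L2_inner M f (e j) * e j x)"
        by (simp only: fourier_sum_def)
      with 1 show ?case by (rule LIMSEQ_unique)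
    qed
  qed
  define X where "X = {x \<in> domain_of F. summable (\<lambda>j. w j * (cmod (e j x))\<^sup>2) \<and>
    (\<forall>f\<in>D. f x = (\<Sum>j. L2_inner M f (e j) * e j x))}"
  have "AE x in M. \<forall>f\<in>D. f x = (\<Sum>j. L2_inner M f (e j) * e j x)"
    using D ae_f by (intro AE_ball_countable') auto
  then have aeX: "AE x in M. x \<in> X"
    using ae_w AE_space[of M] unfolding X_def by eventually_elim auto
  moreover have "(\<lambda>j. L2_inner M f (e j) * e j x) sums f x" if f: "f \<in> funs F" and x: "x \<in> X" for f x
  proof -
    define H where "H = (\<Sum>j. w j * (cmod (e j x))\<^sup>2)"
    have sx: "summable (\<lambda>j. w j * (cmod (e j x))\<^sup>2)" and xd: "x \<in> domain_of F"
      using x by (auto simp: X_def)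
    have H0: "H \<ge> 0"
      unfolding H_def using w(1)[THEN less_imp_le] by (intro suminf_nonneg sx) auto
    obtain C where C: "C \<ge> 0" "\<And>g. g \<in> funs F \<Longrightarrow> cmod (g x) \<le> C * fnorm F g"
      using evaluation_bound[OF xd] by blast
    let ?L = "\<lambda>f. (\<Sum>j. L2_inner M f (e j) * e j x)"
    have L: "cmod (?L g) \<le> sqrt (\<bar>B\<bar> * H) * fnorm F g" if g: "g \<in> funs F" for g
    proof (rule power2_le_imp_le)
      have "(cmod (?L g))\<^sup>2 \<le> B * (fnorm F g)\<^sup>2 * H"
        using conv_x(2)[OF g sx] by (simp add: H_def)
      also have "\<dots> \<le> \<bar>B\<bar> * (fnorm F g)\<^sup>2 * H"
        using H0 by (intro mult_right_mono) auto
      also have "\<dots> = (sqrt (\<bar>B\<bar> * H) * fnorm F g)\<^sup>2"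
        using H0 by (simp add: power_mult_distrib)
      finally show "(cmod (?L g))\<^sup>2 \<le> (sqrt (\<bar>B\<bar> * H) * fnorm F g)\<^sup>2" .
      show "0 \<le> sqrt (\<bar>B\<bar> * H) * fnorm F g" using H0 fnorm_ge_0[OF g] by simp
    qed
    define R where "R = C + sqrt (\<bar>B\<bar> * H)"
    have R0: "R \<ge> 0" using C(1) H0 by (simp add: R_def)
    have small: "cmod (f x - ?L f) \<le> R * \<delta>" if \<delta>: "\<delta> > 0" for \<delta>
    proof -
      obtain g where g: "g \<in> D" "fnorm F (\<lambda>x. f x - g x) < \<delta>" using dense[OF f \<delta>] by (elim bexE)
      have gF: "g \<in> funs F" using g D by auto
      have gx: "g x = ?L g" using x g by (auto simp: X_def)
      let ?h = "\<lambda>x. f x - g x"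
      have h: "?h \<in> funs F" by (intro diff_mem f gF)
      have "?L ?h = (\<Sum>j. L2_inner M f (e j) * e j x - L2_inner M g (e j) * e j x)"
        by (simp add: L2_inner_diff_left mem_square_integrable f gF esq left_diff_distrib)
      also have "\<dots> = ?L f - ?L g"
        by (intro suminf_diff[symmetric] summable_norm_cancel[OF conv_x(1)] f gF sx)
      finally have "f x - ?L f = ?h x - ?L ?h" using gx by simp
      then have "cmod (f x - ?L f) \<le> cmod (?h x) + cmod (?L ?h)"
        by (simp only: norm_triangle_ineq4)
      also have "\<dots> \<le> C * fnorm F ?h + sqrt (\<bar>B\<bar> * H) * fnorm F ?h"
        by (intro add_mono C(2) L h)
      also have "\<dots> = R * fnorm F ?h" by (simp add: R_def algebra_simps)
      also have "\<dots> \<le> R * \<delta>" using R0 g by (intro mult_left_mono) auto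
      finally show ?thesis .
    qed
    have "cmod (f x - ?L f) \<le> 0 + \<delta>" if "\<delta> > 0" for \<delta>
    proof -
      \<comment> \<open>\<open>R\<close> may be 0, hence the denominator
        \<open>R + 1\<close>.\<close>
      have "cmod (f x - ?L f) \<le> R * (\<delta> / (R + 1))"
        using R0 that by (intro small) simp
      also have "\<dots> \<le> \<delta>" using R0 that by (simp add: field_simps)
      finally show ?thesis by simp
    qed
    then have "cmod (f x - ?L f) \<le> 0" by (rule field_le_epsilon)
    then have "f x = ?L f" by simp
    then show ?thesis
      using summable_sums[OF summable_norm_cancel[OF conv_x(1)[OF f sx]]] by simp
  qed
  ultimately show ?thesis by (intro exI[of _ X]) (auto simp: X_def)
qed

end

section \<open>Kolmogorov and Gelfand widths\<close>

text \<open>Each of the \<open>fact r\<close> terms of the Leibniz formula is bounded by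
  \<open>C ^ r\<close>. The estimate is crude, but it serves only to make a supremum of determinants
  finite.\<close>

lemma norm_det_le:
  fixes A :: "complex mat"
  assumes A: "A \<in> carrier_mat r r" and C: "\<And>i j. i < r \<Longrightarrow> j < r \<Longrightarrow> cmod (A $$ (i, j)) \<le> C"
  shows "cmod (Determinant.det A) \<le> fact r * C ^ r"
proof -
  have "cmod (signof p * (\<Prod>i = 0..<r. A $$ (i, p i))) \<le> C ^ r" if p: "p permutes {0..<r}" for p
  proof -
    have "cmod (signof p :: complex) = 1" by (simp add: sign_def)
    moreover have "(\<Prod>i = 0..<r. cmod (A $$ (i, p i))) \<le> (\<Prod>i = 0..<r. C)"
    proof (intro prod_mono conjI C)
      fix i assume i: "i \<in> {0..<r}"
      then show "i < r" by simp
      show "p i < r" using permutes_in_image[OF p, of i] i by simp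
    qed simp
    ultimately show ?thesis by (simp add: norm_mult prod_norm[symmetric])
  qed
  then have "cmod (Determinant.det A) \<le> of_nat (card {p. p permutes {0..<r}}) * C ^ r"
    unfolding det_def'[OF A] by (intro sum_norm_bound) simp
  then show ?thesis by (simp add: card_permutations)
qed

context fun_space_A
begin

lemma dual_scale: "N \<in> dual F \<Longrightarrow> c \<in> scalars F \<Longrightarrow> f \<in> funs F \<Longrightarrow> N (\<lambda>x. c * f x) = c * N f"
  by (simp add: dual_def)

lemma dual_add:
  "N \<in> dual F \<Longrightarrow> f \<in> funs F \<Longrightarrow> g \<in> funs F \<Longrightarrow> N (\<lambda>x. f x + g x) = N f + N g"
  by (simp add: dual_def)

lemma dual_diff:
  assumes "N \<in> dual F" "f \<in> funs F" "g \<in> funs F"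
  shows "N (\<lambda>x. f x - g x) = N f - N g"
proof -
  have "N (\<lambda>x. f x + (-1) * g x) = N f + N (\<lambda>x. (-1) * g x)"
    by (intro dual_add assms scale_mem minus_one_in_scalars[OF normed])
  then show ?thesis
    using dual_scale[OF assms(1) minus_one_in_scalars[OF normed] assms(3)] by simp
qed

lemma dual_zero: "N \<in> dual F \<Longrightarrow> N (\<lambda>x. 0) = 0"
  using dual_diff[of N "\<lambda>x. 0" "\<lambda>x. 0"] zero_mem by simp

lemma dual_sum:
  assumes N: "N \<in> dual F" and "\<And>i. i \<in> I \<Longrightarrow> f i \<in> funs F"
  shows "N (\<lambda>x. \<Sum>i\<in>I. f i x) = (\<Sum>i\<in>I. N (f i))"
  using assms(2)
proof (induction I rule: infinite_finite_induct)
  case (insert i I)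
  have "N (\<lambda>x. f i x + (\<Sum>i\<in>I. f i x)) = N (f i) + N (\<lambda>x. \<Sum>i\<in>I. f i x)"
    using N insert.prems by (intro dual_add sum_mem) auto
  then show ?case using insert by simp
qed (auto simp: dual_zero N)

definition pairing_det :: "nat \<Rightarrow> (nat \<Rightarrow> ('a \<Rightarrow> complex) \<Rightarrow> complex) \<Rightarrow> (nat \<Rightarrow> 'a \<Rightarrow> complex) \<Rightarrow> complex" where
  "pairing_det r N g = Determinant.det (Matrix.mat r r (\<lambda>(i, j). N i (g j)))"

text \<open>Quotients of these determinants become coefficients of functions in \<open>F\<close>, so
  they have to be real when the space is real.\<close>

lemma pairing_det_scalar:
  assumes "\<And>i. i < r \<Longrightarrow> N i \<in> dual F" "\<And>j. j < r \<Longrightarrow> g j \<in> funs F"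
  shows "pairing_det r N g \<in> scalars F"
proof (cases "scalars F = \<real>")
  case True
  have "N i (g j) \<in> \<real>" if "i < r" "j < r" for i j
    using assms that True by (auto simp: dual_def)
  moreover have "p i < r" if "p permutes {0..<r}" "i < r" for p i
    using permutes_in_image[OF that(1), of i] that(2) by simp
  ultimately have "pairing_det r N g \<in> \<real>"
    unfolding pairing_det_def
    by (subst det_def'[where n = r])
       (auto intro!: sum_in_Reals prod_in_Reals Reals_mult simp: sign_def)
  with True show ?thesis by simp
next
  case False
  then show ?thesis using scalars_cases by auto
qed

text \<open>
  An approximate Auerbach basis: if the determinant of \<open>N i (g j)\<close> is within a factor 2 of its
  supremum over the unit ball, then the coefficients given by Cramer's rule are bounded by 2.
\<close>

lemma approximate_auerbach:
  fixes r :: nat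
  assumes N: "\<And>i. i < r \<Longrightarrow> N i \<in> dual F"
    and h: "\<And>i. i < r \<Longrightarrow> h i \<in> funs F" "\<And>i. i < r \<Longrightarrow> N i (h i) \<noteq> 0"
      "\<And>i j. i < r \<Longrightarrow> j < r \<Longrightarrow> i \<noteq> j \<Longrightarrow> N i (h j) = 0"
  shows "\<exists>g. (\<forall>j<r. g j \<in> unit_ball F) \<and> (\<forall>f\<in>unit_ball F. \<exists>c. (\<forall>j<r. c j \<in> scalars F \<and> cmod (c j) \<le> 2) \<and>
    (\<forall>i<r. N i f = (\<Sum>j<r. c j * N i (g j))))"
proof -
  define S where "S = (\<lambda>g. cmod (pairing_det r N g)) ` {g. \<forall>j<r. g j \<in> unit_ball F}"
  have "\<exists>C\<ge>0. \<forall>f\<in>funs F. cmod (N i f) \<le> C * fnorm F f" if "i < r" for i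
    using dual_bound[OF N[OF that]] .
  then obtain C where C: "\<And>i. i < r \<Longrightarrow> C i \<ge> 0"
    "\<And>i f. i < r \<Longrightarrow> f \<in> funs F \<Longrightarrow> cmod (N i f) \<le> C i * fnorm F f" by metis
  have bdd: "bdd_above S"
  proof -
    have "cmod (pairing_det r N g) \<le> fact r * (\<Sum>i<r. C i) ^ r" if g: "\<forall>j<r. g j \<in> unit_ball F" for g
      unfolding pairing_det_def
    proof (rule norm_det_le)
      fix i j assume ij: "i < r" "j < r"
      have "cmod (N i (g j)) \<le> C i * fnorm F (g j)"
        using C ij g by (auto simp: unit_ball_def)
      also have "\<dots> \<le> C i * 1"
        using C ij g by (intro mult_left_mono) (auto simp: unit_ball_def)
      also have "\<dots> \<le> (\<Sum>i<r. C i)"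
        using C ij member_le_sum[of i "{..<r}" C] by simp
      finally show "cmod (Matrix.mat r r (\<lambda>(i, j). N i (g j)) $$ (i, j)) \<le> (\<Sum>i<r. C i)"
        using ij by simp
    qed simp
    then show ?thesis by (auto simp: S_def intro!: bdd_aboveI)
  qed
  \<comment> \<open>The normalised \<open>h j\<close> have a diagonal pairing matrix with nonzero
    entries, so the supremum of \<open>S\<close> is positive.\<close>
  define g0 where "g0 j = (\<lambda>x. complex_of_real (1 / fnorm F (h j)) * h j x)" for j
  have hpos: "fnorm F (h j) > 0" if "j < r" for j
  proof -
    have "h j \<noteq> (\<lambda>x. 0)" using h(2)[OF that] dual_zero[OF N[OF that]] by auto
    then show ?thesis
      using fnorm_eq_0_iff[OF normed h(1)[OF that]] fnorm_ge_0[OF h(1)[OF that]] by linarith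
  qed
  have g0: "g0 j \<in> unit_ball F" if "j < r" for j
    using that hpos[OF that] h(1)[OF that]
    by (simp add: g0_def unit_ball_def scale_mem of_real_scalar fnorm_scale[OF normed] del: of_real_divide)
  have "pairing_det r N g0 \<noteq> 0"
  proof -
    let ?A = "Matrix.mat r r (\<lambda>(i, j). N i (g0 j))"
    have Ng0: "N i (g0 j) = complex_of_real (1 / fnorm F (h j)) * N i (h j)" if "i < r" "j < r" for i j
      using that unfolding g0_def by (intro dual_scale N h of_real_scalar)
    have "upper_triangular ?A"
      using h(3) by (auto simp: Ng0)
    moreover have "0 \<notin> set (diag_mat ?A)"
      using h(2) hpos by (fastforce simp: diag_mat_def Ng0)
    ultimately show ?thesis
      using det_upper_triangular[of ?A r] by (simp add: pairing_det_def)
  qed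
  moreover have g0S: "cmod (pairing_det r N g0) \<in> S" using g0 by (auto simp: S_def)
  ultimately have pos: "0 < Sup S"
    using bdd by (intro less_le_trans[OF _ cSup_upper]) auto
  \<comment> \<open>The supremum need not be attained. A family exceeding half of it exists, and
    this is the origin of the coefficient bound 2.\<close>
  then have "Sup S / 2 < Sup S" by simp
  moreover have "S \<noteq> {}" using g0S by auto
  ultimately have "\<exists>s\<in>S. Sup S / 2 < s" by (intro less_cSupD)
  then obtain g where g: "\<forall>j<r. g j \<in> unit_ball F" and gS: "Sup S / 2 < cmod (pairing_det r N g)"
    unfolding S_def by blast
  have max: "cmod (pairing_det r N g') \<le> 2 * cmod (pairing_det r N g)" if "\<forall>j<r. g' j \<in> unit_ball F" for g'
    using cSup_upper[OF _ bdd, of "cmod (pairing_det r N g')"] that gS by (auto simp: S_def)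
  have gd: "pairing_det r N g \<noteq> 0" using gS pos by auto
  have gF: "g j \<in> funs F" if "j < r" for j using g that by (auto simp: unit_ball_def)
  show ?thesis
  proof (intro exI[of _ g] conjI ballI g)
    fix f assume f: "f \<in> unit_ball F"
    define A where "A = Matrix.mat r r (\<lambda>(i, j). N i (g j))"
    have A: "A \<in> carrier_mat r r" by (simp add: A_def)
    have dA: "Determinant.det A \<noteq> 0" using gd by (simp add: pairing_det_def A_def)
    define b where "b = Matrix.vec r (\<lambda>i. N i f)"
    define x where "x = (1 / Determinant.det A) \<cdot>\<^sub>v (adj_mat A *\<^sub>v b)"
    have b: "b \<in> carrier_vec r" by (simp add: b_def)
    have x: "x \<in> carrier_vec r" using adj_mat(1)[OF A] b by (simp add: x_def)
    have Ax: "A *\<^sub>v x = b"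
    proof -
      have "A *\<^sub>v x = (1 / Determinant.det A) \<cdot>\<^sub>v (A *\<^sub>v (adj_mat A *\<^sub>v b))"
        unfolding x_def using A adj_mat(1)[OF A] b by (intro mult_mat_vec) auto
      also have "A *\<^sub>v (adj_mat A *\<^sub>v b) = (A * adj_mat A) *\<^sub>v b"
        using A adj_mat(1)[OF A] b by (metis assoc_mult_mat_vec)
      also have "\<dots> = Determinant.det A \<cdot>\<^sub>v b"
        unfolding adj_mat(2)[OF A] using b by auto
      finally show ?thesis using dA b by (simp add: smult_smult_assoc)
    qed
    \<comment> \<open>Replacing column \<open>k\<close> by the data of \<open>f\<close> amounts to
      replacing \<open>g k\<close> by \<open>f\<close>, again a family in the unit ball, so
      near-maximality bounds the quotient.\<close>
    have xk: "vec_index x k = pairing_det r N (g(k := f)) / pairing_det r N g" if k: "k < r" for k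
    proof -
      have "replace_col A b k = Matrix.mat r r (\<lambda>(i, j). N i ((g(k := f)) j))"
        using k by (intro eq_matI) (auto simp: replace_col_def A_def b_def)
      then have "pairing_det r N (g(k := f)) = vec_index x k * pairing_det r N g"
        using cramer_lemma_mat[OF A x k] unfolding Ax pairing_det_def by (simp only: A_def)
      then show ?thesis using gd by simp
    qed
    show "\<exists>c. (\<forall>j<r. c j \<in> scalars F \<and> cmod (c j) \<le> 2) \<and> (\<forall>i<r. N i f = (\<Sum>j<r. c j * N i (g j)))"
    proof (intro exI[of _ "vec_index x"] conjI allI impI)
      fix k assume k: "k < r"
      have g': "\<forall>j<r. (g(k := f)) j \<in> unit_ball F" using g f by auto
      then have "pairing_det r N (g(k := f)) \<in> scalars F"
        by (intro pairing_det_scalar N) (auto simp: unit_ball_def)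
      moreover have "pairing_det r N g \<in> scalars F" by (intro pairing_det_scalar N gF)
      ultimately show "vec_index x k \<in> scalars F"
        using scalars_cases xk[OF k] by (auto intro: Reals_divide)
      show "cmod (vec_index x k) \<le> 2"
        using max[OF g'] gd by (simp add: xk[OF k] norm_divide divide_simps fun_upd_def)
    next
      fix i assume i: "i < r"
      have "N i f = vec_index (A *\<^sub>v x) i" using i by (simp add: Ax b_def)
      also have "\<dots> = (\<Sum>j<r. N i (g j) * vec_index x j)"
        using i x A by (simp add: scalar_prod_def A_def atLeast0LessThan)
      finally show "N i f = (\<Sum>j<r. vec_index x j * N i (g j))" by (simp add: mult.commute)
    qed
  qed
qed

lemma L2_norm_sq_fnorm_zero: "f \<in> funs F \<Longrightarrow> fnorm F f = 0 \<Longrightarrow> L2_norm_sq M f = 0"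
  using fnorm_eq_0_iff[OF normed, of f] by auto

lemma normalise:
  assumes f: "f \<in> funs F" and "fnorm F f \<noteq> 0"
  shows "(\<lambda>x. complex_of_real (1 / fnorm F f) * f x) \<in> unit_ball F"
  using assms fnorm_ge_0[OF f]
  by (simp add: unit_ball_def scale_mem[OF of_real_scalar f] fnorm_scale[OF normed of_real_scalar f]
      del: of_real_divide)

text \<open>Subtracting from \<open>f\<close> the combination of an approximate Auerbach basis with
  the same data leaves an element of the kernel. For \<open>f\<close> in the unit ball its norm is
  at most \<open>1 + 2 * n\<close>, and \<open>ker\<close> applies to it.\<close>

lemma kolmogorov_le_gelfand:
  assumes N: "\<And>i. i < n \<Longrightarrow> N i \<in> dual F"
    and ker: "\<And>h. h \<in> funs F \<Longrightarrow> (\<forall>i<n. N i h = 0) \<Longrightarrow> L2_norm_sq M h \<le> \<rho> * (fnorm F h)\<^sup>2"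
    and \<rho>: "\<rho> \<ge> 0"
  shows "\<exists>g. (\<forall>i<n. g i \<in> funs F) \<and>
    (\<forall>f\<in>funs F. \<exists>c. L2_norm_sq M (\<lambda>x. f x - (\<Sum>i<n. c i * g i x)) \<le> \<rho> * (2 * real n + 1)\<^sup>2 * (fnorm F f)\<^sup>2)"
proof -
  \<comment> \<open>The functionals may be dependent. A smallest index set with the same kernel
    admits a biorthogonal family \<open>h\<close> up to nonzero factors, since otherwise an index
    could be removed.\<close>
  define good where "good I \<longleftrightarrow> I \<subseteq> {..<n} \<and> (\<forall>f\<in>funs F. (\<forall>i\<in>I. N i f = 0) \<longrightarrow> (\<forall>i<n. N i f = 0))" for I
  have "good {..<n}" by (auto simp: good_def)
  then obtain I where I: "good I" and min: "\<And>J. good J \<Longrightarrow> card I \<le> card J"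
    using arg_min_nat_lemma[of good "{..<n}" card] by blast
  have fin: "finite I" using I finite_subset by (auto simp: good_def)
  define r where "r = card I"
  have rn: "r \<le> n" using I card_mono[of "{..<n}" I] by (simp add: r_def good_def)
  obtain \<sigma> where \<sigma>: "bij_betw \<sigma> {0..<r} I" using ex_bij_betw_nat_finite[OF fin] by (auto simp: r_def)
  have \<sigma>I: "\<sigma> i \<in> I" if "i < r" for i using \<sigma> that by (auto simp: bij_betw_def)
  have "\<exists>h\<in>funs F. N i h \<noteq> 0 \<and> (\<forall>j\<in>I - {i}. N j h = 0)" if i: "i \<in> I" for i
  proof (rule ccontr)
    assume "\<not> ?thesis"
    then have *: "\<And>h. h \<in> funs F \<Longrightarrow> (\<forall>j\<in>I - {i}. N j h = 0) \<Longrightarrow> N i h = 0" by blast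
    have "good (I - {i})"
      unfolding good_def
    proof (intro conjI ballI impI)
      show "I - {i} \<subseteq> {..<n}" using I by (auto simp: good_def)
      fix f assume f: "f \<in> funs F" and z: "\<forall>j\<in>I - {i}. N j f = 0"
      then have "\<forall>j\<in>I. N j f = 0" using *[OF f z] by blast
      then show "\<forall>i<n. N i f = 0" using I f by (simp add: good_def)
    qed
    then have "card I \<le> card (I - {i})" by (rule min)
    then show False using card_Diff1_less[OF fin i] by linarith
  qed
  then obtain h where h: "\<And>i. i \<in> I \<Longrightarrow> h i \<in> funs F" "\<And>i. i \<in> I \<Longrightarrow> N i (h i) \<noteq> 0"
    "\<And>i j. i \<in> I \<Longrightarrow> j \<in> I \<Longrightarrow> j \<noteq> i \<Longrightarrow> N j (h i) = 0"
    by (metis Diff_iff singletonD)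
  have "\<exists>g. (\<forall>j<r. g j \<in> unit_ball F) \<and> (\<forall>f\<in>unit_ball F. \<exists>c. (\<forall>j<r. c j \<in> scalars F \<and> cmod (c j) \<le> 2) \<and>
    (\<forall>i<r. N (\<sigma> i) f = (\<Sum>j<r. c j * N (\<sigma> i) (g j))))"
  proof (rule approximate_auerbach)
    show "N (\<sigma> i) \<in> dual F" if "i < r" for i
      using \<sigma>I[OF that] I N by (auto simp: good_def)
    show "h (\<sigma> i) \<in> funs F" "N (\<sigma> i) (h (\<sigma> i)) \<noteq> 0" if "i < r" for i
      using h \<sigma>I[OF that] by auto
    show "N (\<sigma> i) (h (\<sigma> j)) = 0" if "i < r" "j < r" "i \<noteq> j" for i j
    proof (rule h(3)[OF \<sigma>I[OF that(2)] \<sigma>I[OF that(1)]])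
      show "\<sigma> i \<noteq> \<sigma> j" using \<sigma> that by (auto simp: bij_betw_def inj_on_def)
    qed
  qed
  then obtain g where g: "\<forall>j<r. g j \<in> unit_ball F"
    and gc: "\<forall>f\<in>unit_ball F. \<exists>c. (\<forall>j<r. c j \<in> scalars F \<and> cmod (c j) \<le> 2) \<and>
      (\<forall>i<r. N (\<sigma> i) f = (\<Sum>j<r. c j * N (\<sigma> i) (g j)))"
    by (elim exE conjE) (rule that)
  have gF: "g j \<in> funs F" if "j < r" for j using g that by (auto simp: unit_ball_def)
  \<comment> \<open>Padding with zeros brings the \<open>r\<close> functions up to the stated number
    \<open>n\<close>.\<close>
  define g' where "g' j = (if j < r then g j else (\<lambda>x. 0))" for j
  have sum_g': "(\<Sum>i<n. c i * g' i x) = (\<Sum>i<r. c i * g i x)" for c x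
    using rn by (intro sum.mono_neutral_cong_right) (auto simp: g'_def)
  have unit: "\<exists>c. L2_norm_sq M (\<lambda>x. f x - (\<Sum>i<n. c i * g' i x)) \<le> \<rho> * (2 * real n + 1)\<^sup>2"
    if f: "f \<in> unit_ball F" for f
  proof -
    obtain c where c: "\<forall>j<r. c j \<in> scalars F \<and> cmod (c j) \<le> 2"
      and Nc: "\<forall>i<r. N (\<sigma> i) f = (\<Sum>j<r. c j * N (\<sigma> i) (g j))"
      using gc f by blast
    have fF: "f \<in> funs F" using f by (simp add: unit_ball_def)
    have sF: "(\<lambda>x. c i * g i x) \<in> funs F" if "i < r" for i
      using c that by (intro scale_mem gF) auto
    let ?s = "\<lambda>x. \<Sum>i<r. c i * g i x"
    have s: "?s \<in> funs F" using sF by (intro sum_mem) auto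
    let ?h = "\<lambda>x. f x - ?s x"
    have hF: "?h \<in> funs F" using fF s by (rule diff_mem)
    have "N i ?h = 0" if "i \<in> I" for i
    proof -
      have "i \<in> \<sigma> ` {0..<r}" using \<sigma> that by (simp add: bij_betw_def)
      then obtain k where k: "k < r" "i = \<sigma> k" by fastforce
      have Ni: "N i \<in> dual F" using that I N by (auto simp: good_def)
      have "N i ?h = N i f - N i ?s" by (rule dual_diff[OF Ni fF s])
      also have "N i ?s = (\<Sum>j<r. N i (\<lambda>x. c j * g j x))"
        using sF by (intro dual_sum[OF Ni]) auto
      also have "\<dots> = (\<Sum>j<r. c j * N i (g j))"
        using c gF by (intro sum.cong dual_scale[OF Ni]) auto
      finally show ?thesis using Nc k by simp
    qed
    then have "\<forall>i<n. N i ?h = 0" using I hF unfolding good_def by blast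
    then have "L2_norm_sq M ?h \<le> \<rho> * (fnorm F ?h)\<^sup>2" by (rule ker[OF hF])
    also have "\<dots> \<le> \<rho> * (2 * real n + 1)\<^sup>2"
    proof (intro mult_left_mono power_mono \<rho> fnorm_ge_0 hF)
      have "fnorm F ?h \<le> fnorm F f + fnorm F ?s" by (rule fnorm_diff_le[OF fF s])
      also have "fnorm F ?s \<le> (\<Sum>i<r. fnorm F (\<lambda>x. c i * g i x))"
        using sF by (intro fnorm_sum_le) auto
      also have "\<dots> \<le> (\<Sum>i<r. 2 * 1)"
      proof (intro sum_mono)
        fix i assume "i \<in> {..<r}"
        then have i: "i < r" by simp
        have "fnorm F (\<lambda>x. c i * g i x) = cmod (c i) * fnorm F (g i)"
          using c i by (intro fnorm_scale[OF normed] gF) auto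
        also have "\<dots> \<le> 2 * 1"
          using c g i by (intro mult_mono fnorm_ge_0 gF) (auto simp: unit_ball_def)
        finally show "fnorm F (\<lambda>x. c i * g i x) \<le> 2 * 1" .
      qed
      also have "\<dots> \<le> 2 * real n" using rn by simp
      finally show "fnorm F ?h \<le> 2 * real n + 1" using f by (simp add: unit_ball_def)
    qed
    finally show ?thesis unfolding sum_g' by blast
  qed
  show ?thesis
  proof (intro exI[of _ g'] conjI ballI)
    show "\<forall>i<n. g' i \<in> funs F" using gF zero_mem by (auto simp: g'_def)
    fix f assume f: "f \<in> funs F"
    show "\<exists>c. L2_norm_sq M (\<lambda>x. f x - (\<Sum>i<n. c i * g' i x)) \<le> \<rho> * (2 * real n + 1)\<^sup>2 * (fnorm F f)\<^sup>2"
    proof (cases "fnorm F f = 0")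
      case True
      then have "f = (\<lambda>x. 0)" using fnorm_eq_0_iff[OF normed f] by simp
      then show ?thesis by (intro exI[of _ "\<lambda>i. 0"]) (simp add: fnorm_zero)
    next
      case False
      let ?t = "fnorm F f"
      let ?f = "\<lambda>x. complex_of_real (1 / ?t) * f x"
      have "?f \<in> unit_ball F" using f False by (rule normalise)
      then obtain c where c: "L2_norm_sq M (\<lambda>x. ?f x - (\<Sum>i<n. c i * g' i x)) \<le> \<rho> * (2 * real n + 1)\<^sup>2"
        using unit by blast
      have "(\<lambda>x. f x - (\<Sum>i<n. (complex_of_real ?t * c i) * g' i x)) =
          (\<lambda>x. complex_of_real ?t * (?f x - (\<Sum>i<n. c i * g' i x)))"
        using False by (simp add: algebra_simps sum_distrib_left)
      then have "L2_norm_sq M (\<lambda>x. f x - (\<Sum>i<n. (complex_of_real ?t * c i) * g' i x)) =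
          ?t\<^sup>2 * L2_norm_sq M (\<lambda>x. ?f x - (\<Sum>i<n. c i * g' i x))"
        by (simp only: L2_norm_sq_scale) simp
      also have "\<dots> \<le> ?t\<^sup>2 * (\<rho> * (2 * real n + 1)\<^sup>2)"
        by (rule mult_left_mono[OF c]) simp
      finally show ?thesis
        by (intro exI[of _ "\<lambda>i. complex_of_real ?t * c i"]) (simp add: mult.commute)
    qed
  qed
qed

end

section \<open>Errors of sampling algorithms\<close>

context fun_space_A
begin

text \<open>If all functionals vanish at \<open>u\<close>, then \<open>u\<close> and
  \<open>-u\<close> share their data, so one value of \<open>\<phi>\<close> approximates both, and
  \<open>2 * u\<close> is the difference of the two errors. The radius is
  \<open>2 * \<epsilon>\<close> because the infimum in \<open>c_err\<close> need not be
  attained.\<close>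

lemma gelfand_radius:
  assumes c: "c_err n F \<le> ennreal \<epsilon>" and \<epsilon>: "\<epsilon> > 0"
  shows "\<exists>N. (\<forall>i<n. N i \<in> dual F) \<and>
    (\<forall>h\<in>funs F. (\<forall>i<n. N i h = 0) \<longrightarrow> L2_norm_sq M h \<le> (2 * \<epsilon>)\<^sup>2 * (fnorm F h)\<^sup>2)"
proof -
  have "c_err n F < ennreal (2 * \<epsilon>)"
    using c \<epsilon> by (intro le_less_trans[OF c]) (simp add: ennreal_less_iff)
  then obtain \<phi> N where \<phi>: "\<phi> \<in> vectors F n \<rightarrow> Ltwo F" and N: "N \<in> {1..n} \<rightarrow> dual F"
    and sup: "(SUP f \<in> unit_ball F. ennreal (Ltwo_norm M (\<lambda>t. f t - \<phi> (\<lambda>i\<in>{1..n}. N i f) t)))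
      < ennreal (2 * \<epsilon>)"
    unfolding c_err_def INF_less_iff by auto
  have err: "L2_norm_sq M (\<lambda>t. f t - \<phi> (\<lambda>i\<in>{1..n}. N i f) t) \<le> (2 * \<epsilon>)\<^sup>2" if "f \<in> unit_ball F" for f
  proof -
    let ?s = "L2_norm_sq M (\<lambda>t. f t - \<phi> (\<lambda>i\<in>{1..n}. N i f) t)"
    have "ennreal (sqrt ?s) \<le> ennreal (2 * \<epsilon>)"
      unfolding Ltwo_norm_L2_norm_sq[symmetric] using SUP_upper[OF that] sup
      by (meson less_imp_le order_trans)
    then have "sqrt ?s \<le> 2 * \<epsilon>" using \<epsilon> by (simp add: ennreal_le_iff)
    then have "(sqrt ?s)\<^sup>2 \<le> (2 * \<epsilon>)\<^sup>2" by (intro power_mono) auto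
    then show ?thesis by simp
  qed
  define z where "z = (\<lambda>i\<in>{1..n}. 0::complex)"
  have "z \<in> vectors F n" using of_real_scalar[of 0] by (auto simp: z_def)
  then have p: "\<phi> z \<in> square_integrable M" using \<phi> Ltwo_square_integrable by auto
  have unit: "L2_norm_sq M u \<le> (2 * \<epsilon>)\<^sup>2" if u: "u \<in> unit_ball F" and zero: "\<forall>i\<in>{1..n}. N i u = 0" for u
  proof -
    have uF: "u \<in> funs F" using u by (simp add: unit_ball_def)
    let ?v = "\<lambda>x. (-1) * u x"
    have v: "?v \<in> unit_ball F"
      using u scale_mem[OF minus_one_in_scalars[OF normed] uF]
        fnorm_scale[OF normed minus_one_in_scalars[OF normed] uF] by (simp add: unit_ball_def)
    have vF: "?v \<in> funs F" using v by (simp add: unit_ball_def)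
    have "N i ?v = 0" if "i \<in> {1..n}" for i
    proof -
      have "N i \<in> dual F" using N that by auto
      from dual_scale[OF this minus_one_in_scalars[OF normed] uF] show ?thesis
        using zero that by simp
    qed
    then have Nv: "(\<lambda>i\<in>{1..n}. N i ?v) = z" unfolding z_def by (intro restrict_ext)
    have Nu: "(\<lambda>i\<in>{1..n}. N i u) = z" unfolding z_def using zero by (intro restrict_ext) auto
    let ?a = "\<lambda>t. u t - \<phi> z t" and ?b = "\<lambda>t. ?v t - \<phi> z t"
    have a: "L2_norm_sq M ?a \<le> (2 * \<epsilon>)\<^sup>2" using err[OF u] unfolding Nu .
    have b: "L2_norm_sq M ?b \<le> (2 * \<epsilon>)\<^sup>2" using err[OF v] unfolding Nv .
    have "4 * L2_norm_sq M u = L2_norm_sq M (\<lambda>x. 2 * u x)" by (simp add: L2_norm_sq_scale)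
    also have "(\<lambda>x. 2 * u x) = (\<lambda>x. ?a x - ?b x)" by auto
    also have "L2_norm_sq M (\<lambda>x. ?a x - ?b x) \<le> 2 * L2_norm_sq M ?a + 2 * L2_norm_sq M ?b"
      by (intro L2_norm_sq_diff_le square_integrable_diff mem_square_integrable uF vF p)
    finally show ?thesis using a b by linarith
  qed
  show ?thesis
  \<comment> \<open>Functionals are numbered from 1 in \<open>c_err\<close> and from 0 here.\<close>
  proof (intro exI[of _ "\<lambda>i. N (Suc i)"] conjI allI ballI impI)
    show "N (Suc i) \<in> dual F" if "i < n" for i using N that by auto
    fix h assume h: "h \<in> funs F" and zero: "\<forall>i<n. N (Suc i) h = 0"
    have zero': "N i h = 0" if "i \<in> {1..n}" for i
      using zero that by (cases i) auto
    show "L2_norm_sq M h \<le> (2 * \<epsilon>)\<^sup>2 * (fnorm F h)\<^sup>2"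
    proof (cases "fnorm F h = 0")
      case True
      then show ?thesis using L2_norm_sq_fnorm_zero[OF h] by simp
    next
      case False
      let ?u = "\<lambda>x. complex_of_real (1 / fnorm F h) * h x"
      have "L2_norm_sq M ?u \<le> (2 * \<epsilon>)\<^sup>2"
      proof (intro unit normalise h False ballI)
        fix i assume i: "i \<in> {1..n}"
        have "N i \<in> dual F" using N i by auto
        from dual_scale[OF this of_real_scalar h, of "1 / fnorm F h"] show "N i ?u = 0"
          unfolding zero'[OF i] by (simp only: mult_zero_right)
      qed
      moreover have "L2_norm_sq M ?u = L2_norm_sq M h / (fnorm F h)\<^sup>2"
        unfolding L2_norm_sq_scale by (simp add: norm_divide power_divide)
      ultimately show ?thesis using False by (simp add: divide_le_eq)
    qed
  qed
qed

text \<open>Answer with any element of the unit ball that has the observed values. Half its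
  difference to \<open>f\<close> lies in the unit ball again and vanishes at the points, whence the
  factor 2.\<close>

lemma g_err_le:
  assumes p: "\<And>i. i < n \<Longrightarrow> p i \<in> domain_of F"
    and ker: "\<And>f. f \<in> unit_ball F \<Longrightarrow> (\<forall>i<n. f (p i) = 0) \<Longrightarrow> L2_norm_sq M f \<le> R"
  shows "g_err n F \<le> ennreal (2 * sqrt R)"
proof -
  define x where "x i = p (i - 1)" for i :: nat
  define info where "info f = (\<lambda>i\<in>{1..n}. f (x i))" for f :: "'a \<Rightarrow> complex"
  define \<phi> where "\<phi> y = (if \<exists>f\<in>unit_ball F. info f = y then SOME f. f \<in> unit_ball F \<and> info f = y
    else (\<lambda>x. 0))" for y
  have \<phi>_info: "\<phi> (info f) \<in> unit_ball F \<and> info (\<phi> (info f)) = info f" if "f \<in> unit_ball F" for f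
  proof -
    have ex: "\<exists>g. g \<in> unit_ball F \<and> info g = info f" using that by blast
    then have "\<phi> (info f) = (SOME g. g \<in> unit_ball F \<and> info g = info f)"
      unfolding \<phi>_def by auto
    with someI_ex[OF ex] show ?thesis by simp
  qed
  have "\<phi> y \<in> Ltwo F" for y
  proof (cases "\<exists>f\<in>unit_ball F. info f = y")
    case True
    then obtain f where "f \<in> unit_ball F" "y = info f" by blast
    then have "\<phi> y \<in> unit_ball F" using \<phi>_info by simp
    then show ?thesis by (simp add: unit_ball_def mem_Ltwo)
  next
    case False
    then show ?thesis using mem_Ltwo[OF zero_mem] by (auto simp: \<phi>_def)
  qed
  then have mem: "(x, \<phi>) \<in> ({1..n} \<rightarrow> domain_of F) \<times> (vectors F n \<rightarrow> Ltwo F)"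
    using p by (auto simp: x_def)
  have "g_err n F \<le> (SUP f \<in> unit_ball F. ennreal (Ltwo_norm M (\<lambda>t. f t - \<phi> (info f) t)))"
    unfolding g_err_def info_def by (rule INF_lower2[OF mem]) simp
  also have "\<dots> \<le> ennreal (2 * sqrt R)"
  proof (intro SUP_least ennreal_leI)
    fix f assume f: "f \<in> unit_ball F"
    let ?g = "\<phi> (info f)"
    have g: "?g \<in> unit_ball F" and eq: "info ?g = info f" using \<phi>_info[OF f] by auto
    have fF: "f \<in> funs F" and gF: "?g \<in> funs F" using f g by (auto simp: unit_ball_def)
    let ?h = "\<lambda>t. complex_of_real (1/2) * (f t - ?g t)"
    have d: "(\<lambda>t. f t - ?g t) \<in> funs F" by (intro diff_mem fF gF)
    have "fnorm F (\<lambda>t. f t - ?g t) \<le> 2"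
      using fnorm_diff_le[OF fF gF] f g by (simp add: unit_ball_def)
    then have h: "?h \<in> unit_ball F"
      unfolding unit_ball_def using scale_mem[OF of_real_scalar d, of "1/2"]
        fnorm_scale[OF normed of_real_scalar d, of "1/2"] by (simp add: norm_divide)
    have "L2_norm_sq M ?h \<le> R"
    proof (intro ker h allI impI)
      fix i assume "i < n"
      then show "?h (p i) = 0"
        using fun_cong[OF eq, of "Suc i"] by (simp add: info_def x_def)
    qed
    then have "L2_norm_sq M (\<lambda>t. f t - ?g t) \<le> 4 * R"
      unfolding L2_norm_sq_scale by (simp add: norm_divide power_divide)
    then have "sqrt (L2_norm_sq M (\<lambda>t. f t - ?g t)) \<le> sqrt (4 * R)" by (rule real_sqrt_le_mono)
    then show "Ltwo_norm M (\<lambda>t. f t - ?g t) \<le> 2 * sqrt R"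
      by (simp add: Ltwo_norm_L2_norm_sq real_sqrt_mult)
  qed
  finally show ?thesis .
qed

end

section \<open>Concatenation of finite families into one sequence\<close>

definition block_start :: "(nat \<Rightarrow> nat) \<Rightarrow> nat \<Rightarrow> nat" where
  "block_start n k = (\<Sum>l<k. n l)"

definition block_of :: "(nat \<Rightarrow> nat) \<Rightarrow> nat \<Rightarrow> nat" where
  "block_of n j = (LEAST k. j < block_start n (Suc k))"

lemma block_start_Suc: "block_start n (Suc k) = block_start n k + n k"
  by (simp add: block_start_def)

lemma block_start_mono: "k \<le> l \<Longrightarrow> block_start n k \<le> block_start n l"
  unfolding block_start_def by (intro sum_mono2) auto

text \<open>Nonempty blocks ensure that every index lies in some block and that the block ends tend
  to infinity.\<close>

lemma block_start_ge:
  assumes "\<And>k. 1 \<le> n k"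
  shows "k \<le> block_start n k"
proof (induction k)
  case (Suc k)
  then show ?case using assms[of k] by (simp add: block_start_Suc)
qed simp

lemma block_of_eq:
  assumes "block_start n k \<le> j" "j < block_start n (Suc k)"
  shows "block_of n j = k"
  unfolding block_of_def
proof (rule Least_equality)
  show "j < block_start n (Suc k)" by (rule assms(2))
  fix l assume "j < block_start n (Suc l)"
  then have "block_start n k < block_start n (Suc l)" using assms(1) by linarith
  then have "\<not> Suc l \<le> k" using block_start_mono[of "Suc l" k n] by linarith
  then show "k \<le> l" by simp
qed

lemma sum_blocks:
  fixes g :: "nat \<Rightarrow> 'b::comm_monoid_add"
  assumes "K \<le> L"
  shows "(\<Sum>j = block_start n K..<block_start n L. g j) =
    (\<Sum>k = K..<L. \<Sum>j = block_start n k..<block_start n (Suc k). g j)"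
  using assms
proof (induction rule: dec_induct)
  case (step L)
  have "(\<Sum>j = block_start n K..<block_start n (Suc L). g j) =
      (\<Sum>j = block_start n K..<block_start n L. g j) +
      (\<Sum>j = block_start n L..<block_start n (Suc L). g j)"
    using step.hyps by (intro sum.atLeastLessThan_concat[symmetric] block_start_mono) auto
  then show ?case using step by simp
qed simp

section \<open>From a sequence of widths to a sampling error\<close>

context fun_space_A
begin

text \<open>A function in the unit ball is a combination of the first \<open>n 0\<close> orthonormal
  functions plus noise with coefficients of energy at most 1, where the noise functions have total
  energy below \<open>\<tau>\<close>. Sampling multiplies \<open>\<tau>\<close> by at most
  \<open>n 0 + 1\<close>.\<close>

lemma g_err_le_of_widths:
  fixes n :: "nat \<Rightarrow> nat" and \<epsilon> :: "nat \<Rightarrow> real"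
  defines "\<eta> \<equiv> \<lambda>k. (2 * \<epsilon> k)\<^sup>2 * (2 * real (n k) + 1)\<^sup>2"
  assumes n: "\<And>k. 1 \<le> n k" and \<epsilon>: "\<And>k. \<epsilon> k > 0"
    and c: "\<And>k. c_err (n k) F \<le> ennreal (\<epsilon> k)"
    and summ: "summable (\<lambda>k. real (n (Suc k)) * (\<eta> k * 2 ^ Suc k))"
    and \<tau>: "(\<Sum>k. real (n (Suc k)) * (\<eta> k * 2 ^ Suc k)) < \<tau>"
  shows "g_err (n 0) F \<le> ennreal (2 * sqrt (real (n 0 + 1) * \<tau>))"
proof -
  let ?s = "block_start n" and ?blk = "block_of n"
  have "\<forall>k. \<exists>g. (\<forall>i<n k. g i \<in> funs F) \<and>
    (\<forall>f\<in>funs F. \<exists>c. L2_norm_sq M (\<lambda>x. f x - (\<Sum>i<n k. c i * g i x)) \<le> \<eta> k * (fnorm F f)\<^sup>2)"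
  proof
    fix k
    obtain N where N: "\<forall>i<n k. N i \<in> dual F"
      "\<forall>h\<in>funs F. (\<forall>i<n k. N i h = 0) \<longrightarrow> L2_norm_sq M h \<le> (2 * \<epsilon> k)\<^sup>2 * (fnorm F h)\<^sup>2"
      using gelfand_radius[OF c[of k] \<epsilon>[of k]] by (elim exE conjE) (rule that)
    show "\<exists>g. (\<forall>i<n k. g i \<in> funs F) \<and>
      (\<forall>f\<in>funs F. \<exists>c. L2_norm_sq M (\<lambda>x. f x - (\<Sum>i<n k. c i * g i x)) \<le> \<eta> k * (fnorm F f)\<^sup>2)"
      unfolding \<eta>_def by (rule kolmogorov_le_gelfand[of _ N]) (use N in auto)
  qed
  from choice[OF this] obtain g where G: "\<forall>k. (\<forall>i<n k. g k i \<in> funs F) \<and>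
    (\<forall>f\<in>funs F. \<exists>c. L2_norm_sq M (\<lambda>x. f x - (\<Sum>i<n k. c i * g k i x)) \<le> \<eta> k * (fnorm F f)\<^sup>2)"
    by (elim exE) (rule that)
  note g = G[THEN spec, THEN conjunct1, rule_format]
  note gc = G[THEN spec, THEN conjunct2, rule_format]
  have \<eta>_pos: "\<eta> k > 0" for k unfolding \<eta>_def using \<epsilon>[of k] by (intro mult_pos_pos zero_less_power) auto
  have in_block: "\<exists>k. ?s k \<le> j \<and> j < ?s (Suc k)" for j
  proof -
    have "j < ?s (Suc j)" using block_start_ge[of n "Suc j", OF n] by linarith
    then have "\<exists>k. j < ?s (Suc k)" by blast
    define k where "k = (LEAST k. j < ?s (Suc k))"
    have 1: "j < ?s (Suc k)" unfolding k_def using \<open>j < ?s (Suc j)\<close> by (rule LeastI)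
    have 2: "?s k \<le> j"
    proof (cases k)
      case 0
      then show ?thesis by (simp add: block_start_def)
    next
      case (Suc l)
      then have "\<not> j < ?s (Suc l)" using not_less_Least[of l "\<lambda>k. j < ?s (Suc k)"] by (simp add: k_def)
      then show ?thesis using Suc by simp
    qed
    from 1 2 show ?thesis by blast
  qed
  define q where "q j = g (?blk j) (j - ?s (?blk j))" for j
  have q_eq: "q j = g k (j - ?s k)" if "?s k \<le> j" "j < ?s (Suc k)" for j k
    using block_of_eq[OF that] by (simp add: q_def)
  have qF: "q j \<in> funs F" for j
  proof -
    obtain k where "?s k \<le> j" "j < ?s (Suc k)" using in_block by blast
    then show ?thesis using g[of "j - ?s k" k] by (simp add: q_eq[of k] block_start_Suc)
  qed
  have q: "q j \<in> square_integrable M" for j by (rule mem_square_integrable[OF qF])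
  define e where "e = gram_schmidt M q"
  have e: "orthonormal_or_zero M e" unfolding e_def by (rule gram_schmidt_orthonormal[OF q])
  have approx: "L2_norm_sq M (\<lambda>x. f x - fourier_sum M e (?s (Suc k)) f x) \<le> \<eta> k * (fnorm F f)\<^sup>2"
    if f: "f \<in> funs F" for f k
  proof -
    obtain c where c: "L2_norm_sq M (\<lambda>x. f x - (\<Sum>i<n k. c i * g k i x)) \<le> \<eta> k * (fnorm F f)\<^sup>2"
      using gc[OF f] by blast
    \<comment> \<open>Block \<open>k\<close> alone reaches the accuracy, so earlier blocks get
      coefficient 0; the projection onto all of them is at least as good.\<close>
    define c' where "c' j = (if ?s k \<le> j then c (j - ?s k) else 0)" for j
    have "(\<Sum>j<?s (Suc k). c' j * q j x) = (\<Sum>i<n k. c i * g k i x)" for x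
    proof -
      have "(\<Sum>j<?s (Suc k). c' j * q j x) = (\<Sum>j = ?s k..<?s k + n k. c' j * q j x)"
        by (intro sum.mono_neutral_right) (auto simp: c'_def block_start_Suc)
      also have "\<dots> = (\<Sum>j = ?s k..<?s k + n k. c (j - ?s k) * g k (j - ?s k) x)"
        by (intro sum.cong) (auto simp: c'_def q_eq[of k] block_start_Suc)
      also have "\<dots> = (\<Sum>i<n k. c i * g k i x)"
        by (rule sum.reindex_bij_witness[of _ "\<lambda>i. i + ?s k" "\<lambda>j. j - ?s k"]) auto
      finally show ?thesis .
    qed
    then have "L2_norm_sq M (\<lambda>x. f x - (\<Sum>j<?s (Suc k). c' j * q j x)) \<le> \<eta> k * (fnorm F f)\<^sup>2"
      using c by simp
    moreover have "L2_norm_sq M (\<lambda>x. f x - fourier_sum M e (?s (Suc k)) f x) \<le>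
        L2_norm_sq M (\<lambda>x. f x - (\<Sum>j<?s (Suc k). c' j * q j x))"
      unfolding e_def by (rule gram_schmidt_best_approximation[OF q mem_square_integrable[OF f]])
    ultimately show ?thesis by linarith
  qed
  \<comment> \<open>Coefficients in block \<open>k + 1\<close> have energy at most
    \<open>\<eta> k\<close>, as the blocks up to \<open>k\<close> already approximate that well. The
    factor \<open>2 ^ Suc k\<close> makes the normalised energies sum to at most 1. Block 0 is
    recovered from the samples and gets the neutral weight 1.\<close>
  define W where "W k = (case k of 0 \<Rightarrow> 1 | Suc l \<Rightarrow> \<eta> l * 2 ^ Suc l)" for k
  have W_pos: "W k > 0" for k using \<eta>_pos by (simp add: W_def split: nat.split)
  define w where "w j = W (?blk j)" for j
  have w_pos: "w j > 0" for j by (simp add: w_def W_pos)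
  have w_eq: "w j = W k" if "?s k \<le> j" "j < ?s (Suc k)" for j k
    using block_of_eq[OF that] by (simp add: w_def)
  have s0: "?s 0 = 0" and s1: "?s (Suc 0) = n 0" by (simp_all add: block_start_def)
  have w_sum: "(\<Sum>j = ?s K..<?s L. w j) = (\<Sum>k = K..<L. real (n k) * W k)" if "K \<le> L" for K L
    unfolding sum_blocks[OF that]
  proof (intro sum.cong refl)
    fix k
    have "(\<Sum>j = ?s k..<?s (Suc k). w j) = (\<Sum>j = ?s k..<?s (Suc k). W k)"
      by (intro sum.cong refl w_eq) auto
    then show "(\<Sum>j = ?s k..<?s (Suc k). w j) = real (n k) * W k"
      by (simp add: block_start_Suc)
  qed
  have tail_w: "(\<Sum>j<m. w (j + n 0)) \<le> (\<Sum>k. real (n (Suc k)) * (\<eta> k * 2 ^ Suc k))" for m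
  proof -
    have "(\<Sum>j<m. w (j + n 0)) = (\<Sum>j = n 0..<m + n 0. w j)"
      by (rule sum.reindex_bij_witness[of _ "\<lambda>j. j - n 0" "\<lambda>j. j + n 0"]) auto
    also have "\<dots> \<le> (\<Sum>j = ?s (Suc 0)..<?s (Suc m). w j)"
    proof (intro sum_mono2)
      have "m + n 0 \<le> ?s (Suc m)"
      proof -
        have "?s (Suc m) = n 0 + (\<Sum>l<m. n (Suc l))"
          by (simp add: block_start_def sum.lessThan_Suc_shift del: sum.lessThan_Suc)
        moreover have "(\<Sum>l<m. 1) \<le> (\<Sum>l<m. n (Suc l))" by (intro sum_mono n)
        ultimately show ?thesis by simp
      qed
      then show "{n 0..<m + n 0} \<subseteq> {?s (Suc 0)..<?s (Suc m)}" by (auto simp: s1)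
    qed (auto simp: w_pos less_imp_le)
    also have "\<dots> = (\<Sum>k = Suc 0..<Suc m. real (n k) * W k)" by (intro w_sum) simp
    also have "\<dots> = (\<Sum>k<m. real (n (Suc k)) * (\<eta> k * 2 ^ Suc k))"
      by (subst sum.shift_bounds_Suc_ivl) (simp add: W_def atLeast0LessThan)
    also have "\<dots> \<le> (\<Sum>k. real (n (Suc k)) * (\<eta> k * 2 ^ Suc k))"
      using \<eta>_pos[THEN less_imp_le] by (intro sum_le_suminf summ) (auto intro!: mult_nonneg_nonneg)
    finally show ?thesis .
  qed
  have summ_tail: "summable (\<lambda>j. w (j + n 0))"
    by (rule bounded_imp_summable[of _ "\<Sum>k. real (n (Suc k)) * (\<eta> k * 2 ^ Suc k)"])
       (use w_pos tail_w in \<open>auto simp: less_imp_le lessThan_Suc_atMost[symmetric] simp del: sum.lessThan_Suc\<close>)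
  then have summ_w: "summable w" by (subst (asm) summable_iff_shift)
  have "(\<Sum>j. w (j + n 0)) \<le> (\<Sum>k. real (n (Suc k)) * (\<eta> k * 2 ^ Suc k))"
    using summ_tail tail_w by (intro suminf_le_const)
  then have suminf_tail: "(\<Sum>j. w (j + n 0)) < \<tau>" using \<tau> by linarith
  have "0 \<le> (\<Sum>j. w (j + n 0))"
    using w_pos by (intro suminf_nonneg summ_tail) (simp add: less_imp_le)
  then have \<tau>_pos: "\<tau> > 0" using suminf_tail by linarith
  have summ_\<eta>: "summable \<eta>"
  proof (rule summable_comparison_test[OF _ summ])
    have "\<eta> k \<le> real (n (Suc k)) * (\<eta> k * 2 ^ Suc k)" for k
    proof -
      have "\<eta> k * 1 \<le> \<eta> k * (real (n (Suc k)) * 2 ^ Suc k)"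
      proof (intro mult_left_mono)
        have "1 * 1 \<le> real (n (Suc k)) * 2 ^ Suc k"
          using n[of "Suc k"] by (intro mult_mono one_le_power) auto
        then show "1 \<le> real (n (Suc k)) * 2 ^ Suc k" by simp
      qed (simp add: \<eta>_pos less_imp_le)
      then show ?thesis by (simp add: mult_ac)
    qed
    then show "\<exists>N. \<forall>k\<ge>N. norm (\<eta> k) \<le> real (n (Suc k)) * (\<eta> k * 2 ^ Suc k)"
      using \<eta>_pos by (auto simp: less_imp_le)
  qed
  define \<gamma> where "\<gamma> f j = (cmod (L2_inner M f (e j)))\<^sup>2 / w j" for f j
  have \<gamma>_nonneg: "0 \<le> \<gamma> f j" for f j using w_pos[of j] by (simp add: \<gamma>_def)
  have tail_\<gamma>: "(\<Sum>j = n 0..<m. \<gamma> f j) \<le> (fnorm F f)\<^sup>2" if f: "f \<in> funs F" for f m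
  proof -
    have fs: "f \<in> square_integrable M" by (rule mem_square_integrable[OF f])
    have "(\<Sum>j = n 0..<m. \<gamma> f j) \<le> (\<Sum>j = ?s (Suc 0)..<?s (Suc m). \<gamma> f j)"
    proof (rule sum_mono2)
      have "m \<le> ?s (Suc m)" using block_start_ge[of n "Suc m", OF n] by linarith
      then show "{n 0..<m} \<subseteq> {?s (Suc 0)..<?s (Suc m)}" by (auto simp: s1)
    qed (auto simp: \<gamma>_nonneg)
    also have "\<dots> = (\<Sum>k = Suc 0..<Suc m. \<Sum>j = ?s k..<?s (Suc k). \<gamma> f j)"
      by (rule sum_blocks) simp
    also have "\<dots> = (\<Sum>k<m. \<Sum>j = ?s (Suc k)..<?s (Suc (Suc k)). \<gamma> f j)"
      by (subst sum.shift_bounds_Suc_ivl) (simp add: atLeast0LessThan)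
    also have "\<dots> \<le> (\<Sum>k<m. (1/2) ^ Suc k * (fnorm F f)\<^sup>2)"
    proof (rule sum_mono)
      fix k
      have "(\<Sum>j = ?s (Suc k)..<?s (Suc (Suc k)). \<gamma> f j) =
          (\<Sum>j = ?s (Suc k)..<?s (Suc (Suc k)). (cmod (L2_inner M f (e j)))\<^sup>2) / W (Suc k)"
        unfolding sum_divide_distrib by (intro sum.cong) (auto simp: \<gamma>_def w_eq[of "Suc k"])
      also have "\<dots> \<le> (\<eta> k * (fnorm F f)\<^sup>2) / W (Suc k)"
      proof (rule divide_right_mono)
        have "?s (Suc k) \<le> ?s (Suc (Suc k))" by (rule block_start_mono) simp
        from Bessel_tail[OF e fs this] approx[OF f, of k]
        show "(\<Sum>j = ?s (Suc k)..<?s (Suc (Suc k)). (cmod (L2_inner M f (e j)))\<^sup>2) \<le> \<eta> k * (fnorm F f)\<^sup>2"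
          by (rule order_trans)
      qed (simp add: W_pos less_imp_le)
      also have "\<dots> = (1/2) ^ Suc k * (fnorm F f)\<^sup>2"
        using \<eta>_pos[of k] by (simp add: W_def field_simps power_divide)
      finally show "(\<Sum>j = ?s (Suc k)..<?s (Suc (Suc k)). \<gamma> f j) \<le> (1/2) ^ Suc k * (fnorm F f)\<^sup>2" .
    qed
    also have "\<dots> = (\<Sum>k<m. (1/2) ^ Suc k) * (fnorm F f)\<^sup>2" by (simp add: sum_distrib_right)
    also have "\<dots> \<le> 1 * (fnorm F f)\<^sup>2"
    proof (rule mult_right_mono)
      have "(\<Sum>k<m. (1/2::real) ^ Suc k) \<le> (\<Sum>k. (1/2) ^ Suc k)"
        using power_half_series by (intro sum_le_suminf) (auto simp: sums_iff)
      also have "\<dots> = 1" using power_half_series by (simp add: sums_iff)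
      finally show "(\<Sum>k<m. (1/2::real) ^ Suc k) \<le> 1" .
    qed simp
    finally show ?thesis by simp
  qed
  obtain C where C: "C \<ge> 0" "\<And>f. f \<in> funs F \<Longrightarrow> L2_norm_sq M f \<le> C * (fnorm F f)\<^sup>2"
    using embedding_bound by blast
  \<comment> \<open>The pointwise expansion also involves block 0, whose coefficients are controlled
    by the embedding constant \<open>C\<close>.\<close>
  have coeff: "(\<Sum>j<m. \<gamma> f j) \<le> (C + 1) * (fnorm F f)\<^sup>2" if f: "f \<in> funs F" for f m
  proof -
    have "(\<Sum>j<m. \<gamma> f j) \<le> (\<Sum>j\<in>{..<n 0} \<union> {n 0..<m}. \<gamma> f j)"
      by (intro sum_mono2) (auto simp: \<gamma>_nonneg)
    also have "\<dots> = (\<Sum>j<n 0. \<gamma> f j) + (\<Sum>j = n 0..<m. \<gamma> f j)"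
      by (intro sum.union_disjoint) auto
    also have "(\<Sum>j<n 0. \<gamma> f j) = (\<Sum>j<n 0. (cmod (L2_inner M f (e j)))\<^sup>2)"
      using s0 s1 by (intro sum.cong) (auto simp: \<gamma>_def w_eq[of 0] W_def)
    also have "\<dots> \<le> C * (fnorm F f)\<^sup>2"
      using Bessel[OF e mem_square_integrable[OF f]] C(2)[OF f] by (rule order_trans)
    finally show ?thesis using tail_\<gamma>[OF f, of m] by (simp add: distrib_right)
  qed
  have "\<exists>X. (AE x in M. x \<in> X) \<and> X \<subseteq> domain_of F \<and>
    (\<forall>x\<in>X. summable (\<lambda>j. w j * (cmod (e j x))\<^sup>2)) \<and>
    (\<forall>f\<in>funs F. \<forall>x\<in>X. (\<lambda>j. L2_inner M f (e j) * e j x) sums f x)"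
  proof (rule pointwise_expansion[OF e w_pos summ_w _ _ summ_\<eta> approx])
    show "(\<Sum>j<m. (cmod (L2_inner M f (e j)))\<^sup>2 / w j) \<le> (C + 1) * (fnorm F f)\<^sup>2" if "f \<in> funs F" for f m
      using coeff[OF that] by (simp add: \<gamma>_def)
    show "filterlim (\<lambda>k. ?s (Suc k)) at_top sequentially"
    proof (rule filterlim_at_top_mono[OF filterlim_ident])
      show "\<forall>\<^sub>F k in sequentially. k \<le> ?s (Suc k)"
        using block_start_ge[of n, OF n] block_start_mono[of _ "Suc _" n]
        by (intro always_eventually allI) (meson Suc_leD)
    qed
  qed
  then obtain X where X: "AE x in M. x \<in> X" "X \<subseteq> domain_of F"
    and Xw': "\<forall>x\<in>X. summable (\<lambda>j. w j * (cmod (e j x))\<^sup>2)"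
    and Xf': "\<forall>f\<in>funs F. \<forall>x\<in>X. (\<lambda>j. L2_inner M f (e j) * e j x) sums f x"
    by (elim exE conjE) (rule that)
  note Xw = Xw'[rule_format] and Xf = Xf'[rule_format]
  \<comment> \<open>The roots of the weights move from the coefficients to the functions:
    \<open>b\<close> has summable energy, and the matching coefficients \<open>a\<close> below have
    energy at most 1.\<close>
  define b where "b j = (\<lambda>x. complex_of_real (sqrt (w (j + n 0))) * e (j + n 0) x)" for j
  \<comment> \<open>The dimension left in block 0, less than \<open>n 0\<close> if Gram-Schmidt
    produced zero functions there.\<close>
  define t where "t = card {i. i < n 0 \<and> L2_norm_sq M (e i) = 1}"
  have "\<exists>p. (\<forall>i<t. p i \<in> X) \<and>
    (\<forall>f u a. f \<in> square_integrable M \<longrightarrow>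
      (\<forall>x\<in>X. f x = (\<Sum>i<n 0. u i * e i x) + (\<Sum>j. a j * b j x)) \<longrightarrow>
      summable (\<lambda>j. (cmod (a j))\<^sup>2) \<longrightarrow> (\<Sum>j. (cmod (a j))\<^sup>2) \<le> 1 \<longrightarrow>
      (\<forall>i<t. f (p i) = 0) \<longrightarrow> L2_norm_sq M f \<le> real (t + 1) * \<tau>)"
  proof (rule sampling_points[OF X(1)])
    show "e i \<in> square_integrable M" for i by (rule orthonormal_square_integrable[OF e])
    show "b j \<in> square_integrable M" for j
      unfolding b_def by (intro square_integrable_scale orthonormal_square_integrable[OF e])
    show "L2_inner M (b j) (e i) = 0" if "i < n 0" for i j
      using that orthonormal_orth[OF e, of "j + n 0" i] by (simp add: b_def L2_inner_scale_left)
    show "e i x = (\<Sum>k<n 0. L2_inner M (e i) (e k) * e k x)" if i: "i < n 0" for i x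
    proof -
      have "(\<Sum>k<n 0. L2_inner M (e i) (e k) * e k x) = (\<Sum>k<n 0. if k = i then e i x else 0)"
        using orthonormal_orth[OF e, of i] orthonormal_parseval[OF e, of i x]
        by (intro sum.cong) auto
      then show ?thesis using i by simp
    qed
    have "(\<Sum>i<n 0. L2_norm_sq M (e i)) = (\<Sum>i<n 0. if L2_norm_sq M (e i) = 1 then 1 else 0)"
      using L2_norm_sq_orthonormal[OF e] by (intro sum.cong) auto
    also have "\<dots> = real t" by (simp add: t_def sum.If_cases Collect_conj_eq lessThan_def)
    finally show "(\<Sum>i<n 0. L2_norm_sq M (e i)) = real t" .
    have "(\<Sum>j. ennreal (L2_norm_sq M (b j))) \<le> (\<Sum>j. ennreal (w (j + n 0)))"
    proof (intro suminf_le summableI ennreal_leI)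
      show "L2_norm_sq M (b j) \<le> w (j + n 0)" for j
        using L2_norm_sq_orthonormal[OF e, of "j + n 0"] w_pos[of "j + n 0"]
        unfolding b_def L2_norm_sq_scale by auto
    qed
    also have "\<dots> = ennreal (\<Sum>j. w (j + n 0))"
      using w_pos by (intro suminf_ennreal2 summ_tail) (auto simp: less_imp_le)
    also have "\<dots> < ennreal \<tau>"
      using \<tau>_pos suminf_tail by (rule ennreal_lessI)
    finally show "(\<Sum>j. ennreal (L2_norm_sq M (b j))) < ennreal \<tau>" .
    show "summable (\<lambda>j. (cmod (b j x))\<^sup>2)" if "x \<in> X" for x
    proof -
      have "(cmod (b j x))\<^sup>2 = w (j + n 0) * (cmod (e (j + n 0) x))\<^sup>2" for j
        using w_pos[of "j + n 0"] by (simp add: b_def norm_mult power_mult_distrib)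
      then show ?thesis
        using summable_ignore_initial_segment[OF Xw[OF that], of "n 0"] by simp
    qed
  qed
  then obtain p where p: "\<forall>i<t. p i \<in> X"
    and main: "\<forall>f u a. f \<in> square_integrable M \<longrightarrow>
      (\<forall>x\<in>X. f x = (\<Sum>i<n 0. u i * e i x) + (\<Sum>j. a j * b j x)) \<longrightarrow>
      summable (\<lambda>j. (cmod (a j))\<^sup>2) \<longrightarrow> (\<Sum>j. (cmod (a j))\<^sup>2) \<le> 1 \<longrightarrow>
      (\<forall>i<t. f (p i) = 0) \<longrightarrow> L2_norm_sq M f \<le> real (t + 1) * \<tau>"
    by (elim exE conjE) (rule that)
  have t_le: "t \<le> n 0" unfolding t_def using card_mono[of "{..<n 0}" "{i. i < n 0 \<and> L2_norm_sq M (e i) = 1}"] by auto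
  \<comment> \<open>Samples beyond the \<open>t\<close> chosen points are all taken at
    \<open>x0\<close>.\<close>
  obtain x0 where x0: "x0 \<in> domain_of F" using normed by (auto simp: normed_fun_space_def)
  show ?thesis
  proof (rule g_err_le)
    show "(if i < t then p i else x0) \<in> domain_of F" for i using p X(2) x0 by auto
    fix f assume fB: "f \<in> unit_ball F" and zero: "\<forall>i<n 0. f (if i < t then p i else x0) = 0"
    have f: "f \<in> funs F" and f1: "fnorm F f \<le> 1" using fB by (auto simp: unit_ball_def)
    define a where "a j = L2_inner M f (e (j + n 0)) / complex_of_real (sqrt (w (j + n 0)))" for j
    have a2: "(cmod (a j))\<^sup>2 = \<gamma> f (j + n 0)" for j
      using w_pos[of "j + n 0"] by (simp add: a_def \<gamma>_def norm_divide power_divide)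
    have a_le: "(\<Sum>j<m. (cmod (a j))\<^sup>2) \<le> 1" for m
    proof -
      have "(\<Sum>j<m. (cmod (a j))\<^sup>2) = (\<Sum>j = n 0..<m + n 0. \<gamma> f j)"
        unfolding a2 by (rule sum.reindex_bij_witness[of _ "\<lambda>j. j - n 0" "\<lambda>j. j + n 0"]) auto
      also have "\<dots> \<le> (fnorm F f)\<^sup>2" by (rule tail_\<gamma>[OF f])
      also have "\<dots> \<le> 1" using f1 fnorm_ge_0[OF f] by (simp add: power_le_one)
      finally show ?thesis .
    qed
    have a_summ: "summable (\<lambda>j. (cmod (a j))\<^sup>2)"
      by (rule bounded_imp_summable[of _ 1])
         (use a_le in \<open>auto simp: lessThan_Suc_atMost[symmetric] simp del: sum.lessThan_Suc\<close>)
    have a_1: "(\<Sum>j. (cmod (a j))\<^sup>2) \<le> 1" using a_summ a_le by (intro suminf_le_const)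
    have rep: "\<forall>x\<in>X. f x = (\<Sum>i<n 0. L2_inner M f (e i) * e i x) + (\<Sum>j. a j * b j x)"
    proof
      fix x assume x: "x \<in> X"
      have "a j * b j x = L2_inner M f (e (j + n 0)) * e (j + n 0) x" for j
        using w_pos[of "j + n 0"] by (simp add: a_def b_def)
      moreover have "f x = (\<Sum>j. L2_inner M f (e (j + n 0)) * e (j + n 0) x) + (\<Sum>i<n 0. L2_inner M f (e i) * e i x)"
        using suminf_split_initial_segment[OF sums_summable[OF Xf[OF f x]], of "n 0"] sums_unique[OF Xf[OF f x]]
        by simp
      ultimately show "f x = (\<Sum>i<n 0. L2_inner M f (e i) * e i x) + (\<Sum>j. a j * b j x)" by simp
    qed
    have zero': "\<forall>i<t. f (p i) = 0"
    proof (intro allI impI)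
      fix i assume "i < t"
      then show "f (p i) = 0" using zero[rule_format, of i] t_le by simp
    qed
    have "L2_norm_sq M f \<le> real (t + 1) * \<tau>"
      by (rule main[rule_format (no_asm), OF mem_square_integrable[OF f] rep a_summ a_1 zero'])
    also have "\<dots> \<le> real (n 0 + 1) * \<tau>"
      using t_le \<tau>_pos by (intro mult_right_mono) auto
    finally show "L2_norm_sq M f \<le> real (n 0 + 1) * \<tau>" .
  qed
qed

end

section \<open>Tractability\<close>

text \<open>The limit as a one-sided bound, the quotient being nonnegative. Asking for some
  admissible \<open>n\<close> instead of the minimum avoids infinite complexities and extended
  reals.\<close>

definition tractable_wrt :: "info_class \<Rightarrow> (nat \<Rightarrow> 'a fun_space) \<Rightarrow> (nat \<Rightarrow> real \<Rightarrow> real) \<Rightarrow> bool" where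
  "tractable_wrt \<Lambda> F D \<longleftrightarrow> (\<forall>\<delta>>0. \<exists>R. \<forall>d \<epsilon>. 1 \<le> d \<longrightarrow> 0 < \<epsilon> \<longrightarrow> \<epsilon> < 1 \<longrightarrow> R \<le> real d + inverse \<epsilon> \<longrightarrow>
     (\<exists>n\<ge>1. min_err \<Lambda> n (F d) \<le> ennreal \<epsilon> \<and> ln (real n) \<le> \<delta> * D d \<epsilon>))"

lemma eventually_tract_filter:
  "eventually P tract_filter \<longleftrightarrow>
     (\<exists>R. \<forall>d \<epsilon>. 1 \<le> d \<longrightarrow> 0 < \<epsilon> \<longrightarrow> \<epsilon> < 1 \<longrightarrow> R \<le> real d + inverse \<epsilon> \<longrightarrow> P (d, \<epsilon>))"
  unfolding tract_filter_def eventually_inf_principal eventually_filtercomap_at_top_linorder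
  by auto

lemma info_complexity_attained:
  assumes "info_complexity \<Lambda> \<epsilon> F = enat k"
  shows "1 \<le> k \<and> min_err \<Lambda> k F \<le> ennreal \<epsilon>"
proof -
  let ?A = "enat ` {n. 1 \<le> n \<and> min_err \<Lambda> n F \<le> ennreal \<epsilon>}"
  have Inf: "Inf ?A = enat k" using assms by (simp add: info_complexity_def)
  then have "?A \<noteq> {}" by (metis Inf_empty enat.distinct(1) top_enat_def)
  then have "Inf ?A \<in> ?A" by (rule wellorder_InfI[OF ex_in_conv[THEN iffD2, THEN someI_ex]])
  then show ?thesis unfolding Inf by auto
qed

lemma info_complexity_le:
  assumes "1 \<le> n" "min_err \<Lambda> n F \<le> ennreal \<epsilon>"
  shows "info_complexity \<Lambda> \<epsilon> F \<le> enat n"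
  unfolding info_complexity_def using assms by (intro Inf_lower) auto

lemma ln_info_complexity_nonneg: "0 \<le> ln_enat (info_complexity \<Lambda> \<epsilon> F)"
proof (cases "info_complexity \<Lambda> \<epsilon> F")
  case (enat k)
  then show ?thesis using info_complexity_attained[OF enat] by (simp add: ln_enat_def)
qed (simp add: ln_enat_def)

lemma ln_info_complexity_le_iff:
  "ln_enat (info_complexity \<Lambda> \<epsilon> F) \<le> ereal c \<longleftrightarrow>
     (\<exists>n\<ge>1. min_err \<Lambda> n F \<le> ennreal \<epsilon> \<and> ln (real n) \<le> c)"
proof
  assume le: "ln_enat (info_complexity \<Lambda> \<epsilon> F) \<le> ereal c"
  show "\<exists>n\<ge>1. min_err \<Lambda> n F \<le> ennreal \<epsilon> \<and> ln (real n) \<le> c"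
  proof (cases "info_complexity \<Lambda> \<epsilon> F")
    case (enat k)
    then show ?thesis using info_complexity_attained[OF enat] le by (auto simp: ln_enat_def)
  qed (use le in \<open>simp add: ln_enat_def\<close>)
next
  assume "\<exists>n\<ge>1. min_err \<Lambda> n F \<le> ennreal \<epsilon> \<and> ln (real n) \<le> c"
  then obtain n where n: "1 \<le> n" "min_err \<Lambda> n F \<le> ennreal \<epsilon>" "ln (real n) \<le> c" by blast
  obtain k where k: "info_complexity \<Lambda> \<epsilon> F = enat k" "k \<le> n"
    using info_complexity_le[OF n(1,2)] by (cases "info_complexity \<Lambda> \<epsilon> F") auto
  have "ln (real k) \<le> ln (real n)" using info_complexity_attained[OF k(1)] k(2) by simp
  then show "ln_enat (info_complexity \<Lambda> \<epsilon> F) \<le> ereal c" using n(3) by (simp add: ln_enat_def k(1))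
qed

lemma ereal_divide_le_iff:
  assumes "0 < D"
  shows "x / ereal D \<le> ereal \<delta> \<longleftrightarrow> x \<le> ereal (\<delta> * D)"
  using assms by (cases x) (auto simp: field_simps)

lemma tendsto_tract_filter_iff:
  assumes D: "\<And>d \<epsilon>. 1 \<le> d \<Longrightarrow> 0 < \<epsilon> \<Longrightarrow> \<epsilon> < 1 \<Longrightarrow> 0 < D d \<epsilon>"
  shows "((\<lambda>(d, \<epsilon>). ln_enat (info_complexity \<Lambda> \<epsilon> (F d)) / ereal (D d \<epsilon>)) \<longlongrightarrow> 0) tract_filter \<longleftrightarrow>
    tractable_wrt \<Lambda> F D"
proof -
  let ?f = "\<lambda>(d, \<epsilon>). ln_enat (info_complexity \<Lambda> \<epsilon> (F d)) / ereal (D d \<epsilon>)"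
  have ev: "eventually (\<lambda>x. ?f x \<le> ereal \<delta>) tract_filter \<longleftrightarrow>
    (\<exists>R. \<forall>d \<epsilon>. 1 \<le> d \<longrightarrow> 0 < \<epsilon> \<longrightarrow> \<epsilon> < 1 \<longrightarrow> R \<le> real d + inverse \<epsilon> \<longrightarrow>
     (\<exists>n\<ge>1. min_err \<Lambda> n (F d) \<le> ennreal \<epsilon> \<and> ln (real n) \<le> \<delta> * D d \<epsilon>))" for \<delta>
    unfolding eventually_tract_filter
    by (intro arg_cong[where f = Ex] ext all_cong1 imp_cong refl)
       (simp add: ereal_divide_le_iff[OF D] ln_info_complexity_le_iff)
  have nonneg: "eventually (\<lambda>x. 0 \<le> ?f x) tract_filter"
  proof -
    have *: "0 \<le> x / ereal c" if "0 \<le> x" "0 < c" for x c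
      using that by (cases x) auto
    show ?thesis
      unfolding eventually_tract_filter
      by (intro exI[of _ 0] allI impI) (simp add: * D ln_info_complexity_nonneg)
  qed
  show ?thesis
    unfolding tractable_wrt_def ev[symmetric]
  proof
    assume lim: "(?f \<longlongrightarrow> 0) tract_filter"
    show "\<forall>\<delta>>0. eventually (\<lambda>x. ?f x \<le> ereal \<delta>) tract_filter"
    proof (intro allI impI)
      fix \<delta> :: real assume "\<delta> > 0"
      then have "eventually (\<lambda>x. ?f x < ereal \<delta>) tract_filter"
        using order_tendstoD(2)[OF lim, of "ereal \<delta>"] by simp
      then show "eventually (\<lambda>x. ?f x \<le> ereal \<delta>) tract_filter"
        by (rule eventually_mono) (rule less_imp_le)
    qed
  next
    assume *: "\<forall>\<delta>>0. eventually (\<lambda>x. ?f x \<le> ereal \<delta>) tract_filter"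
    show "(?f \<longlongrightarrow> 0) tract_filter"
    proof (rule order_tendstoI)
      fix l :: ereal assume "l < 0"
      then show "eventually (\<lambda>x. l < ?f x) tract_filter"
        by (intro eventually_mono[OF nonneg]) (rule less_le_trans)
    next
      fix u :: ereal assume "0 < u"
      then obtain \<delta> where \<delta>: "0 < ereal \<delta>" "ereal \<delta> < u" using ereal_dense2 by blast
      then have "eventually (\<lambda>x. ?f x \<le> ereal \<delta>) tract_filter" using * by simp
      then show "eventually (\<lambda>x. ?f x < u) tract_filter"
        by (rule eventually_mono) (rule le_less_trans[OF _ \<delta>(2)])
    qed
  qed
qed

lemma tractable_wrt_mono:
  assumes "tractable_wrt \<Lambda> F D"
    and "\<And>d \<epsilon>. 1 \<le> d \<Longrightarrow> 0 < \<epsilon> \<Longrightarrow> \<epsilon> < 1 \<Longrightarrow> D d \<epsilon> \<le> D' d \<epsilon>"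
  shows "tractable_wrt \<Lambda> F D'"
  unfolding tractable_wrt_def
proof (intro allI impI)
  fix \<delta> :: real assume \<delta>: "\<delta> > 0"
  with assms(1) obtain R where R: "\<And>d \<epsilon>. 1 \<le> d \<Longrightarrow> 0 < \<epsilon> \<Longrightarrow> \<epsilon> < 1 \<Longrightarrow> R \<le> real d + inverse \<epsilon> \<Longrightarrow>
     (\<exists>n\<ge>1. min_err \<Lambda> n (F d) \<le> ennreal \<epsilon> \<and> ln (real n) \<le> \<delta> * D d \<epsilon>)"
    unfolding tractable_wrt_def by blast
  show "\<exists>R. \<forall>d \<epsilon>. 1 \<le> d \<longrightarrow> 0 < \<epsilon> \<longrightarrow> \<epsilon> < 1 \<longrightarrow> R \<le> real d + inverse \<epsilon> \<longrightarrow>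
     (\<exists>n\<ge>1. min_err \<Lambda> n (F d) \<le> ennreal \<epsilon> \<and> ln (real n) \<le> \<delta> * D' d \<epsilon>)"
  proof (intro exI[of _ R] allI impI)
    fix d :: nat and \<epsilon> :: real assume a: "1 \<le> d" "0 < \<epsilon>" "\<epsilon> < 1" "R \<le> real d + inverse \<epsilon>"
    obtain n where n: "n \<ge> 1" "min_err \<Lambda> n (F d) \<le> ennreal \<epsilon>" "ln (real n) \<le> \<delta> * D d \<epsilon>"
      using R[OF a] by blast
    have "\<delta> * D d \<epsilon> \<le> \<delta> * D' d \<epsilon>" using \<delta> assms(2)[OF a(1-3)] by (intro mult_left_mono) auto
    with n show "\<exists>n\<ge>1. min_err \<Lambda> n (F d) \<le> ennreal \<epsilon> \<and> ln (real n) \<le> \<delta> * D' d \<epsilon>"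
      by (intro exI[of _ n]) auto
  qed
qed

text \<open>
  With accuracies \<open>(\<rho> / 2 ^ k) ^ 4\<close> a bound \<open>n k * (\<rho> / 2 ^ k) \<le> A\<close> on the numbers of functionals
  says that they grow at most like the fourth root of the inverse accuracy.
\<close>

lemma g_err_le_of_polynomial_widths:
  fixes F :: "'a fun_space" and n :: "nat \<Rightarrow> nat"
  assumes F: "F \<in> class_A" and n: "\<And>k. 1 \<le> n k" and \<rho>: "0 < \<rho>" "\<rho> \<le> 1" and A: "A \<ge> 1"
    and c: "\<And>k. c_err (n k) F \<le> ennreal ((\<rho> / 2 ^ k) ^ 4)"
    and growth: "\<And>k. real (n k) * (\<rho> / 2 ^ k) \<le> A"
  shows "g_err (n 0) F \<le> ennreal (2 * sqrt (600 * A ^ 4 * \<rho>))"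
proof -
  interpret fun_space_A F by unfold_locales (rule F)
  define r where "r k = \<rho> / 2 ^ k" for k :: nat
  have r: "0 < r k" "r k \<le> 1" for k
    using \<rho> by (auto simp: r_def divide_le_eq intro: order_trans[OF _ one_le_power])
  define \<eta> where "\<eta> k = (2 * r k ^ 4)\<^sup>2 * (2 * real (n k) + 1)\<^sup>2" for k
  have term_nonneg: "0 \<le> real (n (Suc k)) * (\<eta> k * 2 ^ Suc k)" for k
    by (simp add: \<eta>_def)
  \<comment> \<open>The squared accuracy supplies eight powers of \<open>r k\<close>. Two of them
    absorb \<open>n k\<close> squared and one absorbs \<open>n (Suc k)\<close>, each at the cost of
    a factor \<open>A\<close>. Of the five left, two turn \<open>2 ^ k\<close> into
    \<open>\<rho>^2 * (1/2)^k\<close>, and the others are bounded by 1.\<close>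
  have term_le: "real (n (Suc k)) * (\<eta> k * 2 ^ Suc k) \<le> 144 * A ^ 3 * \<rho>\<^sup>2 * (1/2) ^ k" for k
  proof -
    have g: "real (n k) * r k \<le> A" "real (n (Suc k)) * r (Suc k) \<le> A"
      using growth[of k] growth[of "Suc k"] unfolding r_def by blast+
    have n1: "1 \<le> real (n k)" using n[of k] by simp
    have "(2 * real (n k) + 1) * r k \<le> 3 * A"
    proof -
      have "(2 * real (n k) + 1) * r k \<le> (3 * real (n k)) * r k"
        using n1 r[of k] by (intro mult_right_mono) auto
      then show ?thesis using g(1) by simp
    qed
    then have "((2 * real (n k) + 1) * r k)\<^sup>2 \<le> (3 * A)\<^sup>2"
      using r[of k] by (intro power_mono) auto
    then have "4 * r k ^ 6 * ((2 * real (n k) + 1) * r k)\<^sup>2 \<le> 4 * r k ^ 6 * (3 * A)\<^sup>2"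
      using r[of k] by (intro mult_left_mono) auto
    moreover have "\<eta> k = 4 * r k ^ 6 * ((2 * real (n k) + 1) * r k)\<^sup>2"
      by (simp add: \<eta>_def power_mult_distrib power_mult[symmetric] power_add[symmetric])
    ultimately have \<eta>: "\<eta> k \<le> 36 * A\<^sup>2 * r k ^ 6" by (simp add: power_mult_distrib)
    have "real (n (Suc k)) * (\<eta> k * 2 ^ Suc k) \<le> real (n (Suc k)) * (36 * A\<^sup>2 * r k ^ 6 * 2 ^ Suc k)"
      using \<eta> by (intro mult_left_mono mult_right_mono) auto
    also have "\<dots> = (real (n (Suc k)) * r (Suc k)) * (144 * A\<^sup>2 * r k ^ 5 * 2 ^ k)"
    proof -
      have "r k ^ 6 = r k * r k ^ 5" by (simp add: eval_nat_numeral)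
      moreover have "r (Suc k) = r k / 2" by (simp add: r_def)
      ultimately show ?thesis by simp
    qed
    also have "\<dots> \<le> A * (144 * A\<^sup>2 * r k ^ 5 * 2 ^ k)"
      using g(2) r[of k] by (intro mult_right_mono) auto
    also have "\<dots> \<le> A * (144 * A\<^sup>2 * (r k)\<^sup>2 * 2 ^ k)"
      using A r[of k] by (intro mult_left_mono mult_right_mono power_decreasing) auto
    also have "\<dots> = 144 * A ^ 3 * \<rho>\<^sup>2 * (1/2) ^ k"
      by (simp add: r_def power_divide power2_eq_square power3_eq_cube field_simps)
    finally show ?thesis .
  qed
  have geo: "(\<lambda>k. 144 * A ^ 3 * \<rho>\<^sup>2 * (1/2) ^ k) sums (144 * A ^ 3 * \<rho>\<^sup>2 * 2)"
    using sums_mult[OF geometric_sums[of "1/2 :: real"], of "144 * A ^ 3 * \<rho>\<^sup>2"] by simp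
  have summ: "summable (\<lambda>k. real (n (Suc k)) * (\<eta> k * 2 ^ Suc k))"
    by (rule summable_comparison_test[OF _ sums_summable[OF geo]])
       (use term_le term_nonneg in \<open>auto simp del: power_Suc\<close>)
  have "(\<Sum>k. real (n (Suc k)) * (\<eta> k * 2 ^ Suc k)) \<le> 144 * A ^ 3 * \<rho>\<^sup>2 * 2"
    unfolding sums_unique[OF geo] by (intro suminf_le term_le summ sums_summable[OF geo])
  \<comment> \<open>The bound with \<open>\<tau>\<close> has to be strict, so 288 is rounded
    up.\<close>
  also have "\<dots> < 300 * A ^ 3 * \<rho>\<^sup>2" using A \<rho> by simp
  finally have "g_err (n 0) F \<le> ennreal (2 * sqrt (real (n 0 + 1) * (300 * A ^ 3 * \<rho>\<^sup>2)))"
    using n r(1) c summ unfolding \<eta>_def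
    by (intro g_err_le_of_widths[where \<epsilon> = "\<lambda>k. r k ^ 4"]) (auto simp: r_def)
  also have "\<dots> \<le> ennreal (2 * sqrt (600 * A ^ 4 * \<rho>))"
  proof (intro ennreal_leI mult_left_mono real_sqrt_le_mono)
    \<comment> \<open>Replacing \<open>n 0 + 1\<close> by \<open>2 * n 0\<close> gives the 600; one
      factor \<open>\<rho>\<close> is spent on bounding \<open>n 0 * \<rho>\<close> by
      \<open>A\<close>.\<close>
    have "real (n 0 + 1) * (300 * A ^ 3 * \<rho>\<^sup>2) \<le> (2 * real (n 0)) * (300 * A ^ 3 * \<rho>\<^sup>2)"
      using n[of 0] A by (intro mult_right_mono) auto
    also have "\<dots> = (real (n 0) * \<rho>) * (600 * A ^ 3 * \<rho>)" by (simp add: power2_eq_square)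
    also have "\<dots> \<le> A * (600 * A ^ 3 * \<rho>)"
      using growth[of 0] A \<rho> by (intro mult_right_mono) auto
    also have "\<dots> = 600 * A ^ 4 * \<rho>" by (simp add: power_eq_if)
    finally show "real (n 0 + 1) * (300 * A ^ 3 * \<rho>\<^sup>2) \<le> 600 * A ^ 4 * \<rho>" .
  qed simp
  finally show ?thesis .
qed

text \<open>For \<open>\<alpha> = \<beta> = 1\<close> and accuracies in the unit interval this is
  also the denominator of exponential weak tractability, so one argument serves both
  notions.\<close>

definition exp_scale :: "real \<Rightarrow> real \<Rightarrow> nat \<Rightarrow> real \<Rightarrow> real" where
  "exp_scale \<alpha> \<beta> d \<epsilon> = real d powr \<alpha> + (1 + ln (inverse \<epsilon>)) powr \<beta>"

lemma powr_le_self: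
  fixes x \<beta> :: real
  assumes "1 \<le> x" "\<beta> \<le> 1"
  shows "x powr \<beta> \<le> x"
  using powr_mono[OF assms(2,1)] assms(1) by simp

lemma powr_sum_le:
  fixes x y \<beta> :: real
  assumes "1 \<le> x" "1 \<le> y" "0 < \<beta>" "\<beta> \<le> 1"
  shows "(40 * (x + y)) powr \<beta> \<le> 80 * (x + y powr \<beta>)"
proof -
  define m where "m = max x y"
  have "(40 * (x + y)) powr \<beta> \<le> (80 * m) powr \<beta>"
    using assms by (intro powr_mono2) (auto simp: m_def)
  also have "\<dots> = 80 powr \<beta> * m powr \<beta>"
    using assms by (intro powr_mult)
  also have "\<dots> \<le> 80 * m powr \<beta>"
    using powr_le_self[of 80 \<beta>] assms by (intro mult_right_mono) auto
  also have "m powr \<beta> \<le> x + y powr \<beta>"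
  proof (cases "x \<le> y")
    case True
    then show ?thesis using assms by (simp add: m_def)
  next
    case False
    then have "m powr \<beta> \<le> x" using powr_le_self[of x \<beta>] assms by (simp add: m_def)
    then show ?thesis by (simp add: add_increasing2)
  qed
  finally show ?thesis by simp
qed

lemma ln_2400_le: "ln (2400 :: real) \<le> 8"
proof -
  have "(2400 :: real) \<le> (27 / 10) ^ 8" by (simp add: power_divide)
  also have "\<dots> \<le> exp 1 ^ 8"
  proof (rule power_mono)
    show "(27 / 10 :: real) \<le> exp 1" using abs_le_D2[OF e_approx_32] by simp
  qed simp
  also have "\<dots> = exp 8" by (simp add: exp_of_nat_mult[symmetric])
  finally show ?thesis by (simp add: ln_le_cancel_iff[symmetric] del: ln_le_cancel_iff)
qed

lemma one_le_one_plus_ln_inverse: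
  fixes x :: real
  assumes "0 < x" "x \<le> 1"
  shows "1 \<le> 1 + ln (inverse x)"
  using assms by (simp add: one_le_inverse)

text \<open>For \<open>\<beta> \<le> 1\<close> the assumption bounds \<open>ln n\<close> at accuracy
  \<open>r ^ 4\<close> linearly in \<open>ln (1 / r)\<close> with slope at most 1, so the numbers of
  functionals grow polynomially with a constant \<open>A\<close> depending on \<open>d\<close>. An
  error \<open>\<epsilon>\<close> then requires the accuracy \<open>\<rho> ^ 4\<close> with
  \<open>\<rho>\<close> of order \<open>\<epsilon>^2 / A^4\<close>. As \<open>ln A\<close> is linear
  in \<open>P\<close>, the scale at \<open>\<rho> ^ 4\<close> is at most a constant times the scale
  at \<open>\<epsilon>\<close>.\<close>

lemma std_tractable_of_all_tractable:
  fixes F :: "nat \<Rightarrow> 'a fun_space"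
  assumes F: "\<And>d. d \<ge> 1 \<Longrightarrow> F d \<in> class_A"
    and \<alpha>: "0 < \<alpha>" and \<beta>: "0 < \<beta>" "\<beta> \<le> 1"
    and all: "tractable_wrt Lambda_all F (exp_scale \<alpha> \<beta>)"
  shows "tractable_wrt Lambda_std F (exp_scale \<alpha> \<beta>)"
  unfolding tractable_wrt_def
proof (intro allI impI)
  fix \<delta>' :: real assume \<delta>': "\<delta>' > 0"
  \<comment> \<open>The bound 1/4 makes the slope \<open>4 * \<delta>\<close> at most 1, and 81 is
    the loss between the scales at \<open>\<rho> ^ 4\<close> and \<open>\<epsilon>\<close>.\<close>
  define \<delta> where "\<delta> = min (1/4) (\<delta>' / 81)"
  have \<delta>: "0 < \<delta>" "\<delta> \<le> 1/4" "81 * \<delta> \<le> \<delta>'" using \<delta>' by (auto simp: \<delta>_def min_def)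
  obtain R where R: "\<And>d \<epsilon>. 1 \<le> d \<Longrightarrow> 0 < \<epsilon> \<Longrightarrow> \<epsilon> < 1 \<Longrightarrow> R \<le> real d + inverse \<epsilon> \<Longrightarrow>
     (\<exists>n\<ge>1. min_err Lambda_all n (F d) \<le> ennreal \<epsilon> \<and> ln (real n) \<le> \<delta> * exp_scale \<alpha> \<beta> d \<epsilon>)"
    using all \<delta>(1) unfolding tractable_wrt_def by blast
  show "\<exists>R. \<forall>d \<epsilon>. 1 \<le> d \<longrightarrow> 0 < \<epsilon> \<longrightarrow> \<epsilon> < 1 \<longrightarrow> R \<le> real d + inverse \<epsilon> \<longrightarrow>
     (\<exists>n\<ge>1. min_err Lambda_std n (F d) \<le> ennreal \<epsilon> \<and> ln (real n) \<le> \<delta>' * exp_scale \<alpha> \<beta> d \<epsilon>)"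
  proof (intro exI[of _ R] allI impI)
    fix d :: nat and \<epsilon> :: real
    assume d: "1 \<le> d" and \<epsilon>: "0 < \<epsilon>" "\<epsilon> < 1" and Rd: "R \<le> real d + inverse \<epsilon>"
    define P where "P = real d powr \<alpha>"
    have P: "1 \<le> P" unfolding P_def using d \<alpha> by (intro ge_one_powr_ge_zero) auto
    define A where "A = exp (\<delta> * (P + 1))"
    have A: "1 \<le> A" using \<delta>(1) P by (simp add: A_def)
    have lnA: "ln A = \<delta> * (P + 1)" by (simp add: A_def)
    \<comment> \<open>The solution of
      \<open>2 * sqrt (600 * A ^ 4 * \<rho>) = \<epsilon>\<close>.\<close>
    define \<rho> where "\<rho> = \<epsilon>\<^sup>2 / (2400 * A ^ 4)"
    have A4: "1 \<le> A ^ 4" using A by (rule one_le_power)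
    have \<rho>0: "0 < \<rho>" using \<epsilon> A by (simp add: \<rho>_def)
    have \<rho>\<epsilon>: "\<rho> \<le> \<epsilon>"
    proof -
      have "\<rho> \<le> \<epsilon>\<^sup>2 / 1" unfolding \<rho>_def using A4 by (intro divide_left_mono) auto
      also have "\<dots> \<le> \<epsilon> ^ 1" using \<epsilon> power_decreasing[of 1 2 \<epsilon>] by simp
      finally show ?thesis by simp
    qed
    have \<rho>1: "\<rho> \<le> 1" using \<rho>\<epsilon> \<epsilon> by linarith
    define r where "r k = \<rho> / 2 ^ k" for k :: nat
    have r0: "0 < r k" for k using \<rho>0 by (simp add: r_def)
    have r_le: "r k \<le> \<rho>" for k
      using \<rho>0 by (simp add: r_def divide_le_eq)
    \<comment> \<open>All accuracies in use are at most \<open>\<epsilon>\<close>, so the threshold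
      \<open>R\<close> is met by them as soon as \<open>\<epsilon>\<close> meets it.\<close>
    have r4_le: "r k ^ 4 \<le> \<epsilon>" for k
    proof -
      have "r k ^ 4 \<le> r k ^ 1" using r0[of k] r_le[of k] \<rho>1 by (intro power_decreasing) auto
      then show ?thesis using r_le[of k] \<rho>\<epsilon> by simp
    qed
    have "\<exists>n\<ge>1. c_err n (F d) \<le> ennreal (r k ^ 4) \<and> ln (real n) \<le> \<delta> * exp_scale \<alpha> \<beta> d (r k ^ 4)" for k
    proof -
      have "inverse \<epsilon> \<le> inverse (r k ^ 4)" using r4_le[of k] r0[of k] by (intro le_imp_inverse_le) auto
      then have "R \<le> real d + inverse (r k ^ 4)" using Rd by linarith
      then show ?thesis using R[of d "r k ^ 4"] d r0[of k] r4_le[of k] \<epsilon> by simp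
    qed
    then obtain n where n: "\<And>k. 1 \<le> n k" "\<And>k. c_err (n k) (F d) \<le> ennreal (r k ^ 4)"
      and ln_n: "\<And>k. ln (real (n k)) \<le> \<delta> * exp_scale \<alpha> \<beta> d (r k ^ 4)" by metis
    have growth: "real (n k) * r k \<le> A" for k
    proof -
      have r41: "0 < r k ^ 4" "r k ^ 4 \<le> 1" using r0[of k] r4_le[of k] \<epsilon> by auto
      have "(1 + ln (inverse (r k ^ 4))) powr \<beta> \<le> 1 + ln (inverse (r k ^ 4))"
        using one_le_one_plus_ln_inverse[OF r41] \<beta> by (intro powr_le_self) auto
      moreover have "ln (inverse (r k ^ 4)) = - (4 * ln (r k))"
        using r0[of k] by (simp add: ln_inverse ln_realpow)
      ultimately have "exp_scale \<alpha> \<beta> d (r k ^ 4) \<le> P + 1 - 4 * ln (r k)"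
        unfolding exp_scale_def P_def by linarith
      then have "\<delta> * exp_scale \<alpha> \<beta> d (r k ^ 4) \<le> \<delta> * (P + 1 - 4 * ln (r k))"
        using \<delta>(1) by (intro mult_left_mono) auto
      with ln_n[of k] have "ln (real (n k)) \<le> ln A + (4 * \<delta>) * (- ln (r k))"
        by (simp add: lnA algebra_simps)
      also have "(4 * \<delta>) * (- ln (r k)) \<le> 1 * (- ln (r k))"
      proof (rule mult_right_mono)
        show "0 \<le> - ln (r k)" using r0[of k] r_le[of k] \<rho>1 by (simp add: ln_le_zero_iff)
      qed (use \<delta> in simp)
      finally have "ln (real (n k)) + ln (r k) \<le> ln A" by simp
      then have "ln (real (n k) * r k) \<le> ln A"
        using n(1)[of k] r0[of k] by (simp add: ln_mult)
      moreover have "0 < real (n k) * r k" using n(1)[of k] r0[of k] by (intro mult_pos_pos) auto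
      ultimately show ?thesis using A by (simp add: ln_le_cancel_iff)
    qed
    have "g_err (n 0) (F d) \<le> ennreal (2 * sqrt (600 * A ^ 4 * \<rho>))"
      using F[OF d] n \<rho>0 \<rho>1 A growth unfolding r_def by (intro g_err_le_of_polynomial_widths)
    also have "600 * A ^ 4 * \<rho> = (\<epsilon> / 2)\<^sup>2"
      using A by (simp add: \<rho>_def power_divide)
    also have "2 * sqrt ((\<epsilon> / 2)\<^sup>2) = \<epsilon>" using \<epsilon> by simp
    finally have g: "g_err (n 0) (F d) \<le> ennreal \<epsilon>" .
    define L where "L = 1 + ln (inverse \<epsilon>)"
    have L: "1 \<le> L" using one_le_one_plus_ln_inverse[of \<epsilon>] \<epsilon> by (simp add: L_def)
    have "1 + ln (inverse (\<rho> ^ 4)) = 1 + 4 * (2 * (L - 1) + ln 2400 + 4 * ln A)"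
    proof -
      have "ln \<rho> = 2 * ln \<epsilon> - (ln 2400 + 4 * ln A)"
        using \<epsilon> A by (simp add: \<rho>_def ln_div ln_mult ln_realpow)
      then show ?thesis using \<rho>0 \<epsilon> by (simp add: L_def ln_inverse ln_realpow)
    qed
    \<comment> \<open>Here \<open>4 * ln 2400\<close> is at most 32 and \<open>16 * ln A\<close> at
      most \<open>4 * (P + 1)\<close>. The total \<open>8 * L + 4 * P + 29\<close> is absorbed
      because \<open>P\<close> and \<open>L\<close> are at least 1.\<close>
    also have "\<dots> \<le> 40 * (P + L)"
    proof -
      have "ln A \<le> 1/4 * (P + 1)" unfolding lnA using \<delta>(2) P by (intro mult_right_mono) auto
      then show ?thesis using ln_2400_le P L by simp
    qed
    finally have L0: "1 + ln (inverse (\<rho> ^ 4)) \<le> 40 * (P + L)" .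
    have "\<rho> ^ 4 \<le> 1" using \<rho>0 \<rho>1 by (simp add: power_le_one)
    then have "(1 + ln (inverse (\<rho> ^ 4))) powr \<beta> \<le> (40 * (P + L)) powr \<beta>"
      using L0 one_le_one_plus_ln_inverse[of "\<rho> ^ 4"] \<rho>0 \<beta> by (intro powr_mono2) auto
    also have "\<dots> \<le> 80 * (P + L powr \<beta>)" using P L \<beta> by (rule powr_sum_le)
    finally have "exp_scale \<alpha> \<beta> d (\<rho> ^ 4) \<le> P + 80 * (P + L powr \<beta>)"
      by (simp add: exp_scale_def P_def)
    also have "\<dots> \<le> 81 * exp_scale \<alpha> \<beta> d \<epsilon>"
      by (simp add: exp_scale_def P_def L_def)
    finally have scale: "exp_scale \<alpha> \<beta> d (\<rho> ^ 4) \<le> 81 * exp_scale \<alpha> \<beta> d \<epsilon>" .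
    have "ln (real (n 0)) \<le> \<delta> * exp_scale \<alpha> \<beta> d (\<rho> ^ 4)" using ln_n[of 0] by (simp add: r_def)
    also have "\<dots> \<le> \<delta> * (81 * exp_scale \<alpha> \<beta> d \<epsilon>)"
      using \<delta>(1) scale by (intro mult_left_mono) auto
    also have "\<dots> = (81 * \<delta>) * exp_scale \<alpha> \<beta> d \<epsilon>" by simp
    also have "\<dots> \<le> \<delta>' * exp_scale \<alpha> \<beta> d \<epsilon>"
      using \<delta>(3) by (intro mult_right_mono) (auto simp: exp_scale_def)
    finally show "\<exists>n\<ge>1. min_err Lambda_std n (F d) \<le> ennreal \<epsilon> \<and> ln (real n) \<le> \<delta>' * exp_scale \<alpha> \<beta> d \<epsilon>"
      using g n(1)[of 0] by (intro exI[of _ "n 0"]) simp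
  qed
qed

lemma exp_scale_pos: "1 \<le> d \<Longrightarrow> 0 < exp_scale \<alpha> \<beta> d \<epsilon>"
  unfolding exp_scale_def by (intro add_pos_nonneg) auto

lemma exp_unif_weakly_tractable_iff:
  "exp_unif_weakly_tractable \<Lambda> F \<longleftrightarrow> (\<forall>\<alpha>>0. \<forall>\<beta>>0. tractable_wrt \<Lambda> F (exp_scale \<alpha> \<beta>))"
  unfolding exp_unif_weakly_tractable_def exp_scale_def[symmetric]
  by (simp add: tendsto_tract_filter_iff exp_scale_pos)

text \<open>A power with exponent 1 is the base itself only for nonnegative bases, so the two scales
  are compared for \<open>0 < \<epsilon> < 1\<close> only.\<close>

lemma exp_weakly_tractable_iff:
  "exp_weakly_tractable \<Lambda> F \<longleftrightarrow> tractable_wrt \<Lambda> F (exp_scale 1 1)"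
proof -
  have eq: "real d + (1 + ln (inverse \<epsilon>)) = exp_scale 1 1 d \<epsilon>" if "0 < \<epsilon>" "\<epsilon> < 1" for d \<epsilon>
  proof -
    have "0 \<le> 1 + ln (inverse \<epsilon>)" using that one_le_one_plus_ln_inverse[of \<epsilon>] by simp
    then show ?thesis by (simp only: exp_scale_def powr_one of_nat_0_le_iff)
  qed
  have "exp_weakly_tractable \<Lambda> F \<longleftrightarrow> tractable_wrt \<Lambda> F (\<lambda>d \<epsilon>. real d + (1 + ln (inverse \<epsilon>)))"
    unfolding exp_weakly_tractable_def
    by (rule tendsto_tract_filter_iff) (simp add: eq exp_scale_pos)
  also have "\<dots> \<longleftrightarrow> tractable_wrt \<Lambda> F (exp_scale 1 1)"
    by (intro iffI; elim tractable_wrt_mono) (simp_all add: eq)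
  finally show ?thesis .
qed

theorem theorem7:
  fixes F :: "nat \<Rightarrow> 'a fun_space"
  assumes "\<And>d. d \<ge> 1 \<Longrightarrow> F d \<in> class_A"
  shows "(exp_weakly_tractable Lambda_all F \<longrightarrow> exp_weakly_tractable Lambda_std F) \<and>
         (exp_unif_weakly_tractable Lambda_all F \<longrightarrow> exp_unif_weakly_tractable Lambda_std F)"
proof (intro conjI impI)
  assume "exp_weakly_tractable Lambda_all F"
  then show "exp_weakly_tractable Lambda_std F"
    unfolding exp_weakly_tractable_iff using assms
    by (intro std_tractable_of_all_tractable) auto
next
  assume all: "exp_unif_weakly_tractable Lambda_all F"
  show "exp_unif_weakly_tractable Lambda_std F"
    unfolding exp_unif_weakly_tractable_iff
  proof (intro allI impI)
    fix \<alpha> \<beta> :: real assume \<alpha>: "0 < \<alpha>" and \<beta>: "0 < \<beta>"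
    have "tractable_wrt Lambda_std F (exp_scale \<alpha> (min \<beta> 1))"
    proof (rule std_tractable_of_all_tractable[OF assms])
      show "tractable_wrt Lambda_all F (exp_scale \<alpha> (min \<beta> 1))"
        using all \<alpha> \<beta> by (simp add: exp_unif_weakly_tractable_iff)
    qed (use \<alpha> \<beta> in auto)
    then show "tractable_wrt Lambda_std F (exp_scale \<alpha> \<beta>)"
    proof (rule tractable_wrt_mono)
      fix d :: nat and \<epsilon> :: real assume "0 < \<epsilon>" "\<epsilon> < 1"
      then have "1 \<le> 1 + ln (inverse \<epsilon>)" by (intro one_le_one_plus_ln_inverse) auto
      then show "exp_scale \<alpha> (min \<beta> 1) d \<epsilon> \<le> exp_scale \<alpha> \<beta> d \<epsilon>"
        unfolding exp_scale_def by (intro add_left_mono powr_mono) auto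
    qed
  qed
qed

end
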